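(* Let $k\ge 1$ and $n\ge k$ be integers, let $g\in \mathsf{S}_n$ be a permutation having exactly $k$ orbits on $\{1,2,\ldots,n\}$, and let $\chi$ be an irreducible complex character of $\mathsf{S}_n$. If $g$ has at least one fixed point, then $$|\chi(g)|\le (k-1)!.$$ Moreover, this bound is sharp: for every integer $k\ge 1$ there exist an integer $n\ge k$, an element $g\in \mathsf{S}_n$ with exactly $k$ orbits on $\{1,\ldots,n\}$, at least one of which has size $1$, and an irreducible complex character $\chi$ of $\mathsf{S}_n$ such that $|\chi(g)|=(k-1)!$.
   Context: $\mathsf{S}_n$ denotes the symmetric group on $\{1,\ldots,n\}$. Orbits of $g$ means orbits of the cyclic group $\langle g\rangle$; fixed points count as orbits of size $1$. *)

theory Defs
  imports
    "Jordan_Normal_Form.VS_Connect"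
    "HOL-Algebra.Sym_Groups"
    "HOL-Algebra.Group_Action"
begin

definition general_linear_group :: "nat \<Rightarrow> complex mat monoid" where
  "general_linear_group d = units_of (ring_mat TYPE(complex) d ())"

definition matrix_representation ::
    "('g, 'b) monoid_scheme \<Rightarrow> nat \<Rightarrow> ('g \<Rightarrow> complex mat) \<Rightarrow> bool" where
  "matrix_representation G d \<rho> \<longleftrightarrow> \<rho> \<in> hom G (general_linear_group d)"

definition invariant_subspace ::
    "('g, 'b) monoid_scheme \<Rightarrow> nat \<Rightarrow> ('g \<Rightarrow> complex mat) \<Rightarrow> complex vec set \<Rightarrow> bool" where
  "invariant_subspace G d \<rho> W \<longleftrightarrow>
     VectorSpace.subspace class_ring W (module_vec TYPE(complex) d) \<and>
     (\<forall>x\<in>carrier G. \<forall>w\<in>W. \<rho> x *\<^sub>v w \<in> W)"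

definition irreducible_representation ::
    "('g, 'b) monoid_scheme \<Rightarrow> nat \<Rightarrow> ('g \<Rightarrow> complex mat) \<Rightarrow> bool" where
  "irreducible_representation G d \<rho> \<longleftrightarrow>
     matrix_representation G d \<rho> \<and> d > 0 \<and>
     (\<forall>W. invariant_subspace G d \<rho> W \<longrightarrow> W = {0\<^sub>v d} \<or> W = carrier_vec d)"

definition mat_trace :: "complex mat \<Rightarrow> complex" where
  "mat_trace A = (\<Sum>i<dim_row A. A $$ (i, i))"

text \<open>Only the values of \<open>\<chi>\<close> on the carrier of \<open>G\<close> are constrained.\<close>

definition irreducible_character ::
    "('g, 'b) monoid_scheme \<Rightarrow> ('g \<Rightarrow> complex) \<Rightarrow> bool" where
  "irreducible_character G \<chi> \<longleftrightarrow>
     (\<exists>d \<rho>. irreducible_representation G d \<rho> \<and>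
            (\<forall>x\<in>carrier G. \<chi> x = mat_trace (\<rho> x)))"

definition perm_orbits :: "nat \<Rightarrow> (nat \<Rightarrow> nat) \<Rightarrow> nat set set" where
  "perm_orbits n g = Group_Action.orbits (subgroup_generated (sym_group n) {g}) {1..n} (\<lambda>h. h)"

end

theory Submission
  imports
    Defs
    "HOL-Combinatorics.Orbits"
    "HOL-Algebra.Elementary_Groups"
    "Jordan_Normal_Form.Schur_Decomposition"
    "Jordan_Normal_Form.Spectral_Radius"
    "Jordan_Normal_Form.DL_Rank"
begin

text \<open>
  Irreducible characters of the symmetric group are compared with the class functions \<open>s\<^sub>\<beta>\<close> defined
  by the Murnaghan--Nakayama recursion on bead configurations. Hook addition and hook removal
  satisfy Heisenberg commutation relations, so that
  \<open>\<Sum>\<^sub>\<beta> s\<^sub>\<beta>(g) s\<^sub>\<beta>(h)\<close> counts the elements conjugating \<open>g\<close> into \<open>h\<close>, because both sides obey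
  the same recursion on orbits. Moreover \<open>s\<^sub>\<beta>\<close> is an integral combination of
  permutation characters on colourings. Hence the coefficients of an irreducible character along
  the \<open>s\<^sub>\<beta>\<close> are integers whose squares sum to one (up to the \<open>n!\<close> orderings of the beads), and
  every irreducible character is some \<open>\<plusminus>s\<^sub>\<beta>\<close>.

  For the bound, remove a largest orbit, of size \<open>l\<close>, first. All beads that can move down by \<open>l\<close> can
  do so simultaneously, hence there are at most \<open>n / l\<close> of them (fewer than \<open>n\<close> if \<open>l = 1\<close>), which is less
  than \<open>k\<close> when there is a fixed point; induction gives \<open>(k - 1)!\<close>. Equality holds for the \<open>k \<times> k\<close> square partition and the
  cycle type with \<open>k - 1\<close> cycles of length \<open>k + 1\<close> and one fixed point.
\<close>

section \<open>Hook operators on bead configurations\<close>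

text \<open>In terms of symmetric functions, \<open>add_hook N m\<close> is multiplication by the
  power sum \<open>p_m\<close> in Schur coordinates, and \<open>remove_hook N m\<close> is its
  adjoint \<open>m d/dp_m\<close>. This description of the adjoint relies on all low positions being
  occupied, so the number of beads is kept at least as large as the degree; in the application both
  equal \<open>n\<close>. Integrality comes from traces of averaging projections: pairing a
  character with a permutation character gives a natural number. Every permutation turns out to be
  conjugate to its inverse, so the norm of an irreducible character becomes the bilinear sum of
  \<open>\<chi> x * \<chi> x\<close>, to which the Gram identity applies. The fixed point matters in
  the count: the \<open>k - 1\<close> other orbits of size at most \<open>l\<close> give
  \<open>n \<le> 1 + (k - 1) l\<close>, hence fewer than \<open>k\<close> movable beads unless
  \<open>l = 1\<close>. The square is chosen because \<open>k^2 = 1 + (k - 1)(k + 1)\<close> makes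
  this an equality, and its \<open>k - 1\<close> movable beads can be moved in any order.\<close>

definition alternating :: "nat \<Rightarrow> ((nat \<Rightarrow> nat) \<Rightarrow> int) \<Rightarrow> bool" where
  "alternating N s \<longleftrightarrow> (\<forall>\<beta> \<tau>. \<tau> permutes {..<N} \<longrightarrow> s (\<beta> \<circ> \<tau>) = sign \<tau> * s \<beta>)"

text \<open>
  A partition with at most \<open>N\<close> parts is encoded by its beta-set \<open>{\<lambda>\<^sub>i + N - i}\<close>, listed in arbitrary order
  as \<open>\<beta> 0, \<dots>, \<beta> (N - 1)\<close> and continued by the identity outside \<open>{..<N}\<close>. With this convention the
  orderings of the empty partition are the permutations of \<open>{..<N}\<close>, and the leg-length signs of the
  Murnaghan--Nakayama rule are absorbed into the antisymmetry under reordering.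
\<close>

definition ground :: "nat \<Rightarrow> (nat \<Rightarrow> nat) \<Rightarrow> int" where
  "ground N \<beta> = (if \<beta> permutes {..<N} then sign \<beta> else 0)"

text \<open>Acting on functions, it raises the degree by \<open>m\<close>, so the configuration in
  the argument loses a hook: one bead moves down. Moves onto an occupied position are summed too;
  alternating functions vanish there.\<close>

definition add_hook :: "nat \<Rightarrow> nat \<Rightarrow> ((nat \<Rightarrow> nat) \<Rightarrow> int) \<Rightarrow> (nat \<Rightarrow> nat) \<Rightarrow> int" where
  "add_hook N m s \<beta> = (\<Sum>i<N. if m \<le> \<beta> i then s (\<beta>(i := \<beta> i - m)) else 0)"

definition remove_hook :: "nat \<Rightarrow> nat \<Rightarrow> ((nat \<Rightarrow> nat) \<Rightarrow> int) \<Rightarrow> (nat \<Rightarrow> nat) \<Rightarrow> int" where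
  "remove_hook N m s \<beta> = (\<Sum>i<N. s (\<beta>(i := \<beta> i + m)))"

text \<open>The coefficient of a Schur function in the product \<open>p_M\<close> of power sums. The
  fold runs in an unspecified order and is meaningful once the hook operators are known to
  commute.\<close>

definition beta_char :: "nat \<Rightarrow> nat multiset \<Rightarrow> (nat \<Rightarrow> nat) \<Rightarrow> int" where
  "beta_char N M = fold_mset (add_hook N) (ground N) M"

text \<open>\<open>t\<close> is the size of the partition plus \<open>\<Sum>{..<N}\<close>.
  Configurations with two beads on one position are included and contribute zero to sums of
  alternating functions; fixing the values from \<open>N\<close> on makes the set finite.\<close>

definition bead_configs :: "nat \<Rightarrow> nat \<Rightarrow> (nat \<Rightarrow> nat) set" where
  "bead_configs N t = {\<beta>. (\<forall>i\<ge>N. \<beta> i = i) \<and> sum \<beta> {..<N} = t}"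

section \<open>Antisymmetry under reordering of the beads\<close>

lemma alternating_eq_0:
  assumes "alternating N s" "i < N" "j < N" "i \<noteq> j" "\<beta> i = \<beta> j"
  shows "s \<beta> = 0"
proof -
  have "Transposition.transpose i j permutes {..<N}" using assms by (intro permutes_swap_id) auto
  then have "s (\<beta> \<circ> Transposition.transpose i j) = sign (Transposition.transpose i j) * s \<beta>"
    using assms(1) unfolding alternating_def by blast
  moreover have "\<beta> \<circ> Transposition.transpose i j = \<beta>"
    using assms(5) by (auto simp: fun_eq_iff Transposition.transpose_def)
  ultimately show ?thesis using assms(4) by (simp add: sign_swap_id)
qed

lemma alternating_inj:
  assumes "alternating N s" "s \<beta> \<noteq> 0"
  shows "inj_on \<beta> {..<N}"
  using alternating_eq_0[OF assms(1)] assms(2) by (auto simp: inj_on_def)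

lemma alternating_ground: "alternating N (ground N)"
  unfolding alternating_def
proof (intro allI impI)
  fix \<beta> \<tau> :: "nat \<Rightarrow> nat" assume \<tau>: "\<tau> permutes {..<N}"
  show "ground N (\<beta> \<circ> \<tau>) = sign \<tau> * ground N \<beta>"
  proof (cases "\<beta> permutes {..<N}")
    case True
    then have "permutation \<beta>" "permutation \<tau>"
      using \<tau> by (auto simp: permutation_permutes)
    then show ?thesis
      using True \<tau> by (simp add: ground_def permutes_compose sign_compose mult.commute)
  next
    case False
    have "\<not> (\<beta> \<circ> \<tau>) permutes {..<N}"
    proof
      assume "(\<beta> \<circ> \<tau>) permutes {..<N}"
      then have "(\<beta> \<circ> \<tau> \<circ> inv' \<tau>) permutes {..<N}"
        by (rule permutes_compose[OF permutes_inv[OF \<tau>]])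
      then show False
        using False permutes_inv_o(1)[OF \<tau>] by (simp add: comp_assoc)
    qed
    then show ?thesis using False by (simp add: ground_def)
  qed
qed

lemma fun_upd_comp_permutes:
  assumes "\<tau> permutes S"
  shows "(\<beta> \<circ> \<tau>)(i := x) = (\<beta>(\<tau> i := x)) \<circ> \<tau>"
  using permutes_inj[OF assms] by (auto simp: fun_eq_iff inj_eq)

lemma alternating_add_hook:
  assumes "alternating N s"
  shows "alternating N (add_hook N m s)"
  unfolding alternating_def
proof (intro allI impI)
  fix \<beta> \<tau> :: "nat \<Rightarrow> nat" assume \<tau>: "\<tau> permutes {..<N}"
  have "add_hook N m s (\<beta> \<circ> \<tau>)
      = (\<Sum>i<N. sign \<tau> * (if m \<le> \<beta> (\<tau> i) then s (\<beta>(\<tau> i := \<beta> (\<tau> i) - m)) else 0))"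
    using assms \<tau> unfolding add_hook_def alternating_def
    by (intro sum.cong refl) (auto simp: fun_upd_comp_permutes[OF \<tau>])
  also have "\<dots> = (\<Sum>i<N. sign \<tau> * (if m \<le> \<beta> i then s (\<beta>(i := \<beta> i - m)) else 0))"
    by (rule sum.permute[OF \<tau>, symmetric, unfolded comp_def])
  finally show "add_hook N m s (\<beta> \<circ> \<tau>) = sign \<tau> * add_hook N m s \<beta>"
    by (simp add: add_hook_def sum_distrib_left)
qed

lemma alternating_remove_hook:
  assumes "alternating N s"
  shows "alternating N (remove_hook N m s)"
  unfolding alternating_def
proof (intro allI impI)
  fix \<beta> \<tau> :: "nat \<Rightarrow> nat" assume \<tau>: "\<tau> permutes {..<N}"
  have "remove_hook N m s (\<beta> \<circ> \<tau>) = (\<Sum>i<N. sign \<tau> * s (\<beta>(\<tau> i := \<beta> (\<tau> i) + m)))"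
    using assms \<tau> unfolding remove_hook_def alternating_def
    by (intro sum.cong refl) (auto simp: fun_upd_comp_permutes[OF \<tau>])
  also have "\<dots> = (\<Sum>i<N. sign \<tau> * s (\<beta>(i := \<beta> i + m)))"
    by (rule sum.permute[OF \<tau>, symmetric, unfolded comp_def])
  finally show "remove_hook N m s (\<beta> \<circ> \<tau>) = sign \<tau> * remove_hook N m s \<beta>"
    by (simp add: remove_hook_def sum_distrib_left)
qed

lemma add_hook_double:
  "add_hook N m (add_hook N l s) \<beta> = (\<Sum>i<N. \<Sum>j<N. if m \<le> \<beta> i \<and> l \<le> (\<beta>(i := \<beta> i - m)) j
     then s (\<beta>(i := \<beta> i - m, j := (\<beta>(i := \<beta> i - m)) j - l)) else 0)"
  unfolding add_hook_def by (intro sum.cong refl) (auto intro!: sum.cong)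

text \<open>Two distinct beads move independently, and for one bead moved twice both orders require
  \<open>m + l \<le> \<beta> i\<close>.\<close>

lemma add_hook_commute: "add_hook N m (add_hook N l s) = add_hook N l (add_hook N m s)"
proof
  fix \<beta>
  show "add_hook N m (add_hook N l s) \<beta> = add_hook N l (add_hook N m s) \<beta>"
    unfolding add_hook_double
  proof (subst sum.swap, intro sum.cong refl)
    fix i j
    show "(if m \<le> \<beta> j \<and> l \<le> (\<beta>(j := \<beta> j - m)) i
         then s (\<beta>(j := \<beta> j - m, i := (\<beta>(j := \<beta> j - m)) i - l)) else 0)
       = (if l \<le> \<beta> i \<and> m \<le> (\<beta>(i := \<beta> i - l)) j
         then s (\<beta>(i := \<beta> i - l, j := (\<beta>(i := \<beta> i - l)) j - m)) else 0)"
      by (cases "i = j") (auto simp: fun_upd_twist add.commute)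
  qed
qed

interpretation add_hook: comp_fun_commute "add_hook N" for N
  by unfold_locales (auto simp: fun_eq_iff add_hook_commute)

lemma beta_char_empty [simp]: "beta_char N {#} = ground N"
  by (simp add: beta_char_def)

lemma beta_char_add [simp]: "beta_char N (add_mset m M) = add_hook N m (beta_char N M)"
  by (simp add: beta_char_def)

lemma alternating_beta_char: "alternating N (beta_char N M)"
  by (induction M) (simp_all add: alternating_ground alternating_add_hook)

text \<open>Each hook contributes its length to the sum of the positions, and the orderings of the
  empty partition have sum \<open>\<Sum>{..<N}\<close>.\<close>

lemma beta_char_in_bead_configs:
  assumes "beta_char N M \<beta> \<noteq> 0"
  shows "\<beta> \<in> bead_configs N (\<Sum>{..<N} + sum_mset M)"
  using assms
proof (induction M arbitrary: \<beta>)
  case empty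
  then have "\<beta> permutes {..<N}" by (auto simp: ground_def split: if_splits)
  then show ?case
    using sum.permute[of \<beta> "{..<N}" id] by (auto simp: bead_configs_def permutes_def)
next
  case (add m M)
  then obtain i where i: "i < N" "m \<le> \<beta> i" "beta_char N M (\<beta>(i := \<beta> i - m)) \<noteq> 0"
    by (auto simp: add_hook_def elim!: sum.not_neutral_contains_not_neutral split: if_splits)
  from add.IH[OF i(3)] have st: "\<beta>(i := \<beta> i - m) \<in> bead_configs N (\<Sum>{..<N} + sum_mset M)" .
  have "sum (\<beta>(i := \<beta> i - m)) {..<N} = (\<beta> i - m) + sum \<beta> ({..<N} - {i})"
    using i(1) by (subst sum.remove[of _ i]) (auto intro!: sum.cong)
  moreover have "sum \<beta> {..<N} = \<beta> i + sum \<beta> ({..<N} - {i})"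
    using i(1) by (subst sum.remove[of _ i]) auto
  ultimately show ?case
    using st i unfolding bead_configs_def by (auto split: if_splits)
qed

section \<open>Lower bounds for sums of bead positions\<close>

lemma sum_lessThan_card_le: "finite X \<Longrightarrow> \<Sum>{..<card X} \<le> \<Sum>(X :: nat set)"
proof (induction X rule: finite_linorder_max_induct)
  case (insert b A)
  then have "A \<subseteq> {..<b}" by auto
  then have "card A \<le> b" using card_mono[of "{..<b}" A] by simp
  moreover have "b \<notin> A" using insert by auto
  ultimately show ?case using insert by (simp add: lessThan_Suc)
qed simp

text \<open>Adding the missing value \<open>v\<close> yields \<open>card X + 1\<close> distinct
  numbers, whose sum is at least that of the smallest ones.\<close>

lemma sum_missing_value:
  assumes "finite X" "(v :: nat) \<notin> X"
  shows "\<Sum>{..<card X} + card X \<le> \<Sum>X + v"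
  using sum_lessThan_card_le[of "insert v X"] assms by (simp add: lessThan_Suc)

lemma sum_inj_on_ge:
  fixes \<beta> :: "nat \<Rightarrow> nat"
  assumes "inj_on \<beta> {..<N}"
  shows "\<Sum>{..<N} \<le> sum \<beta> {..<N}"
  using sum_lessThan_card_le[of "\<beta> ` {..<N}"] assms
  by (simp add: card_image sum.reindex)

text \<open>A partition whose beta-set leaves \<open>v\<close> free has size at least
  \<open>N - v\<close>, since avoiding \<open>v\<close> raises the sum of \<open>N\<close> distinct
  positions by at least that much above the minimum.\<close>

lemma beta_char_occupied:
  assumes "beta_char N M \<beta> \<noteq> 0" "sum_mset M + v < N"
  shows "v \<in> \<beta> ` {..<N}"
proof (rule ccontr)
  assume "v \<notin> \<beta> ` {..<N}"
  moreover have "inj_on \<beta> {..<N}" using assms(1) by (rule alternating_inj[OF alternating_beta_char])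
  ultimately have "\<Sum>{..<N} + N \<le> sum \<beta> {..<N} + v"
    using sum_missing_value[of "\<beta> ` {..<N}" v] by (simp add: card_image sum.reindex)
  then show False
    using beta_char_in_bead_configs[OF assms(1)] assms(2) by (simp add: bead_configs_def)
qed

text \<open>Moves of two distinct beads commute. For one bead, going up first allows
  \<open>m \<le> \<beta> i + l\<close> while going down first demands
  \<open>m \<le> \<beta> i\<close>, so the commutator is a boundary sum over beads below
  \<open>m\<close>.\<close>

lemma remove_add_hook:
  "remove_hook N l (add_hook N m s) \<beta> = add_hook N m (remove_hook N l s) \<beta>
     + (\<Sum>i<N. if \<beta> i < m \<and> m \<le> \<beta> i + l then s (\<beta>(i := \<beta> i + l - m)) else 0)"
proof -
  \<comment> \<open>\<open>F\<close> collects the pairs of distinct beads, \<open>E\<close> and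
    \<open>E'\<close> the cases where one bead makes both moves.\<close>
  define F where "F i j = (if i \<noteq> j \<and> m \<le> \<beta> j then s (\<beta>(i := \<beta> i + l, j := \<beta> j - m)) else 0)" for i j
  define E where "E i = (if m \<le> \<beta> i + l then s (\<beta>(i := \<beta> i + l - m)) else 0)" for i
  define E' where "E' i = (if m \<le> \<beta> i then s (\<beta>(i := \<beta> i + l - m)) else 0)" for i
  have "remove_hook N l (add_hook N m s) \<beta> = (\<Sum>i<N. \<Sum>j<N. F i j + (if j = i then E i else 0))"
    unfolding remove_hook_def add_hook_def F_def E_def
    by (intro sum.cong refl) auto
  also have "\<dots> = (\<Sum>i<N. \<Sum>j<N. F i j) + (\<Sum>i<N. E i)"
    by (simp add: sum.distrib sum.delta)
  finally have 1: "remove_hook N l (add_hook N m s) \<beta> = (\<Sum>i<N. \<Sum>j<N. F i j) + (\<Sum>i<N. E i)" .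
  have "add_hook N m (remove_hook N l s) \<beta> = (\<Sum>j<N. \<Sum>i<N. F i j + (if i = j then E' j else 0))"
    unfolding remove_hook_def add_hook_def
  proof (rule sum.cong[OF refl])
    fix j
    show "(if m \<le> \<beta> j then \<Sum>i<N. s (\<beta>(j := \<beta> j - m, i := (\<beta>(j := \<beta> j - m)) i + l)) else 0)
        = (\<Sum>i<N. F i j + (if i = j then E' j else 0))"
    proof (cases "m \<le> \<beta> j")
      case True
      then show ?thesis
        unfolding if_P[OF True] F_def E'_def by (intro sum.cong refl) (auto simp: fun_upd_twist)
    next
      case False
      then show ?thesis unfolding F_def E'_def by simp
    qed
  qed
  also have "\<dots> = (\<Sum>j<N. \<Sum>i<N. F i j) + (\<Sum>j<N. E' j)"
    by (simp add: sum.distrib sum.delta)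
  also have "(\<Sum>j<N. \<Sum>i<N. F i j) = (\<Sum>i<N. \<Sum>j<N. F i j)" by (rule sum.swap)
  finally have 2: "add_hook N m (remove_hook N l s) \<beta> = (\<Sum>i<N. \<Sum>j<N. F i j) + (\<Sum>i<N. E' i)" .
  have "(\<Sum>i<N. E i) = (\<Sum>i<N. E' i)
     + (\<Sum>i<N. if \<beta> i < m \<and> m \<le> \<beta> i + l then s (\<beta>(i := \<beta> i + l - m)) else 0)"
    unfolding sum.distrib[symmetric] E_def E'_def by (intro sum.cong refl) auto
  then show ?thesis using 1 2 by simp
qed

text \<open>All positions below \<open>m\<close> are occupied wherever \<open>beta_char N M\<close>
  is nonzero. For \<open>l = m\<close> the move is trivial and exactly \<open>m\<close> beads lie
  below \<open>m\<close>. For \<open>l \<noteq> m\<close> the moved bead vacates its position below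
  \<open>m\<close>, which no other bead of an injective configuration can fill.\<close>

lemma remove_add_hook_beta_char:
  assumes inj: "inj_on \<beta> {..<N}" and M: "sum_mset M + m \<le> N"
  shows "(\<Sum>i<N. if \<beta> i < m \<and> m \<le> \<beta> i + l then beta_char N M (\<beta>(i := \<beta> i + l - m)) else 0)
     = (if l = m then int m * beta_char N M \<beta> else 0)"
proof (cases "l = m")
  case True
  have "card {i. i < N \<and> \<beta> i < m} = m" if "beta_char N M \<beta> \<noteq> 0"
  proof -
    have "\<beta> ` {i. i < N \<and> \<beta> i < m} = {..<m}"
      using beta_char_occupied[OF that] M by force
    moreover have "inj_on \<beta> {i. i < N \<and> \<beta> i < m}" using inj by (auto simp: inj_on_def)
    ultimately show ?thesis by (metis card_image card_lessThan)
  qed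
  moreover have "{..<N} \<inter> {i. \<beta> i < m} = {i. i < N \<and> \<beta> i < m}" by auto
  ultimately show ?thesis
    using True by (cases "beta_char N M \<beta> = 0") (auto simp: sum.If_cases)
next
  case False
  have "beta_char N M (\<beta>(i := \<beta> i + l - m)) = 0" if i: "i < N" "\<beta> i < m" "m \<le> \<beta> i + l" for i
  proof (rule ccontr)
    assume "beta_char N M (\<beta>(i := \<beta> i + l - m)) \<noteq> 0"
    then have "\<beta> i \<in> (\<beta>(i := \<beta> i + l - m)) ` {..<N}"
      using i M by (intro beta_char_occupied) auto
    then obtain j where j: "j < N" "(\<beta>(i := \<beta> i + l - m)) j = \<beta> i" by auto
    show False
    proof (cases "j = i")
      case True
      then have "\<beta> i + l - m = \<beta> i" using j(2) by simp
      then show False using i False by linarith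
    next
      case neq: False
      then have "\<beta> j = \<beta> i" using j(2) by simp
      then show False using neq inj j(1) i(1) by (auto dest: inj_onD)
    qed
  qed
  then show ?thesis using False by (auto intro!: sum.neutral)
qed

text \<open>Hook removal acts as the derivation \<open>l d/dp_l\<close>: it annihilates the ground
  state, because raising a bead of an injective configuration exceeds the minimal sum, and its
  commutator with hook addition is the scalar \<open>m\<close> for \<open>l = m\<close> and zero
  otherwise.\<close>

lemma remove_hook_beta_char:
  assumes "l > 0" "sum_mset M \<le> N"
  shows "remove_hook N l (beta_char N M) \<beta> = int (l * count M l) * beta_char N (M - {#l#}) \<beta>"
  using assms(2)
proof (induction M arbitrary: \<beta>)
  case empty
  have "ground N (\<beta>(i := \<beta> i + l)) = 0" if "i < N" "inj_on \<beta> {..<N}" for i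
  proof (rule ccontr)
    assume *: "ground N (\<beta>(i := \<beta> i + l)) \<noteq> 0"
    have "sum (\<beta>(i := \<beta> i + l)) {..<N} = (\<beta> i + l) + sum \<beta> ({..<N} - {i})"
      using that(1) by (subst sum.remove[of _ i]) (auto intro!: sum.cong)
    moreover have "sum \<beta> {..<N} = \<beta> i + sum \<beta> ({..<N} - {i})"
      using that(1) by (subst sum.remove[of _ i]) auto
    moreover have "sum (\<beta>(i := \<beta> i + l)) {..<N} = \<Sum>{..<N}"
      using beta_char_in_bead_configs[of N "{#}" "\<beta>(i := \<beta> i + l)"] *
      by (simp add: bead_configs_def del: fun_upd_apply)
    ultimately show False using sum_inj_on_ge[OF that(2)] assms(1) by simp
  qed
  moreover have "remove_hook N l (ground N) \<beta> = 0" if "\<not> inj_on \<beta> {..<N}"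
    using alternating_inj[OF alternating_remove_hook[OF alternating_ground]] that by blast
  ultimately show ?case
    by (cases "inj_on \<beta> {..<N}") (auto simp: remove_hook_def)
next
  case (add m M)
  show ?case
  proof (cases "inj_on \<beta> {..<N}")
    case False
    then have "remove_hook N l (beta_char N (add_mset m M)) \<beta> = 0"
      "beta_char N (add_mset m M - {#l#}) \<beta> = 0"
      using alternating_inj alternating_remove_hook alternating_beta_char by blast+
    then show ?thesis by simp
  next
    case True
    have IH: "remove_hook N l (beta_char N M) = (\<lambda>\<beta>. int (l * count M l) * beta_char N (M - {#l#}) \<beta>)"
      using add by (auto simp: fun_eq_iff)
    have "add_hook N m (\<lambda>\<beta>. c * s \<beta>) \<beta> = c * add_hook N m s \<beta>" for c s
      unfolding add_hook_def by (auto simp: sum_distrib_left intro!: sum.cong)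
    note lin = this
    have "remove_hook N l (beta_char N (add_mset m M)) \<beta>
       = int (l * count M l) * add_hook N m (beta_char N (M - {#l#})) \<beta>
         + (if l = m then int m * beta_char N M \<beta> else 0)"
      using add.prems
      by (simp add: remove_add_hook IH lin remove_add_hook_beta_char[OF True])
    also have "\<dots> = int (l * count (add_mset m M) l) * beta_char N (add_mset m M - {#l#}) \<beta>"
    \<comment> \<open>If \<open>l\<close> is absent from \<open>M\<close>, the truncated difference
      \<open>M - {#l#}\<close> is harmless because its coefficient \<open>count M l\<close> is
      zero.\<close>
    proof (cases "l \<in># M")
      case True
      then have "add_mset m M - {#l#} = add_mset m (M - {#l#})" by (cases "l = m") auto
      then show ?thesis
        using True by (auto simp: algebra_simps simp flip: beta_char_add)
    next
      case False
      then show ?thesis by (auto simp: not_in_iff)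
    qed
    finally show ?thesis .
  qed
qed

section \<open>Finiteness, adjointness and the Gram recursion\<close>

lemma finite_bead_configs: "finite (bead_configs N t)"
proof (rule finite_subset)
  show "bead_configs N t \<subseteq> (\<lambda>f i. if i < N then f i else i) ` ({..<N} \<rightarrow>\<^sub>E {..t})"
  proof
    fix \<beta> assume \<beta>: "\<beta> \<in> bead_configs N t"
    then have "\<beta> i \<le> t" if "i < N" for i
      using member_le_sum[of i "{..<N}" \<beta>] that by (auto simp: bead_configs_def)
    then have "restrict \<beta> {..<N} \<in> {..<N} \<rightarrow>\<^sub>E {..t}" by auto
    moreover have "\<beta> = (\<lambda>i. if i < N then restrict \<beta> {..<N} i else i)"
      using \<beta> by (auto simp: bead_configs_def fun_eq_iff)
    ultimately show "\<beta> \<in> (\<lambda>f i. if i < N then f i else i) ` ({..<N} \<rightarrow>\<^sub>E {..t})" by blast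
  qed
qed (auto intro: finite_PiE)

lemma fun_upd_in_bead_configs:
  assumes "\<beta> \<in> bead_configs N t" "i < N" "t + x = t' + \<beta> i"
  shows "\<beta>(i := x) \<in> bead_configs N t'"
proof -
  have "sum (\<beta>(i := x)) {..<N} = x + sum \<beta> ({..<N} - {i})"
    using assms(2) by (subst sum.remove[of _ i]) (auto intro!: sum.cong)
  moreover have "sum \<beta> {..<N} = \<beta> i + sum \<beta> ({..<N} - {i})"
    using assms(2) by (subst sum.remove[of _ i]) auto
  ultimately show ?thesis using assms unfolding bead_configs_def by auto
qed

text \<open>For each bead \<open>i\<close>, lowering it by \<open>m\<close> is a bijection from the
  configurations of sum \<open>t + m\<close> with \<open>m \<le> \<beta> i\<close> onto those of sum
  \<open>t\<close>.\<close>

lemma add_hook_adjoint: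
  "(\<Sum>\<beta>\<in>bead_configs N (t + m). add_hook N m s \<beta> * u \<beta>) = (\<Sum>\<beta>\<in>bead_configs N t. s \<beta> * remove_hook N m u \<beta>)"
proof -
  have "(\<Sum>\<beta>\<in>bead_configs N (t + m). add_hook N m s \<beta> * u \<beta>)
      = (\<Sum>i<N. \<Sum>\<beta>\<in>bead_configs N (t + m). if m \<le> \<beta> i then s (\<beta>(i := \<beta> i - m)) * u \<beta> else 0)"
    unfolding add_hook_def sum_distrib_right
    by (subst sum.swap) (intro sum.cong refl, auto)
  also have "\<dots> = (\<Sum>i<N. \<Sum>\<beta>\<in>bead_configs N t. s \<beta> * u (\<beta>(i := \<beta> i + m)))"
  proof (rule sum.cong[OF refl])
    fix i assume "i \<in> {..<N}"
    then have i: "i < N" by simp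
    have "(\<Sum>\<beta>\<in>bead_configs N (t + m). if m \<le> \<beta> i then s (\<beta>(i := \<beta> i - m)) * u \<beta> else 0)
       = (\<Sum>\<beta>\<in>{\<beta> \<in> bead_configs N (t + m). m \<le> \<beta> i}. s (\<beta>(i := \<beta> i - m)) * u \<beta>)"
      using finite_bead_configs by (simp add: sum.inter_filter)
    also have "\<dots> = (\<Sum>\<beta>\<in>bead_configs N t. s \<beta> * u (\<beta>(i := \<beta> i + m)))"
      by (rule sum.reindex_bij_witness[where j = "\<lambda>\<beta>. \<beta>(i := \<beta> i - m)" and i = "\<lambda>\<beta>. \<beta>(i := \<beta> i + m)"])
         (auto intro!: fun_upd_in_bead_configs[OF _ i])
    finally show "(\<Sum>\<beta>\<in>bead_configs N (t + m). if m \<le> \<beta> i then s (\<beta>(i := \<beta> i - m)) * u \<beta> else 0)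
       = (\<Sum>\<beta>\<in>bead_configs N t. s \<beta> * u (\<beta>(i := \<beta> i + m)))" .
  qed
  also have "\<dots> = (\<Sum>\<beta>\<in>bead_configs N t. s \<beta> * remove_hook N m u \<beta>)"
    unfolding remove_hook_def sum_distrib_left by (rule sum.swap)
  finally show ?thesis .
qed

lemma gram_step:
  assumes "l > 0" "sum_mset M' \<le> N"
  shows "(\<Sum>\<beta>\<in>bead_configs N (t + l). beta_char N (add_mset l M) \<beta> * beta_char N M' \<beta>)
     = int (l * count M' l) * (\<Sum>\<beta>\<in>bead_configs N t. beta_char N M \<beta> * beta_char N (M' - {#l#}) \<beta>)"
  by (simp add: add_hook_adjoint remove_hook_beta_char[OF assms] sum_distrib_left mult.left_commute)

text \<open>Each of the \<open>N!\<close> orderings of the empty partition contributes the square of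
  a sign. This is the source of the factorial in the later normalisations.\<close>

lemma gram_ground: "(\<Sum>\<beta>\<in>bead_configs N (\<Sum>{..<N}). ground N \<beta> * ground N \<beta>) = fact N"
proof -
  have sub: "{p. p permutes {..<N}} \<subseteq> bead_configs N (\<Sum>{..<N})"
  proof safe
    fix p assume "p permutes {..<N}"
    then have "ground N p \<noteq> 0" by (simp add: ground_def sign_def)
    then show "p \<in> bead_configs N (\<Sum>{..<N})" using beta_char_in_bead_configs[of N "{#}" p] by simp
  qed
  have "(\<Sum>\<beta>\<in>bead_configs N (\<Sum>{..<N}). ground N \<beta> * ground N \<beta>) = (\<Sum>p | p permutes {..<N}. 1)"
    using sub by (intro sum.mono_neutral_cong_right finite_bead_configs) (auto simp: ground_def sign_def)
  also have "\<dots> = fact N" using card_permutations[of "{..<N}" N] by simp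
  finally show ?thesis .
qed

section \<open>Orbits and intertwiners\<close>

definition cyc_type :: "('a \<Rightarrow> 'a) \<Rightarrow> 'a set \<Rightarrow> nat multiset" where
  "cyc_type g A = image_mset card (mset_set (orbit g ` A))"

section \<open>Orbits and cycle types on an invariant set\<close>

lemma orbit_eq:
  assumes "permutation g" "b \<in> orbit g a"
  shows "orbit g b = orbit g a"
  using orbit_cyclic_eq3[OF cyclic_on_orbit'[OF assms(1)] assms(2)] .

lemma funpow_eq_iff:
  assumes "permutation g"
  shows "(g ^^ i) a = (g ^^ j) a \<longleftrightarrow> i mod card (orbit g a) = j mod card (orbit g a)"
proof -
  define p where "p = funpow_dist1 g a a"
  have self: "a \<in> orbit g a" using assms by (rule permutation_self_in_orbit)
  have inj: "inj_on (\<lambda>n. (g ^^ n) a) {0..<p}" unfolding p_def by (rule inj_on_funpow_dist1[OF self])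
  have "orbit g a = (\<lambda>n. (g ^^ n) a) ` {0..<p}"
    unfolding p_def by (rule orbit_conv_funpow_dist1[OF self])
  then have p: "card (orbit g a) = p" using inj by (simp add: card_image)
  have "(g ^^ p) a = a" unfolding p_def by (rule funpow_dist1_prop[OF self])
  then have "(g ^^ (k mod p)) a = (g ^^ k) a" for k by (rule funpow_mod_eq)
  moreover have "p > 0" by (simp add: p_def)
  ultimately show ?thesis
    using inj unfolding p inj_on_def by (metis atLeastLessThan_iff le0 mod_less_divisor)
qed

lemma orbit_subset_closed:
  assumes "g ` A \<subseteq> A" "a \<in> A"
  shows "orbit g a \<subseteq> A"
proof
  fix y assume "y \<in> orbit g a"
  then show "y \<in> A" by induct (use assms in auto)
qed

lemma closed_diff_orbit:
  assumes "permutation g" "g ` A \<subseteq> A"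
  shows "g ` (A - orbit g a) \<subseteq> A - orbit g a"
proof safe
  fix x assume "x \<in> A" "x \<notin> orbit g a" "g x \<in> orbit g a"
  then have "x \<in> orbit g a"
    using orbit_eq[OF assms(1), of "g x" a] permutation_orbit_step[OF assms(1), of x]
      permutation_self_in_orbit[OF assms(1), of x] by simp
  then show False using \<open>x \<notin> orbit g a\<close> by simp
qed (use assms(2) in auto)

lemma finite_orbit_permutation: "permutation g \<Longrightarrow> finite (orbit g a)"
  by (rule finite_orbit[OF permutation_self_in_orbit])

lemma card_orbit_pos: "permutation g \<Longrightarrow> card (orbit g a) > 0"
  using orbit_nonempty[of g a] finite_orbit_permutation[of g a] by (simp add: card_gt_0_iff)

lemma orbit_image_split:
  assumes "permutation g" "g ` A \<subseteq> A" "a \<in> A"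
  shows "orbit g ` A = insert (orbit g a) (orbit g ` (A - orbit g a))"
    and "orbit g a \<notin> orbit g ` (A - orbit g a)"
proof -
  show "orbit g ` A = insert (orbit g a) (orbit g ` (A - orbit g a))"
    using assms(3) orbit_eq[OF assms(1)] by blast
  show "orbit g a \<notin> orbit g ` (A - orbit g a)"
    using permutation_self_in_orbit[OF assms(1)] by blast
qed

lemma cyc_type_split:
  assumes "permutation g" "finite A" "g ` A \<subseteq> A" "a \<in> A"
  shows "cyc_type g A = add_mset (card (orbit g a)) (cyc_type g (A - orbit g a))"
  using assms(2) orbit_image_split(2)[OF assms(1,3,4)]
  unfolding cyc_type_def by (subst orbit_image_split(1)[OF assms(1,3,4)]) simp

lemma cyc_type_empty [simp]: "cyc_type g {} = {#}"
  by (simp add: cyc_type_def)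

text \<open>Peeling off whole orbits mirrors the removal of one hook at a time.\<close>

lemma orbit_induct [consumes 3, case_names empty split]:
  assumes "permutation g" "finite A" "g ` A \<subseteq> A" "P {}"
    and "\<And>A a. finite A \<Longrightarrow> g ` A \<subseteq> A \<Longrightarrow> a \<in> A \<Longrightarrow> P (A - orbit g a) \<Longrightarrow> P A"
  shows "P A"
  using assms(2,3)
proof (induction A rule: finite_psubset_induct)
  case (psubset A)
  show ?case
  proof (cases "A = {}")
    case False
    then obtain a where a: "a \<in> A" by auto
    then have "A - orbit g a \<subset> A" using permutation_self_in_orbit[OF assms(1), of a] by auto
    then have "P (A - orbit g a)"
      by (rule psubset.IH) (rule closed_diff_orbit[OF assms(1) psubset.prems])
    then show ?thesis using assms(5)[OF psubset.hyps psubset.prems a] by simp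
  qed (use assms(4) in simp)
qed

lemma card_diff_orbit:
  assumes "permutation g" "finite A" "g ` A \<subseteq> A" "a \<in> A"
  shows "card A = card (A - orbit g a) + card (orbit g a)"
  using card_Diff_subset[OF finite_orbit_permutation[OF assms(1)] orbit_subset_closed[OF assms(3,4)]]
    card_mono[OF assms(2) orbit_subset_closed[OF assms(3,4)]] by simp

lemma sum_mset_cyc_type:
  assumes "permutation g" "finite A" "g ` A \<subseteq> A"
  shows "sum_mset (cyc_type g A) = card A"
  using assms
proof (induction rule: orbit_induct)
  case (split A a)
  then show ?case using assms(1) by (simp add: cyc_type_split[of g A a] card_diff_orbit[of g A a])
qed simp

text \<open>This identifies the factor \<open>l * count\<close> produced by hook removal with the
  number of candidate images of a point under an intertwiner.\<close>

lemma card_points_with_orbit_size: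
  assumes "permutation g" "finite A" "g ` A \<subseteq> A"
  shows "card {b \<in> A. card (orbit g b) = l} = l * count (cyc_type g A) l"
  using assms
proof (induction rule: orbit_induct)
  case (split A a)
  have "{b \<in> A. card (orbit g b) = l} = {b \<in> A - orbit g a. card (orbit g b) = l}
     \<union> (if card (orbit g a) = l then orbit g a else {})"
    using orbit_subset_closed[OF split(2,3)] orbit_eq[OF assms(1), of _ a] by auto
  moreover have "card \<dots> = card {b \<in> A - orbit g a. card (orbit g b) = l}
      + (if card (orbit g a) = l then l else 0)"
    using finite_orbit_permutation[OF assms(1), of a] split(1) by (subst card_Un_disjoint) auto
  ultimately show ?case
    using split assms(1) by (simp add: cyc_type_split[of g A a] algebra_simps)
qed simp

text \<open>The sets \<open>A\<close> and \<open>B\<close> are kept apart because deleting an orbit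
  on each side leaves different sets. Extensionality makes the set finite.\<close>

definition intertwiners :: "('a \<Rightarrow> 'a) \<Rightarrow> 'a set \<Rightarrow> ('b \<Rightarrow> 'b) \<Rightarrow> 'b set \<Rightarrow> ('a \<Rightarrow> 'b) set" where
  "intertwiners g A h B = {x \<in> A \<rightarrow>\<^sub>E B. bij_betw x A B \<and> (\<forall>a\<in>A. x (g a) = h (x a))}"

lemma finite_intertwiners: "finite A \<Longrightarrow> finite B \<Longrightarrow> finite (intertwiners g A h B)"
  unfolding intertwiners_def by (rule finite_subset[of _ "A \<rightarrow>\<^sub>E B"]) (auto intro: finite_PiE)

lemma intertwiners_funpow:
  assumes "x \<in> intertwiners g A h B" "g ` A \<subseteq> A" "a \<in> A"
  shows "x ((g ^^ i) a) = (h ^^ i) (x a)" "(g ^^ i) a \<in> A"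
proof -
  have "x ((g ^^ i) a) = (h ^^ i) (x a) \<and> (g ^^ i) a \<in> A"
    using assms by (induction i) (auto simp: intertwiners_def)
  then show "x ((g ^^ i) a) = (h ^^ i) (x a)" "(g ^^ i) a \<in> A" by auto
qed

lemma intertwiners_image_orbit:
  assumes "permutation g" "x \<in> intertwiners g A h B" "g ` A \<subseteq> A" "a \<in> A"
  shows "x ` orbit g a = orbit h (x a)"
  by (rule orbit_inverse[OF permutation_self_in_orbit[OF assms(1)]])
     (use orbit_subset_closed[OF assms(3,4)] assms(2) in \<open>auto simp: intertwiners_def\<close>)

text \<open>On the orbit of \<open>a\<close> an intertwiner is forced by its value at
  \<open>a\<close>; equal orbit sizes make the forced values \<open>(h ^^ i) b\<close> well defined
  and bijective onto the orbit of \<open>b\<close>.\<close>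

lemma intertwiners_restrict:
  assumes g: "permutation g" and h: "permutation h"
    and A: "g ` A \<subseteq> A" "a \<in> A" and B: "h ` B \<subseteq> B" "b \<in> B"
    and c: "card (orbit g a) = card (orbit h b)"
  shows "bij_betw (\<lambda>x. restrict x (A - orbit g a)) {x \<in> intertwiners g A h B. x a = b}
           (intertwiners g (A - orbit g a) h (B - orbit h b))"
  (is "bij_betw ?r ?X ?Y")
proof -
  note OA = orbit_subset_closed[OF A] and OB = orbit_subset_closed[OF B]
  have same: "(g ^^ i) a = (g ^^ j) a \<longleftrightarrow> (h ^^ i) b = (h ^^ j) b" for i j
    using funpow_eq_iff[OF g, of i a j] funpow_eq_iff[OF h, of i b j] c by simp
  have inj: "inj_on ?r ?X"
  proof (rule inj_onI, rule ext)
    fix x y z assume x: "x \<in> ?X" and y: "y \<in> ?X" and e: "?r x = ?r y"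
    consider "z \<notin> A" | "z \<in> orbit g a" | "z \<in> A - orbit g a" by auto
    then show "x z = y z"
    proof cases
      case 1 then show ?thesis using x y by (auto simp: intertwiners_def PiE_def extensional_def)
    next
      case 2
      then obtain i where "z = (g ^^ i) a" by (auto simp: orbit_altdef_permutation[OF g])
      then show ?thesis
        using x y intertwiners_funpow(1)[OF _ A, of x h B i] intertwiners_funpow(1)[OF _ A, of y h B i] by simp
    next
      case 3 then show ?thesis using fun_cong[OF e, of z] by simp
    qed
  qed
  have into: "?r x \<in> ?Y" if "x \<in> ?X" for x
  proof -
    have x: "x \<in> intertwiners g A h B" "x a = b" using that by auto
    have bij: "bij_betw x A B" using x by (simp add: intertwiners_def)
    have "x ` orbit g a = orbit h b" using intertwiners_image_orbit[OF g x(1) A] x(2) by simp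
    moreover have "x ` (A - orbit g a) = x ` A - x ` orbit g a"
      using bij OA by (intro inj_on_image_set_diff[of x A]) (auto simp: bij_betw_def)
    ultimately have "x ` (A - orbit g a) = B - orbit h b"
      using bij by (simp add: bij_betw_def)
    then have bD: "bij_betw x (A - orbit g a) (B - orbit h b)"
      using bij by (auto simp: bij_betw_def intro: inj_on_diff)
    then have "bij_betw (?r x) (A - orbit g a) (B - orbit h b)"
      using bij_betw_cong[of "A - orbit g a" "?r x" x "B - orbit h b"] by simp
    moreover have "?r x \<in> A - orbit g a \<rightarrow>\<^sub>E B - orbit h b"
      using bij_betw_apply[OF bD] by auto
    moreover have "?r x (g c) = h (?r x c)" if "c \<in> A - orbit g a" for c
    proof -
      have "g c \<in> A - orbit g a" using closed_diff_orbit[OF g A(1), of a] that by blast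
      then show ?thesis using x(1) that by (simp add: intertwiners_def)
    qed
    ultimately show ?thesis by (simp add: intertwiners_def)
  qed
  have surj: "y \<in> ?r ` ?X" if y: "y \<in> ?Y" for y
  proof -
    \<comment> \<open>Any exponent reaching \<open>c\<close> will do: by \<open>same\<close>, the
      value \<open>(h ^^ idx c) b\<close> does not depend on the choice.\<close>
    define idx where "idx c = (SOME i. (g ^^ i) a = c)" for c
    have idx: "(g ^^ idx c) a = c" if "c \<in> orbit g a" for c
      unfolding idx_def using that by (intro someI_ex[of "\<lambda>i. (g ^^ i) a = c"]) (auto simp: orbit_altdef_permutation[OF g])
    define x where "x c = (if c \<in> orbit g a then (h ^^ idx c) b else y c)" for c
    have xpow: "x ((g ^^ i) a) = (h ^^ i) b" for i
    proof -
      have mem: "(g ^^ i) a \<in> orbit g a" by (auto simp: orbit_altdef_permutation[OF g])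
      then have "(h ^^ idx ((g ^^ i) a)) b = (h ^^ i) b" using idx same by blast
      then show ?thesis using mem by (simp only: x_def if_True)
    qed
    have "orbit g a = range (\<lambda>i. (g ^^ i) a)" "orbit h b = range (\<lambda>i. (h ^^ i) b)"
      by (auto simp: orbit_altdef_permutation[OF g] orbit_altdef_permutation[OF h])
    then have img: "x ` orbit g a = orbit h b"
      by (simp only: image_image xpow)
    have bO: "bij_betw x (orbit g a) (orbit h b)"
      using img c finite_orbit_permutation[OF g, of a] by (simp add: bij_betw_def eq_card_imp_inj_on)
    have bD: "bij_betw x (A - orbit g a) (B - orbit h b)"
      using y bij_betw_cong[of "A - orbit g a" x y "B - orbit h b"]
      by (simp add: intertwiners_def x_def)
    have "bij_betw x (orbit g a \<union> (A - orbit g a)) (orbit h b \<union> (B - orbit h b))"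
      using bO bD by (rule bij_betw_combine) auto
    then have bij: "bij_betw x A B"
      using OA OB by (simp only: Un_Diff_cancel Un_absorb1)
    have comm: "x (g c) = h (x c)" if "c \<in> A" for c
    proof (cases "c \<in> orbit g a")
      case True
      then obtain i where "c = (g ^^ i) a" by (auto simp: orbit_altdef_permutation[OF g])
      then show ?thesis using xpow[of i] xpow[of "Suc i"] by simp
    next
      case False
      then have "g c \<in> A - orbit g a" using closed_diff_orbit[OF g A(1), of a] that by blast
      then show ?thesis using y that False by (simp add: x_def intertwiners_def)
    qed
    have ext: "x \<in> extensional A"
      using y OA by (auto simp: x_def intertwiners_def PiE_def extensional_def)
    have "x \<in> intertwiners g A h B"
      using bij comm ext bij_betw_apply[OF bij] by (auto simp: intertwiners_def PiE_def)
    moreover have "x a = b" using xpow[of 0] by simp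
    moreover have "?r x = y"
      using y by (auto simp: x_def intertwiners_def PiE_def extensional_def fun_eq_iff)
    ultimately show ?thesis by blast
  qed
  show ?thesis
    unfolding bij_betw_def using inj into surj by blast
qed

text \<open>An intertwiner maps the orbit of \<open>a\<close> bijectively onto the orbit of its
  image, so the image ranges over points with orbits of the same size.\<close>

lemma card_intertwiners_split:
  assumes g: "permutation g" and h: "permutation h"
    and A: "finite A" "g ` A \<subseteq> A" "a \<in> A" and B: "finite B" "h ` B \<subseteq> B"
  shows "card (intertwiners g A h B) = (\<Sum>b | b \<in> B \<and> card (orbit h b) = card (orbit g a).
           card (intertwiners g (A - orbit g a) h (B - orbit h b)))"
proof -
  define B' where "B' = {b \<in> B. card (orbit h b) = card (orbit g a)}"
  have "x a \<in> B'" if x: "x \<in> intertwiners g A h B" for x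
  proof -
    have "inj_on x (orbit g a)"
      using x orbit_subset_closed[OF A(2,3)] by (auto simp: intertwiners_def bij_betw_def intro: inj_on_subset)
    then have "card (orbit h (x a)) = card (orbit g a)"
      using intertwiners_image_orbit[OF g x A(2,3)] by (metis card_image)
    moreover have "x a \<in> B" using x A(3) by (auto simp: intertwiners_def)
    ultimately show ?thesis by (simp add: B'_def)
  qed
  then have "intertwiners g A h B = (\<Union>b\<in>B'. {x \<in> intertwiners g A h B. x a = b})" by auto
  also have "card \<dots> = (\<Sum>b\<in>B'. card {x \<in> intertwiners g A h B. x a = b})"
    using B(1) finite_intertwiners[OF A(1) B(1), of g h] by (intro card_UN_disjoint) (auto simp: B'_def)
  also have "\<dots> = (\<Sum>b\<in>B'. card (intertwiners g (A - orbit g a) h (B - orbit h b)))"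
    by (intro sum.cong refl bij_betw_same_card[OF intertwiners_restrict[OF g h A(2,3) B(2)]])
       (auto simp: B'_def)
  finally show ?thesis by (simp add: B'_def)
qed

text \<open>Hook removal on the left matches the choice of the image of one point on the right. The
  set \<open>B\<close> is generalised in the induction because a different orbit is deleted for each
  image.\<close>

theorem gram_intertwiners:
  assumes "permutation g" "permutation h"
    and "finite A" "g ` A \<subseteq> A" "finite B" "h ` B \<subseteq> B" "card A = card B" "card A \<le> N"
  shows "(\<Sum>\<beta>\<in>bead_configs N (\<Sum>{..<N} + card A).
            beta_char N (cyc_type g A) \<beta> * beta_char N (cyc_type h B) \<beta>)
       = fact N * int (card (intertwiners g A h B))"
  using assms(1,3-)
proof (induction arbitrary: B rule: orbit_induct)
  case empty
  then have "B = {}" by simp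
  moreover have "intertwiners g {} h {} = {\<lambda>_. undefined}" by (auto simp: intertwiners_def bij_betw_def)
  ultimately show ?case using gram_ground by simp
next
  case (split A a B)
  define l where "l = card (orbit g a)"
  define B' where "B' = {b \<in> B. card (orbit h b) = l}"
  note g = assms(1) and h = assms(2)
  have l: "l > 0" using card_orbit_pos[OF g] by (simp add: l_def)
  have cA: "card A = card (A - orbit g a) + l"
    using card_diff_orbit[OF g split(1-3)] by (simp add: l_def)
  define G where "G = (\<Sum>\<beta>\<in>bead_configs N (\<Sum>{..<N} + card (A - orbit g a)).
     beta_char N (cyc_type g (A - orbit g a)) \<beta> * beta_char N (cyc_type h B - {#l#}) \<beta>)"
  have "(\<Sum>\<beta>\<in>bead_configs N (\<Sum>{..<N} + card A).
            beta_char N (cyc_type g A) \<beta> * beta_char N (cyc_type h B) \<beta>)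
      = int (l * count (cyc_type h B) l) * G"
    using gram_step[OF l, where M' = "cyc_type h B" and N = N and
        t = "\<Sum>{..<N} + card (A - orbit g a)" and M = "cyc_type g (A - orbit g a)"]
      sum_mset_cyc_type[OF h split(5,6)] split(7,8)
    unfolding cyc_type_split[OF g split(1-3)] G_def cA l_def[symmetric] by (simp add: add.assoc)
  \<comment> \<open>The numerical factor becomes a sum over the candidate images \<open>b\<close> of
    \<open>a\<close>.\<close>
  also have "l * count (cyc_type h B) l = card B'"
    unfolding B'_def by (rule card_points_with_orbit_size[OF h split(5,6), symmetric])
  also have "int (card B') * G = (\<Sum>b\<in>B'. G)" by simp
  \<comment> \<open>\<open>G\<close> involves \<open>B\<close> only through
    \<open>cyc_type h B - {#l#}\<close>, which is the cycle type left after deleting the orbit of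
    any \<open>b\<close> in \<open>B'\<close>.\<close>
  also have "\<dots> = (\<Sum>b\<in>B'. fact N * int (card (intertwiners g (A - orbit g a) h (B - orbit h b))))"
  proof (intro sum.cong refl)
    fix b assume "b \<in> B'"
    then have b: "b \<in> B" "card (orbit h b) = l" by (auto simp: B'_def)
    have "card B = card (B - orbit h b) + l"
      using card_diff_orbit[OF h split(5,6) b(1)] b(2) by simp
    then have "(\<Sum>\<beta>\<in>bead_configs N (\<Sum>{..<N} + card (A - orbit g a)).
        beta_char N (cyc_type g (A - orbit g a)) \<beta> * beta_char N (cyc_type h (B - orbit h b)) \<beta>)
      = fact N * int (card (intertwiners g (A - orbit g a) h (B - orbit h b)))"
      using split(5-8) cA closed_diff_orbit[OF h split(6)] by (intro split(4)) auto
    then show "G = fact N * int (card (intertwiners g (A - orbit g a) h (B - orbit h b)))"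
      using cyc_type_split[OF h split(5,6) b(1)] b(2) by (simp add: G_def)
  qed
  also have "\<dots> = fact N * int (card (intertwiners g A h B))"
    unfolding card_intertwiners_split[OF g h split(1-3,5,6)] B'_def l_def
    by (simp add: sum_distrib_left)
  finally show ?case .
qed

section \<open>Colourings and the bound\<close>

text \<open>For fixed \<open>\<gamma>\<close> and \<open>\<beta>\<close> the number of these, as a
  function of \<open>g\<close>, is the permutation character on colourings of content
  \<open>\<beta> - \<gamma>\<close>; the content is written additively to avoid truncated
  subtraction.\<close>

definition colourings :: "nat \<Rightarrow> ('a \<Rightarrow> 'a) \<Rightarrow> 'a set \<Rightarrow> (nat \<Rightarrow> nat) \<Rightarrow> (nat \<Rightarrow> nat) \<Rightarrow> ('a \<Rightarrow> nat) set" where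
  "colourings N g A \<gamma> \<beta> = {f \<in> A \<rightarrow>\<^sub>E {..<N}. (\<forall>a\<in>A. f (g a) = f a) \<and>
     (\<forall>i<N. \<beta> i = \<gamma> i + card {a \<in> A. f a = i})}"

lemma finite_colourings: "finite A \<Longrightarrow> finite (colourings N g A \<gamma> \<beta>)"
  unfolding colourings_def by (rule finite_subset[of _ "A \<rightarrow>\<^sub>E {..<N}"]) (auto intro: finite_PiE)

lemma colouring_const_on_orbit:
  assumes "f \<in> colourings N g A \<gamma> \<beta>" "g ` A \<subseteq> A" "a \<in> A" "b \<in> orbit g a"
  shows "f b = f a"
proof -
  have "f b = f a \<and> b \<in> A"
    using assms(4) by induct (use assms in \<open>auto simp: colourings_def\<close>)
  then show ?thesis ..
qed

lemma card_colour_class_split: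
  assumes "finite A" "Q \<subseteq> A" "\<And>b. b \<in> Q \<Longrightarrow> f b = c"
  shows "card {a \<in> A. f a = i} = card {a \<in> A - Q. f a = i} + (if i = c then card Q else 0)"
proof -
  have "{a \<in> A. f a = i} = {a \<in> A - Q. f a = i} \<union> (if i = c then Q else {})"
    using assms by auto
  moreover have "card \<dots> = card {a \<in> A - Q. f a = i} + (if i = c then card Q else 0)"
    using assms finite_subset[OF assms(2,1)] by (subst card_Un_disjoint) auto
  ultimately show ?thesis by simp
qed

text \<open>The whole orbit of \<open>a\<close> has colour \<open>i\<close>, so deleting it lowers
  the number of uses of colour \<open>i\<close> by the orbit size; the bound on the orbit size makes
  the subtraction genuine.\<close>

lemma colourings_restrict:
  assumes g: "permutation g" and A: "finite A" "g ` A \<subseteq> A" "a \<in> A"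
    and i: "i < N" "card (orbit g a) \<le> \<beta> i"
  shows "bij_betw (\<lambda>f. restrict f (A - orbit g a)) {f \<in> colourings N g A \<gamma> \<beta>. f a = i}
           (colourings N g (A - orbit g a) \<gamma> (\<beta>(i := \<beta> i - card (orbit g a))))"
  (is "bij_betw ?r ?X ?Y")
proof -
  define Q where "Q = orbit g a"
  have Q: "Q \<subseteq> A" unfolding Q_def by (rule orbit_subset_closed[OF A(2,3)])
  have aQ: "a \<in> Q" unfolding Q_def by (rule permutation_self_in_orbit[OF g])
  have gD: "g b \<in> A - Q" if "b \<in> A - Q" for b
    using closed_diff_orbit[OF g A(2), of a] that unfolding Q_def by blast
  have gQ: "g b \<in> Q" if "b \<in> Q" for b
    using that unfolding Q_def by (rule orbit.step)
  have const: "f b = i" if "f \<in> ?X" "b \<in> Q" for f b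
    using colouring_const_on_orbit[OF _ A(2,3)] that unfolding Q_def by blast
  have inj: "inj_on ?r ?X"
  proof (rule inj_onI, rule ext)
    fix f f' z assume f: "f \<in> ?X" and f': "f' \<in> ?X" and e: "?r f = ?r f'"
    consider "z \<notin> A" | "z \<in> Q" | "z \<in> A - Q" by auto
    then show "f z = f' z"
    proof cases
      case 1 then show ?thesis using f f' by (auto simp: colourings_def PiE_def extensional_def)
    next
      case 2 then show ?thesis using const[OF f] const[OF f'] by simp
    next
      case 3 then show ?thesis using fun_cong[OF e, of z] by (simp add: Q_def)
    qed
  qed
  have cong: "{b \<in> A - Q. restrict f (A - Q) b = j} = {b \<in> A - Q. f b = j}" for f :: "'a \<Rightarrow> nat" and j
    by auto
  have into: "?r f \<in> ?Y" if f: "f \<in> ?X" for f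
  proof -
    have "card {b \<in> A. f b = j} = card {b \<in> A - Q. f b = j} + (if j = i then card Q else 0)" for j
      using A(1) Q const[OF f] by (rule card_colour_class_split)
    then have "(\<beta>(i := \<beta> i - card Q)) j = \<gamma> j + card {b \<in> A - Q. f b = j}" if "j < N" for j
      using f that by (simp add: colourings_def)
    moreover have "restrict f (A - Q) (g b) = restrict f (A - Q) b" if "b \<in> A - Q" for b
      using f that gD[OF that] by (simp add: colourings_def)
    moreover have "restrict f (A - Q) \<in> A - Q \<rightarrow>\<^sub>E {..<N}"
      using f by (auto simp: colourings_def)
    ultimately show ?thesis
      unfolding colourings_def Q_def[symmetric]
      by (intro CollectI conjI ballI allI impI) (simp_all only: cong)
  qed
  have surj: "h \<in> ?r ` ?X" if h: "h \<in> ?Y" for h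
  proof -
    define f where "f b = (if b \<in> Q then i else h b)" for b
    have "card {b \<in> A. f b = j} = card {b \<in> A - Q. f b = j} + (if j = i then card Q else 0)" for j
      using A(1) Q by (rule card_colour_class_split) (simp add: f_def)
    moreover have "{b \<in> A - Q. f b = j} = {b \<in> A - Q. h b = j}" for j
      by (auto simp: f_def)
    moreover have "\<gamma> j + card {b \<in> A - Q. h b = j} = (\<beta>(i := \<beta> i - card Q)) j" if "j < N" for j
      using h that unfolding colourings_def Q_def[symmetric] by simp
    ultimately have "\<beta> j = \<gamma> j + card {b \<in> A. f b = j}" if "j < N" for j
      using that i(2) unfolding Q_def[symmetric] by fastforce
    moreover have "f (g b) = f b" if "b \<in> A" for b
      using gD gQ h that unfolding colourings_def Q_def[symmetric] by (auto simp: f_def)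
    moreover have "f \<in> A \<rightarrow>\<^sub>E {..<N}"
      using h i(1) Q unfolding colourings_def Q_def[symmetric]
      by (auto simp: f_def PiE_iff extensional_def)
    ultimately have "f \<in> ?X" using aQ by (simp add: colourings_def f_def)
    moreover have "?r f = h"
      using h unfolding colourings_def Q_def[symmetric]
      by (auto simp: f_def PiE_iff extensional_def fun_eq_iff)
    ultimately show ?thesis by blast
  qed
  show ?thesis unfolding bij_betw_def using inj into surj by blast
qed

text \<open>This is the recursion of \<open>add_hook\<close>, with the colour of \<open>a\<close> in
  the role of the bead being moved.\<close>

lemma card_colourings_split:
  assumes g: "permutation g" and A: "finite A" "g ` A \<subseteq> A" "a \<in> A"
  shows "card (colourings N g A \<gamma> \<beta>) = (\<Sum>i<N. if card (orbit g a) \<le> \<beta> i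
     then card (colourings N g (A - orbit g a) \<gamma> (\<beta>(i := \<beta> i - card (orbit g a)))) else 0)"
proof -
  have "colourings N g A \<gamma> \<beta> = (\<Union>i<N. {f \<in> colourings N g A \<gamma> \<beta>. f a = i})"
    using A(3) by (auto simp: colourings_def)
  also have "card \<dots> = (\<Sum>i<N. card {f \<in> colourings N g A \<gamma> \<beta>. f a = i})"
    using finite_colourings[OF A(1), of N g \<gamma> \<beta>] by (intro card_UN_disjoint) auto
  also have "\<dots> = (\<Sum>i<N. if card (orbit g a) \<le> \<beta> i
     then card (colourings N g (A - orbit g a) \<gamma> (\<beta>(i := \<beta> i - card (orbit g a)))) else 0)"
  proof (rule sum.cong[OF refl])
    fix i assume i: "i \<in> {..<N}"
    show "card {f \<in> colourings N g A \<gamma> \<beta>. f a = i} = (if card (orbit g a) \<le> \<beta> i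
     then card (colourings N g (A - orbit g a) \<gamma> (\<beta>(i := \<beta> i - card (orbit g a)))) else 0)"
    proof (cases "card (orbit g a) \<le> \<beta> i")
      case True
      then show ?thesis using i bij_betw_same_card[OF colourings_restrict[OF g A]] by simp
    next
      case False
      have "f \<notin> {f \<in> colourings N g A \<gamma> \<beta>. f a = i}" for f
      proof
        assume f: "f \<in> {f \<in> colourings N g A \<gamma> \<beta>. f a = i}"
        then have "orbit g a \<subseteq> {b \<in> A. f b = i}"
          using colouring_const_on_orbit[OF _ A(2,3)] orbit_subset_closed[OF A(2,3)] by blast
        then have "card (orbit g a) \<le> card {b \<in> A. f b = i}"
          using A(1) by (intro card_mono) auto
        also have "\<dots> \<le> \<beta> i" using f i by (simp add: colourings_def)
        finally show False using False by simp
      qed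
      then have "{f \<in> colourings N g A \<gamma> \<beta>. f a = i} = {}" by blast
      then show ?thesis using False by (simp only: card.empty if_False)
    qed
  qed
  finally show ?thesis .
qed

text \<open>Unfolding the hook recursion completely sends bead \<open>i\<close> from
  \<open>\<beta> i\<close> down to some \<open>\<gamma> i\<close>, the lengths of its moves being
  the sizes of the orbits of colour \<open>i\<close>. The signed sum over \<open>\<gamma>\<close> is
  the Jacobi-Trudi determinant.\<close>

lemma beta_char_eq_colourings:
  assumes "permutation g" "finite A" "g ` A \<subseteq> A" "\<And>i. i \<ge> N \<Longrightarrow> \<beta> i = i"
  shows "beta_char N (cyc_type g A) \<beta>
       = (\<Sum>\<gamma> | \<gamma> permutes {..<N}. sign \<gamma> * int (card (colourings N g A \<gamma> \<beta>)))"
  using assms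
proof (induction arbitrary: \<beta> rule: orbit_induct)
  case empty
  have "card (colourings N g {} \<gamma> \<beta>) = (if \<gamma> = \<beta> then 1 else 0)" if "\<gamma> permutes {..<N}" for \<gamma>
  proof -
    \<comment> \<open>Agreement on \<open>{..<N}\<close> suffices since both functions are the
      identity beyond it.\<close>
    have "(\<forall>i<N. \<beta> i = \<gamma> i) \<longleftrightarrow> \<gamma> = \<beta>"
      using empty that by (metis ext lessThan_iff not_less permutes_not_in)
    then have "colourings N g {} \<gamma> \<beta> = (if \<gamma> = \<beta> then {\<lambda>_. undefined} else {})"
      by (auto simp: colourings_def)
    then show ?thesis by simp
  qed
  then have "(\<Sum>\<gamma> | \<gamma> permutes {..<N}. sign \<gamma> * int (card (colourings N g {} \<gamma> \<beta>)))
      = (\<Sum>\<gamma> | \<gamma> permutes {..<N}. if \<gamma> = \<beta> then sign \<gamma> else 0)"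
    by (intro sum.cong refl) auto
  then show ?case
    by (simp add: ground_def finite_permutations)
next
  case (split A a)
  define l where "l = card (orbit g a)"
  let ?P = "{\<gamma>. \<gamma> permutes {..<N}}"
  have "beta_char N (cyc_type g A) \<beta>
      = (\<Sum>i<N. if l \<le> \<beta> i then beta_char N (cyc_type g (A - orbit g a)) (\<beta>(i := \<beta> i - l)) else 0)"
    unfolding cyc_type_split[OF assms(1) split(1-3)] l_def by (simp add: add_hook_def)
  also have "\<dots> = (\<Sum>i<N. \<Sum>\<gamma>\<in>?P. sign \<gamma> * int (if l \<le> \<beta> i
     then card (colourings N g (A - orbit g a) \<gamma> (\<beta>(i := \<beta> i - l))) else 0))"
  proof (rule sum.cong[OF refl])
    fix i assume "i \<in> {..<N}"
    then have "beta_char N (cyc_type g (A - orbit g a)) (\<beta>(i := \<beta> i - l))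
      = (\<Sum>\<gamma>\<in>?P. sign \<gamma> * int (card (colourings N g (A - orbit g a) \<gamma> (\<beta>(i := \<beta> i - l)))))"
      using split(5) by (intro split(4)) auto
    then show "(if l \<le> \<beta> i then beta_char N (cyc_type g (A - orbit g a)) (\<beta>(i := \<beta> i - l)) else 0)
      = (\<Sum>\<gamma>\<in>?P. sign \<gamma> * int (if l \<le> \<beta> i
          then card (colourings N g (A - orbit g a) \<gamma> (\<beta>(i := \<beta> i - l))) else 0))"
      by (simp del: fun_upd_apply)
  qed
  also have "\<dots> = (\<Sum>\<gamma>\<in>?P. sign \<gamma> * int (card (colourings N g A \<gamma> \<beta>)))"
    unfolding card_colourings_split[OF assms(1) split(1-3)] l_def[symmetric]
    by (subst sum.swap) (simp add: sum_distrib_left)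
  finally show ?case .
qed

text \<open>Moving all beads of \<open>I\<close> at once yields distinct positions again, so the sum
  of the positions cannot drop below that of the ground state. The second claim sharpens this for
  \<open>l = 1\<close>: a partition of \<open>n \<ge> 2\<close> has fewer than \<open>n\<close>
  removable corners.\<close>

lemma movable_beads:
  fixes \<beta> :: "nat \<Rightarrow> nat"
  assumes inj: "inj_on \<beta> {..<N}" and sum: "sum \<beta> {..<N} = \<Sum>{..<N} + n" and "l > 0"
  defines "I \<equiv> {i. i < N \<and> l \<le> \<beta> i \<and> \<beta> i - l \<notin> \<beta> ` {..<N}}"
  shows "card I * l \<le> n" "n \<ge> 2 \<Longrightarrow> card I < n"
proof -
  define \<gamma> where "\<gamma> i = (if i \<in> I then \<beta> i - l else \<beta> i)" for i
  have I: "I \<subseteq> {..<N}" "finite I" by (auto simp: I_def)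
  have inj': "inj_on \<gamma> {..<N}"
  proof (rule inj_onI)
    fix i j assume ij: "i \<in> {..<N}" "j \<in> {..<N}" "\<gamma> i = \<gamma> j"
    have "\<gamma> i' \<noteq> \<gamma> j'" if "i' \<in> I" "j' \<in> {..<N} - I" for i' j'
      using that by (auto simp: \<gamma>_def I_def)
    then have "i \<in> I \<longleftrightarrow> j \<in> I" using ij by (metis DiffI)
    then have "\<beta> i = \<beta> j" using ij by (auto simp: \<gamma>_def I_def split: if_splits)
    then show "i = j" using inj ij by (auto simp: inj_on_def)
  qed
  have "sum \<beta> {..<N} = (\<Sum>i<N. \<gamma> i + (if i \<in> I then l else 0))"
    by (intro sum.cong refl) (auto simp: \<gamma>_def I_def)
  also have "\<dots> = sum \<gamma> {..<N} + card I * l"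
    using I by (simp add: sum.distrib sum.If_cases Int_absorb1)
  finally have s: "sum \<beta> {..<N} = sum \<gamma> {..<N} + card I * l" .
  then show le: "card I * l \<le> n"
    using sum sum_inj_on_ge[OF inj'] by simp
  show "card I < n" if "n \<ge> 2"
  proof (rule ccontr)
    assume "\<not> card I < n"
    moreover have "card I \<le> card I * l" using \<open>l > 0\<close> by simp
    ultimately have c: "card I = n" "card I * l = n" using le by linarith+
    then have "l = 1" using that by simp
    have "\<not> card I \<le> Suc 0" using c that by linarith
    then obtain i j where ij: "i \<in> I" "j \<in> I" "i \<noteq> j"
      unfolding card_le_Suc0_iff_eq[OF I(2)] by blast
    then have "\<beta> i \<noteq> \<beta> j" using inj I by (auto simp: inj_on_def)
    with ij obtain i j where ij: "i \<in> I" "j \<in> I" "\<beta> i < \<beta> j"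
      by (metis linorder_neqE_nat)
    \<comment> \<open>Equality would make the sum over \<open>X\<close> minimal, although
      \<open>\<beta> i\<close> is free while the higher position \<open>\<gamma> j\<close> is
      taken.\<close>
    define X where "X = \<gamma> ` {..<N}"
    have "sum \<gamma> {..<N} = \<Sum>{..<N}" using s sum c(2) by linarith
    then have X: "finite X" "card X = N" "\<Sum>X = \<Sum>{..<N}"
      using inj' by (simp_all add: X_def card_image sum.reindex)
    have v: "\<beta> i \<notin> X"
    proof
      assume "\<beta> i \<in> X"
      then obtain m where m: "m < N" "\<gamma> m = \<beta> i" by (auto simp: X_def)
      show False
      proof (cases "m \<in> I")
        case True then show ?thesis using m ij I by (auto simp: \<gamma>_def I_def)
      next
        case False
        then have "\<beta> m = \<beta> i" using m by (simp add: \<gamma>_def)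
        then show ?thesis using inj m ij False I by (auto simp: inj_on_def)
      qed
    qed
    have w: "\<gamma> j \<in> X" using ij I by (auto simp: X_def)
    have "\<beta> i \<le> \<gamma> j" using ij \<open>l = 1\<close> by (simp add: \<gamma>_def)
    then have "\<beta> i < \<gamma> j" using v w by (metis le_neq_implies_less)
    moreover have "\<Sum>X = \<gamma> j + \<Sum>(X - {\<gamma> j})" using w X by (simp add: sum.remove)
    \<comment> \<open>Trading \<open>\<gamma> j\<close> for the smaller free position
      \<open>\<beta> i\<close> keeps \<open>N\<close> distinct values, so the minimal sum is still a
      lower bound.\<close>
    moreover have "\<Sum>{..<N} \<le> \<beta> i + \<Sum>(X - {\<gamma> j})"
    proof -
      have "card (insert (\<beta> i) (X - {\<gamma> j})) = N"
        using v w X by (metis card_Suc_Diff1 card_insert_disjoint Diff_iff finite_Diff)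
      then show ?thesis
        using sum_lessThan_card_le[of "insert (\<beta> i) (X - {\<gamma> j})"] X v by simp
    qed
    ultimately show False using X by simp
  qed
qed

text \<open>Only the beads whose target is free contribute; any other target is the position of a
  second bead, and antisymmetry kills the term.\<close>

lemma add_hook_beta_char_le:
  assumes "add_hook N l (beta_char N M) \<beta> \<noteq> 0" "l > 0"
    and "\<And>\<beta>. \<bar>beta_char N M \<beta>\<bar> \<le> c"
  obtains m where "\<bar>add_hook N l (beta_char N M) \<beta>\<bar> \<le> int m * c"
    and "m * l \<le> sum_mset M + l" and "sum_mset M + l \<ge> 2 \<Longrightarrow> m < sum_mset M + l"
proof -
  define I where "I = {i. i < N \<and> l \<le> \<beta> i \<and> \<beta> i - l \<notin> \<beta> ` {..<N}}"
  have nz: "beta_char N (add_mset l M) \<beta> \<noteq> 0" using assms(1) by simp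
  have inj: "inj_on \<beta> {..<N}" using nz by (rule alternating_inj[OF alternating_beta_char])
  have sum: "sum \<beta> {..<N} = \<Sum>{..<N} + (sum_mset M + l)"
    using beta_char_in_bead_configs[OF nz] by (simp add: bead_configs_def)
  note mv = movable_beads[OF inj sum assms(2), folded I_def]
  have zero: "beta_char N M (\<beta>(i := \<beta> i - l)) = 0" if i: "i < N" "l \<le> \<beta> i" "i \<notin> I" for i
  proof -
    have "\<beta> i - l \<in> \<beta> ` {..<N}" using i by (simp add: I_def)
    then obtain j where "\<beta> i - l = \<beta> j" "j \<in> {..<N}" by (rule imageE)
    then have j: "j < N" "\<beta> j = \<beta> i - l" by simp_all
    then have "\<beta> j < \<beta> i" using i(2) assms(2) by linarith
    then have "i \<noteq> j" by blast
    moreover from this have "(\<beta>(i := \<beta> i - l)) i = (\<beta>(i := \<beta> i - l)) j" using j by simp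
    ultimately show ?thesis by (rule alternating_eq_0[OF alternating_beta_char i(1) j(1)])
  qed
  have "add_hook N l (beta_char N M) \<beta> = (\<Sum>i\<in>I. beta_char N M (\<beta>(i := \<beta> i - l)))"
    unfolding add_hook_def using zero
    by (intro sum.mono_neutral_cong_right) (auto simp: I_def)
  also have "\<bar>\<dots>\<bar> \<le> (\<Sum>i\<in>I. c)"
    by (rule order_trans[OF sum_abs]) (rule sum_mono, rule assms(3))
  also have "(\<Sum>i\<in>I. c) = int (card I) * c" by simp
  finally have "\<bar>add_hook N l (beta_char N M) \<beta>\<bar> \<le> int (card I) * c" .
  then show ?thesis
    using mv by (rule that)
qed

text \<open>The largest orbit is sought among the points other than \<open>p\<close>, so the fixed
  point survives until the set is \<open>{p}\<close>. It costs only one point: with \<open>k\<close>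
  orbits besides the removed one, \<open>card A \<le> 1 + k * l\<close>, which limits the movable
  beads to \<open>k\<close>.\<close>

lemma beta_char_bound:
  assumes "permutation g" "finite A" "g ` A \<subseteq> A" "p \<in> A" "g p = p"
  shows "\<bar>beta_char N (cyc_type g A) \<beta>\<bar> \<le> fact (card (orbit g ` A) - 1)"
  using assms(2-4)
proof (induction A arbitrary: \<beta> rule: finite_psubset_induct)
  case (psubset A)
  note g = assms(1)
  have op: "orbit g p = {p}" using assms(5) by (simp add: orbit_eq_singleton_iff)
  show ?case
  proof (cases "beta_char N (cyc_type g A) \<beta> = 0 \<or> A = {p}")
    case True
    show ?thesis
    proof (cases "beta_char N (cyc_type g A) \<beta> = 0")
      case False
      then have A: "A = {p}" using True by simp
      then have ct: "cyc_type g A = {#1#}" by (simp add: cyc_type_def op)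
      have bd: "\<bar>beta_char N {#} \<beta>\<bar> \<le> 1" for \<beta> by (simp add: ground_def sign_def)
      have nz: "add_hook N 1 (beta_char N {#}) \<beta> \<noteq> 0" using False ct by simp
      have "(0 :: nat) < 1" by simp
      then obtain m where
        "\<bar>add_hook N 1 (beta_char N {#}) \<beta>\<bar> \<le> int m * 1" "m * 1 \<le> sum_mset {#} + 1"
        by (rule add_hook_beta_char_le[OF nz _ bd])
      then show ?thesis using ct A by simp
    qed simp
  next
    case False
    have "A - {p} \<noteq> {}" using False psubset.prems by auto
    define S where "S = (\<lambda>b. card (orbit g b)) ` (A - {p})"
    have S: "finite S" "S \<noteq> {}" using psubset.hyps \<open>A - {p} \<noteq> {}\<close> by (simp_all add: S_def)
    then have "Max S \<in> S" by (rule Max_in)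
    then obtain a where a: "a \<in> A - {p}" "Max S = card (orbit g a)" unfolding S_def by blast
    have amax: "card (orbit g b) \<le> card (orbit g a)" if "b \<in> A - {p}" for b
      using Max_ge[OF S(1)] that unfolding a(2)[symmetric] by (simp add: S_def)
    define l where "l = card (orbit g a)"
    define k where "k = card (orbit g ` (A - orbit g a))"
    have l: "l > 0" unfolding l_def by (rule card_orbit_pos[OF g])
    have pa: "p \<notin> orbit g a"
      using a(1) op orbit_eq[OF g, of p a] permutation_self_in_orbit[OF g, of a] by auto
    have aA: "a \<in> A" using a by simp
    have k: "card (orbit g ` A) = Suc k"
      using orbit_image_split[OF g psubset.prems(1) aA] psubset.hyps by (simp add: k_def)
    have pD: "p \<in> A - orbit g a" using pa psubset.prems by simp
    have k0: "k > 0" using pD psubset.hyps unfolding k_def by (auto simp: card_gt_0_iff)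
    have IH: "\<bar>beta_char N (cyc_type g (A - orbit g a)) \<beta>\<bar> \<le> fact (k - 1)" for \<beta>
      unfolding k_def
      using pD aA permutation_self_in_orbit[OF g, of a] closed_diff_orbit[OF g psubset.prems(1)]
      by (intro psubset.IH) auto
    have ct: "cyc_type g A = add_mset l (cyc_type g (A - orbit g a))"
      unfolding l_def by (rule cyc_type_split[OF g psubset.hyps psubset.prems(1) aA])
    then have n: "sum_mset (cyc_type g (A - orbit g a)) + l = card A"
      using sum_mset_cyc_type[OF g psubset.hyps psubset.prems(1)] by simp
    have "add_hook N l (beta_char N (cyc_type g (A - orbit g a))) \<beta> \<noteq> 0" using False ct by simp
    then obtain m where m: "\<bar>beta_char N (cyc_type g A) \<beta>\<bar> \<le> int m * fact (k - 1)"
      "m * l \<le> card A" "card A \<ge> 2 \<Longrightarrow> m < card A"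
      using add_hook_beta_char_le[OF _ l IH] unfolding ct n by (metis beta_char_add)
    have "card A = (\<Sum>Q\<in>orbit g ` A. card Q)"
      using sum_mset_cyc_type[OF g psubset.hyps psubset.prems(1)]
      by (simp add: cyc_type_def sum_unfold_sum_mset)
    also have "\<dots> = 1 + (\<Sum>Q\<in>orbit g ` A - {{p}}. card Q)"
      using psubset op by (subst sum.remove[of _ "{p}"]) force+
    also have "(\<Sum>Q\<in>orbit g ` A - {{p}}. card Q) \<le> of_nat (card (orbit g ` A - {{p}})) * l"
      using amax op unfolding l_def by (intro sum_bounded_above) auto
    also have "card (orbit g ` A - {{p}}) = k"
      using k op psubset by (subst card_Diff_singleton) force+
    finally have cA: "card A \<le> 1 + k * l" by simp
    have "card {p, a} \<le> card A" using psubset aA by (intro card_mono) auto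
    moreover have "p \<noteq> a" using a(1) by auto
    ultimately have c2: "card A \<ge> 2" by simp
    \<comment> \<open>From \<open>m > k\<close> the estimates
      \<open>m * l \<le> card A \<le> 1 + k * l\<close> force \<open>l = 1\<close>; then
      \<open>A\<close> has at most \<open>k + 1\<close> points, against the strict bound
      \<open>m < card A\<close>.\<close>
    have "m \<le> k"
    proof (rule ccontr)
      assume "\<not> m \<le> k"
      then have "Suc k * l \<le> m * l" by (intro mult_le_mono1) simp
      then have "l \<le> 1" using m(2) cA by simp
      then have "l = 1" using l by simp
      then show False using cA m(3)[OF c2] \<open>\<not> m \<le> k\<close> by simp
    qed
    then have "int m * fact (k - 1) \<le> int k * fact (k - 1)" by (intro mult_right_mono) auto
    also have "\<dots> = fact k" using k0 by (simp add: fact_reduce)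
    finally show ?thesis using m(1) k by simp
  qed
qed

section \<open>The square partition\<close>

text \<open>
  The beta-set \<open>{0..<N - k} \<union> {N..<N + k}\<close> of the \<open>k \<times> k\<close> square, after the beads in \<open>J\<close> have been moved
  down by \<open>k + 1\<close>.
\<close>

definition square_bead :: "nat \<Rightarrow> nat \<Rightarrow> nat set \<Rightarrow> nat \<Rightarrow> nat" where
  "square_bead N k J i = (if i \<in> J then i - 1 else if N - k \<le> i \<and> i < N then i + k else i)"

text \<open>Once the beads with labels above \<open>N - k\<close> have come down, bead
  \<open>N - k\<close> sits at \<open>N\<close> and the only gap below it is \<open>N - 1\<close>.
  It alone can move by one, and this gives an ordering of the empty partition.\<close>

lemma ground_square_bead:
  assumes k: "0 < k" "k \<le> N"
  shows "\<bar>add_hook N 1 (ground N) (square_bead N k {N - k<..<N})\<bar> = 1"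
proof -
  define J where "J = {N - k<..<N}"
  define \<beta> where "\<beta> = square_bead N k J"
  define i0 where "i0 = N - k"
  have i0: "i0 < N" "N \<le> i0 + k" using k by (auto simp: i0_def)
  have J: "i \<in> J \<longleftrightarrow> i0 < i \<and> i < N" for i by (auto simp: J_def i0_def)
  have \<beta>: "\<beta> i = (if i0 < i \<and> i < N then i - 1 else if i = i0 then N else i)" for i
    using k by (auto simp: \<beta>_def square_bead_def J i0_def)
  have \<beta>0: "\<beta> i0 = N" by (simp add: \<beta>)
  have "(\<Sum>i<N. if 1 \<le> \<beta> i then ground N (\<beta>(i := \<beta> i - 1)) else 0)
      = (\<Sum>i\<in>{i0}. ground N (\<beta>(i := \<beta> i - 1)))"
  proof (intro sum.mono_neutral_cong_right ballI)
    fix i assume i: "i \<in> {..<N} - {i0}"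
    show "(if 1 \<le> \<beta> i then ground N (\<beta>(i := \<beta> i - 1)) else 0) = 0"
    proof (cases "1 \<le> \<beta> i")
      case True
      \<comment> \<open>Bead \<open>i\<close> is blocked by bead \<open>i - 1\<close>, except for
        \<open>i = Suc i0\<close>, whose target is held by bead \<open>i0 - 1\<close>.\<close>
      have "\<beta> (i - 1) = \<beta> i - 1 \<or> \<beta> (i0 - 1) = \<beta> i - 1 \<and> i0 - 1 < i0"
        using True i i0 unfolding \<beta> by (cases "i = Suc i0") auto
      then obtain j where j: "j < N" "j \<noteq> i" "\<beta> j = \<beta> i - 1"
      proof
        assume e: "\<beta> (i - 1) = \<beta> i - 1"
        moreover have "\<beta> i - 1 < \<beta> i" using True by simp
        ultimately have "\<beta> (i - 1) \<noteq> \<beta> i" by linarith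
        then have "i - 1 \<noteq> i" by metis
        moreover have "i - 1 < N" using i by (simp add: less_imp_diff_less)
        ultimately show ?thesis using e by (intro that[of "i - 1"]) simp_all
      next
        assume e: "\<beta> (i0 - 1) = \<beta> i - 1 \<and> i0 - 1 < i0"
        then have "i \<noteq> i0 - 1" using True by auto
        then show ?thesis using that[of "i0 - 1"] i0 e by auto
      qed
      have "ground N (\<beta>(i := \<beta> i - 1)) = 0"
        using i j by (intro alternating_eq_0[OF alternating_ground, where i = i and j = j]) auto
      then show ?thesis by simp
    qed simp
  qed (use i0 \<beta> in auto)
  then have "add_hook N 1 (ground N) \<beta> = ground N (\<beta>(i0 := N - 1))"
    unfolding add_hook_def by (rule trans) (simp add: \<beta>0)
  moreover have "\<beta>(i0 := N - 1) permutes {..<N}"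
  proof (rule bij_imp_permutes)
    have "inj_on (\<beta>(i0 := N - 1)) {..<N}"
      using i0 by (auto simp: inj_on_def \<beta> split: if_splits)
    moreover have "(\<beta>(i0 := N - 1)) ` {..<N} \<subseteq> {..<N}"
      using i0 by (auto simp: \<beta>)
    ultimately show "bij_betw (\<beta>(i0 := N - 1)) {..<N} {..<N}"
      unfolding bij_betw_def using endo_inj_surj[OF finite_lessThan] by blast
  qed (use i0 in \<open>auto simp: \<beta>\<close>)
  ultimately show ?thesis
    unfolding \<beta>_def J_def by (simp add: ground_def sign_def)
qed

text \<open>The beads of \<open>{N - k<..<N}\<close> come down independently, each from
  \<open>i + k\<close> to \<open>i - 1\<close>, and keep their labels, so every order of the moves
  leads to the same configuration with the same sign. Counting orders gives the factorial.\<close>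

lemma beta_char_square_step:
  assumes "0 < k" "k \<le> N" "J \<subseteq> {N - k<..<N}"
  shows "beta_char N (add_mset 1 (replicate_mset (card ({N - k<..<N} - J)) (k + 1))) (square_bead N k J)
       = fact (card ({N - k<..<N} - J)) * add_hook N 1 (ground N) (square_bead N k {N - k<..<N})"
  using assms(3)
proof (induction "card ({N - k<..<N} - J)" arbitrary: J)
  case 0
  then have "{N - k<..<N} - J = {}" by simp
  then have "J = {N - k<..<N}" using 0 by auto
  then show ?case by simp
next
  case (Suc j)
  define T where "T = {N - k<..<N}"
  define i0 where "i0 = N - k"
  have i0: "i0 < N" "i0 + k = N" using assms by (auto simp: i0_def)
  have T: "i \<in> T \<longleftrightarrow> i0 < i \<and> i < N" for i by (auto simp: T_def i0_def)
  have J: "J \<subseteq> T" using Suc by (simp add: T_def)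
  have j: "card (T - J) = Suc j" using Suc by (simp add: T_def)
  define s where "s = beta_char N (add_mset 1 (replicate_mset j (k + 1)))"
  define c where "c = add_hook N 1 (ground N) (square_bead N k T)"
  define \<beta> where "\<beta> = square_bead N k J"
  have \<beta>: "\<beta> i = (if i \<in> J then i - 1 else if i0 \<le> i \<and> i < N then i + k else i)" for i
    by (simp add: \<beta>_def square_bead_def i0_def)
  have moved: "s (\<beta>(i := \<beta> i - (k + 1))) = fact j * c" if i: "i \<in> T - J" for i
  proof -
    have "\<beta>(i := \<beta> i - (k + 1)) = square_bead N k (insert i J)"
      using i by (auto simp: fun_eq_iff square_bead_def \<beta>_def T i0_def)
    moreover have "card (T - insert i J) = j"
      using i j by (metis Diff_insert card_Diff_singleton diff_Suc_1)
    ultimately show ?thesis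
      using Suc(1)[of "insert i J"] i J unfolding s_def c_def T_def[symmetric] by simp
  qed
  \<comment> \<open>Every other bead that has room to go down would land at some \<open>v\<close>
    below \<open>N - k\<close>, where the unmoved bead \<open>v\<close> sits.\<close>
  have stuck: "s (\<beta>(i := \<beta> i - (k + 1))) = 0" if i: "i < N" "i \<notin> T - J" "k + 1 \<le> \<beta> i" for i
  proof -
    define v where "v = \<beta> i - (k + 1)"
    have v: "v < i0" "v < i"
      using i J i0 assms(1) unfolding v_def \<beta> by (auto simp: T split: if_splits)
    then have "\<beta> v = v" using J by (auto simp: \<beta> T)
    then show ?thesis
      using i v i0 unfolding s_def v_def[symmetric]
      by (intro alternating_eq_0[OF alternating_beta_char, where i = i and j = v]) auto
  qed
  \<comment> \<open>The fold does not depend on the order, so a hook of length \<open>k + 1\<close>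
    can be taken out before the single box.\<close>
  have "add_mset 1 (replicate_mset (Suc j) (k + 1)) = add_mset (k + 1) (add_mset 1 (replicate_mset j (k + 1)))"
    by (simp add: add_mset_commute)
  then have "beta_char N (add_mset 1 (replicate_mset (Suc j) (k + 1))) \<beta> = add_hook N (k + 1) s \<beta>"
    unfolding s_def by (simp only: beta_char_add)
  also have "\<dots> = (\<Sum>i\<in>T - J. fact j * c)"
    unfolding add_hook_def
  proof (intro sum.mono_neutral_cong_right ballI)
    fix i assume "i \<in> {..<N} - (T - J)"
    then show "(if k + 1 \<le> \<beta> i then s (\<beta>(i := \<beta> i - (k + 1))) else 0) = 0"
      using stuck[of i] by simp
  next
    fix i assume i: "i \<in> T - J"
    then have "k + 1 \<le> \<beta> i" using T by (auto simp: \<beta>)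
    then show "(if k + 1 \<le> \<beta> i then s (\<beta>(i := \<beta> i - (k + 1))) else 0) = fact j * c"
      using moved[OF i] by simp
  qed (auto simp: T)
  also have "\<dots> = fact (Suc j) * c" using j by simp
  finally show ?case using j unfolding \<beta>_def c_def T_def by simp
qed

lemma beta_char_square:
  assumes "0 < k" "k \<le> N"
  shows "\<bar>beta_char N (add_mset 1 (replicate_mset (k - 1) (k + 1))) (square_bead N k {})\<bar> = fact (k - 1)"
  using beta_char_square_step[OF assms, of "{}"] ground_square_bead[OF assms] assms
  by (simp add: abs_mult)

text \<open>Each part \<open>m\<close> attaches a cycle on the next \<open>m\<close> numbers; zero
  parts are excluded because orbits are nonempty.\<close>

lemma ex_permutation_with_cyc_type:
  assumes "0 \<notin># M"
  shows "\<exists>g. g permutes {1..sum_mset M} \<and> cyc_type g {1..sum_mset M} = M"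
  using assms
proof (induction M)
  case empty
  then show ?case by (intro exI[of _ id]) (simp add: permutes_id id_def[symmetric])
next
  case (add m M)
  then obtain g where g: "g permutes {1..sum_mset M}" "cyc_type g {1..sum_mset M} = M" by auto
  define s where "s = sum_mset M"
  have m: "m > 0" using add.prems by (cases m) auto
  \<comment> \<open>The wrap-around case is tested first so that \<open>m = 1\<close> gives a fixed
    point.\<close>
  define h where "h x = (if x = s + m then s + 1 else if s < x \<and> x < s + m then x + 1 else g x)" for x
  have gs: "g x = x" if "x \<notin> {1..s}" for x using g(1) that by (simp add: s_def permutes_def)
  have gin: "g x \<in> {1..s}" if "x \<in> {1..s}" for x
    using permutes_in_image[OF g(1)] that by (simp add: s_def)
  have h_old: "h x = g x" if "x \<in> {1..s}" for x using that m by (auto simp: h_def)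
  have h_perm: "h permutes {1..s + m}"
  proof (rule bij_imp_permutes)
    have "inj_on h {1..s + m}"
    proof (rule inj_onI)
      fix x y assume xy: "x \<in> {1..s + m}" "y \<in> {1..s + m}" "h x = h y"
      have new: "h z > s" if "z \<in> {1..s + m}" "z > s" for z using that by (auto simp: h_def)
      consider "x \<le> s" "y \<le> s" | "x > s" "y > s" | "x \<le> s" "y > s" | "x > s" "y \<le> s" by linarith
      then show "x = y"
      proof cases
        case 1
        then show ?thesis using xy h_old permutes_inj[OF g(1)] by (auto simp: inj_eq)
      next
        case 2 then show ?thesis using xy by (auto simp: h_def split: if_splits)
      next
        case 3
        then show ?thesis using new[of y] gin[of x] h_old[of x] xy by auto
      next
        case 4
        then show ?thesis using new[of x] gin[of y] h_old[of y] xy by auto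
      qed
    qed
    moreover have "h ` {1..s + m} \<subseteq> {1..s + m}"
    proof safe
      fix x assume "x \<in> {1..s + m}"
      then show "h x \<in> {1..s + m}" using gin[of x] h_old[of x] m by (cases "x \<le> s") (auto simp: h_def)
    qed
    ultimately show "bij_betw h {1..s + m} {1..s + m}" by (simp add: bij_betw_def endo_inj_surj)
  next
    fix x assume "x \<notin> {1..s + m}"
    then show "h x = x" using gs[of x] m by (auto simp: h_def)
  qed
  then have perm: "permutation h" by (auto simp: permutation_permutes)
  have pow: "(h ^^ i) (s + 1) = s + 1 + i" if "i < m" for i
    using that by (induction i) (auto simp: h_def)
  have "(h ^^ m) (s + 1) = h ((h ^^ (m - 1)) (s + 1))" using m by (cases m) auto
  also have "\<dots> = s + 1" using pow[of "m - 1"] m by (simp add: h_def)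
  finally have "orbit h (s + 1) = {(h ^^ i) (s + 1) | i. i < m}"
    using m by (intro orbit_altdef_bounded)
  also have "\<dots> = {s + 1 + i | i. i < m}" using pow by force
  also have "\<dots> = {s + 1..s + m}"
  proof safe
    fix x assume "x \<in> {s + 1..s + m}"
    then have "x = s + 1 + (x - (s + 1))" "x - (s + 1) < m" by auto
    then show "\<exists>i. x = s + 1 + i \<and> i < m" by blast
  qed auto
  finally have orb: "orbit h (s + 1) = {s + 1..s + m}" .
  have "{1..s + m} - orbit h (s + 1) = {1..s}" unfolding orb by auto
  moreover have "h ` {1..s + m} \<subseteq> {1..s + m}" using permutes_image[OF h_perm] by simp
  ultimately have "cyc_type h {1..s + m} = add_mset m (cyc_type h {1..s})"
    using cyc_type_split[OF perm, of "{1..s + m}" "s + 1"] m orb by simp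
  also have "orbit h ` {1..s} = orbit g ` {1..s}"
    by (intro image_cong refl orbit_cong0[where A = "{1..s}"]) (use h_old gin in auto)
  then have "cyc_type h {1..s} = M" using g(2) by (simp add: cyc_type_def s_def)
  finally show ?case using h_perm by (auto simp: s_def add.commute)
qed

section \<open>Matrix representations\<close>

text \<open>Invertibility follows from multiplicativity and the value at the unit: the image of the
  inverse element is the inverse matrix.\<close>

lemma matrix_representation_iff:
  assumes "group G"
  shows "matrix_representation G d \<rho> \<longleftrightarrow>
    (\<forall>x\<in>carrier G. \<rho> x \<in> carrier_mat d d) \<and>
    (\<forall>x\<in>carrier G. \<forall>y\<in>carrier G. \<rho> (x \<otimes>\<^bsub>G\<^esub> y) = \<rho> x * \<rho> y) \<and> \<rho> \<one>\<^bsub>G\<^esub> = 1\<^sub>m d"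
    (is "_ \<longleftrightarrow> ?R")
proof -
  interpret G: group G by fact
  let ?M = "ring_mat TYPE(complex) d ()"
  interpret M: ring ?M by (rule ring_mat)
  have U: "group (units_of ?M)" by (rule M.units_group)
  have simps: "\<And>A B. A \<otimes>\<^bsub>units_of ?M\<^esub> B = A * B" "\<one>\<^bsub>units_of ?M\<^esub> = 1\<^sub>m d"
    "carrier (units_of ?M) = {A \<in> carrier_mat d d. \<exists>B\<in>carrier_mat d d. B * A = 1\<^sub>m d \<and> A * B = 1\<^sub>m d}"
    by (auto simp: units_of_def Units_def ring_mat_def)
  show ?thesis
  proof
    assume "matrix_representation G d \<rho>"
    then have h: "\<rho> \<in> hom G (units_of ?M)"
      by (simp add: matrix_representation_def general_linear_group_def)
    then have "\<rho> \<one>\<^bsub>G\<^esub> = \<one>\<^bsub>units_of ?M\<^esub>" by (rule hom_one[OF _ assms U])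
    then show ?R using h by (auto simp: hom_def simps)
  next
    assume R: ?R
    have "\<rho> x \<in> carrier (units_of ?M)" if x: "x \<in> carrier G" for x
    proof -
      have "\<rho> (inv\<^bsub>G\<^esub> x) * \<rho> x = 1\<^sub>m d" "\<rho> x * \<rho> (inv\<^bsub>G\<^esub> x) = 1\<^sub>m d"
        using R x by (metis G.inv_closed G.l_inv, metis G.inv_closed G.r_inv)
      then show ?thesis using R x unfolding simps by blast
    qed
    then show "matrix_representation G d \<rho>"
      using R by (auto simp: matrix_representation_def general_linear_group_def hom_def simps)
  qed
qed

lemma matrix_representation_closed:
  "group G \<Longrightarrow> matrix_representation G d \<rho> \<Longrightarrow> x \<in> carrier G \<Longrightarrow> \<rho> x \<in> carrier_mat d d"
  by (simp add: matrix_representation_iff)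

lemma matrix_representation_mult:
  "group G \<Longrightarrow> matrix_representation G d \<rho> \<Longrightarrow> x \<in> carrier G \<Longrightarrow> y \<in> carrier G \<Longrightarrow>
    \<rho> (x \<otimes>\<^bsub>G\<^esub> y) = \<rho> x * \<rho> y"
  by (simp add: matrix_representation_iff)

section \<open>Traces of complex matrices\<close>

lemma mat_mult_entry:
  assumes "A \<in> carrier_mat n m" "B \<in> carrier_mat m l" "i < n" "j < l"
  shows "(A * B) $$ (i, j) = (\<Sum>k<m. A $$ (i, k) * B $$ (k, j))"
  using assms by (simp add: scalar_prod_def lessThan_atLeast0)

lemma mat_trace_comm:
  assumes "A \<in> carrier_mat n m" "B \<in> carrier_mat m n"
  shows "mat_trace (A * B) = mat_trace (B * A)"
proof -
  have "mat_trace (A * B) = (\<Sum>i<n. \<Sum>k<m. A $$ (i, k) * B $$ (k, i))"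
    using assms by (simp add: mat_trace_def mat_mult_entry[OF assms] mat_mult_entry[OF assms(2,1)] del: index_mult_mat(1))
  also have "\<dots> = (\<Sum>k<m. \<Sum>i<n. B $$ (k, i) * A $$ (i, k))"
    by (subst sum.swap) (simp add: mult.commute)
  also have "\<dots> = mat_trace (B * A)"
    using assms by (simp add: mat_trace_def mat_mult_entry[OF assms] mat_mult_entry[OF assms(2,1)] del: index_mult_mat(1))
  finally show ?thesis .
qed

lemma mat_trace_similar:
  assumes "P \<in> carrier_mat n n" "Q \<in> carrier_mat n n" "B \<in> carrier_mat n n" "Q * P = 1\<^sub>m n"
  shows "mat_trace (P * B * Q) = mat_trace B"
proof -
  have "mat_trace (P * B * Q) = mat_trace (Q * (P * B))"
    using assms by (intro mat_trace_comm[of _ n n]) auto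
  also have "Q * (P * B) = B" using assms by (simp flip: assoc_mult_mat[of Q n n P n B n])
  finally show ?thesis .
qed

text \<open>After triangularisation each diagonal entry squares to itself and is therefore 0 or 1.
  This is where natural numbers enter the character computations.\<close>

lemma mat_trace_idempotent:
  assumes A: "A \<in> carrier_mat n n" and idem: "A * A = A"
  shows "\<exists>r::nat. mat_trace A = of_nat r"
proof -
  obtain es where "char_poly A = (\<Prod>a\<leftarrow>es. [:- a, 1:])" using char_poly_factorized[OF A] by blast
  from schur_decomposition_exists[OF A this] obtain B where
    B: "B \<in> carrier_mat n n" "upper_triangular B" "similar_mat A B" by blast
  then obtain P Q where "similar_mat_wit A B P Q" by (auto simp: similar_mat_def)
  note w = similar_mat_witD2[OF A this]
  have P: "P \<in> carrier_mat n n" and Q: "Q \<in> carrier_mat n n" and PQ: "P * Q = 1\<^sub>m n" "Q * P = 1\<^sub>m n"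
    and AB: "A = P * B * Q" using w by auto
  have tr: "mat_trace A = mat_trace B" unfolding AB by (rule mat_trace_similar[OF P Q B(1) PQ(2)])
  have BA: "B = Q * A * P"
  proof -
    have "Q * A * P = (Q * P) * B * (Q * P)"
      unfolding AB using P Q B(1) by (simp add: assoc_mult_mat[of _ n n _ n _ n])
    then show ?thesis using PQ B(1) by simp
  qed
  have "B * B = Q * A * (P * Q) * A * P"
    unfolding BA using P Q A by (simp add: assoc_mult_mat[of _ n n _ n _ n])
  also have "\<dots> = Q * (A * A) * P" using P Q A PQ by (simp add: assoc_mult_mat[of _ n n _ n _ n])
  finally have BB: "B * B = B" using idem BA by simp
  have diag: "B $$ (i, i) = 0 \<or> B $$ (i, i) = 1" if i: "i < n" for i
  proof -
    have "B $$ (i, i) = (\<Sum>k<n. B $$ (i, k) * B $$ (k, i))"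
      using mat_mult_entry[OF B(1) B(1) i i] BB by simp
    also have "\<dots> = (\<Sum>k\<in>{i}. B $$ (i, k) * B $$ (k, i))"
    proof (rule sum.mono_neutral_right)
      show "\<forall>k\<in>{..<n} - {i}. B $$ (i, k) * B $$ (k, i) = 0"
      proof
        fix k assume k: "k \<in> {..<n} - {i}"
        then have "k < i \<or> i < k" by auto
        then show "B $$ (i, k) * B $$ (k, i) = 0"
          using B(1,2) i k by (auto simp: upper_triangular_def)
      qed
    qed (use i in auto)
    finally show ?thesis by simp
  qed
  have "mat_trace B = (\<Sum>i<n. if B $$ (i, i) = 1 then 1 else 0)"
    unfolding mat_trace_def using B(1) diag by (intro sum.cong) auto
  also have "\<dots> = of_nat (card {i \<in> {..<n}. B $$ (i, i) = 1})"
    by (simp add: sum.If_cases Int_def)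
  finally show ?thesis using tr by auto
qed

text \<open>Taken entrywise with the dimension as a parameter: matrices of all sizes share one type,
  so no single zero matrix could serve as the empty sum.\<close>

definition mat_sum :: "nat \<Rightarrow> ('a \<Rightarrow> complex mat) \<Rightarrow> 'a set \<Rightarrow> complex mat" where
  "mat_sum d F S = mat d d (\<lambda>ij. \<Sum>x\<in>S. F x $$ ij)"

lemma mat_sum_carrier [simp]: "mat_sum d F S \<in> carrier_mat d d"
  by (simp add: mat_sum_def)

lemma mat_sum_entry: "i < d \<Longrightarrow> j < d \<Longrightarrow> mat_sum d F S $$ (i, j) = (\<Sum>x\<in>S. F x $$ (i, j))"
  by (simp add: mat_sum_def)

lemma mat_trace_mat_sum:
  assumes "\<And>x. x \<in> S \<Longrightarrow> F x \<in> carrier_mat d d"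
  shows "mat_trace (mat_sum d F S) = (\<Sum>x\<in>S. mat_trace (F x))"
proof -
  have "mat_trace (mat_sum d F S) = (\<Sum>i<d. \<Sum>x\<in>S. F x $$ (i, i))"
    by (simp add: mat_trace_def mat_sum_def)
  also have "\<dots> = (\<Sum>x\<in>S. \<Sum>i<d. F x $$ (i, i))" by (rule sum.swap)
  also have "\<dots> = (\<Sum>x\<in>S. mat_trace (F x))"
    using assms by (intro sum.cong refl) (auto simp: mat_trace_def)
  finally show ?thesis .
qed

lemma mat_sum_mult_left:
  assumes A: "A \<in> carrier_mat d d" and F: "\<And>x. x \<in> S \<Longrightarrow> F x \<in> carrier_mat d d"
  shows "A * mat_sum d F S = mat_sum d (\<lambda>x. A * F x) S"
proof (rule eq_matI)
  fix i j assume ij: "i < dim_row (mat_sum d (\<lambda>x. A * F x) S)" "j < dim_col (mat_sum d (\<lambda>x. A * F x) S)"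
  then have ij: "i < d" "j < d" by (auto simp: mat_sum_def)
  have "(A * mat_sum d F S) $$ (i, j) = (\<Sum>k<d. \<Sum>x\<in>S. A $$ (i, k) * F x $$ (k, j))"
    using ij by (simp add: mat_mult_entry[OF A mat_sum_carrier] mat_sum_entry sum_distrib_left del: index_mult_mat(1))
  also have "\<dots> = (\<Sum>x\<in>S. \<Sum>k<d. A $$ (i, k) * F x $$ (k, j))" by (rule sum.swap)
  also have "\<dots> = mat_sum d (\<lambda>x. A * F x) S $$ (i, j)"
    using ij F by (simp add: mat_sum_entry mat_mult_entry[OF A, where l = d] del: index_mult_mat(1))
  finally show "(A * mat_sum d F S) $$ (i, j) = mat_sum d (\<lambda>x. A * F x) S $$ (i, j)" .
qed (use A in \<open>auto simp: mat_sum_def\<close>)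

lemma mat_sum_mult_right:
  assumes A: "A \<in> carrier_mat d d" and F: "\<And>x. x \<in> S \<Longrightarrow> F x \<in> carrier_mat d d"
  shows "mat_sum d F S * A = mat_sum d (\<lambda>x. F x * A) S"
proof (rule eq_matI)
  fix i j assume ij: "i < dim_row (mat_sum d (\<lambda>x. F x * A) S)" "j < dim_col (mat_sum d (\<lambda>x. F x * A) S)"
  then have ij: "i < d" "j < d" by (auto simp: mat_sum_def)
  have "(mat_sum d F S * A) $$ (i, j) = (\<Sum>k<d. \<Sum>x\<in>S. F x $$ (i, k) * A $$ (k, j))"
    using ij A by (simp add: mat_mult_entry[OF mat_sum_carrier A] mat_sum_entry sum_distrib_right del: index_mult_mat(1))
  also have "\<dots> = (\<Sum>x\<in>S. \<Sum>k<d. F x $$ (i, k) * A $$ (k, j))" by (rule sum.swap)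
  also have "\<dots> = mat_sum d (\<lambda>x. F x * A) S $$ (i, j)"
    using ij F A by (simp add: mat_sum_entry mat_mult_entry[OF _ A, where n = d] del: index_mult_mat(1))
  finally show "(mat_sum d F S * A) $$ (i, j) = mat_sum d (\<lambda>x. F x * A) S $$ (i, j)" .
qed (use A in \<open>auto simp: mat_sum_def\<close>)

section \<open>Averaging over a finite group\<close>

lemma bij_betw_mult_left:
  assumes "group G" "y \<in> carrier G"
  shows "bij_betw (\<lambda>x. y \<otimes>\<^bsub>G\<^esub> x) (carrier G) (carrier G)"
proof -
  interpret group G by fact
  show ?thesis using assms(2)
    by (intro bij_betw_byWitness[where f' = "\<lambda>x. inv\<^bsub>G\<^esub> y \<otimes>\<^bsub>G\<^esub> x"]) (auto simp: m_assoc[symmetric])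
qed

text \<open>The average of \<open>\<rho>\<close> is idempotent, being the projection onto the
  invariant vectors, so its trace is a natural number.\<close>

lemma sum_character_eq:
  assumes G: "group G" and fin: "finite (carrier G)" and \<rho>: "matrix_representation G d \<rho>"
  shows "\<exists>r::nat. (\<Sum>x\<in>carrier G. mat_trace (\<rho> x)) = of_nat (card (carrier G)) * of_nat r"
proof -
  interpret group G by fact
  define S where "S = mat_sum d \<rho> (carrier G)"
  define c where "c = (of_nat (card (carrier G)) :: complex)"
  have c0: "c \<noteq> 0" using fin one_closed by (auto simp: c_def)
  note cl = matrix_representation_closed[OF G \<rho>]
  have S: "S \<in> carrier_mat d d" by (simp add: S_def)
  have \<rho>S: "\<rho> y * S = S" if y: "y \<in> carrier G" for y
  proof -
    have "\<rho> y * S = mat_sum d (\<lambda>x. \<rho> y * \<rho> x) (carrier G)"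
      unfolding S_def using cl y by (intro mat_sum_mult_left) auto
    also have "\<dots> = mat_sum d (\<lambda>x. \<rho> (y \<otimes>\<^bsub>G\<^esub> x)) (carrier G)"
      unfolding mat_sum_def
      by (intro cong_mat sum.cong refl) (simp add: matrix_representation_mult[OF G \<rho> y])
    also have "\<dots> = S"
      unfolding S_def mat_sum_def
      by (intro cong_mat refl sum.reindex_bij_betw[OF bij_betw_mult_left[OF G y], of "\<lambda>x. \<rho> x $$ _"])
    finally show ?thesis .
  qed
  have SS: "S * S = c \<cdot>\<^sub>m S"
  proof -
    have "S * S = mat_sum d (\<lambda>x. \<rho> x * S) (carrier G)"
      unfolding S_def using cl by (intro mat_sum_mult_right) auto
    also have "\<dots> = c \<cdot>\<^sub>m S"
      using S by (intro eq_matI) (auto simp: mat_sum_def \<rho>S c_def)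
    finally show ?thesis .
  qed
  define P where "P = inverse c \<cdot>\<^sub>m S"
  have "P \<in> carrier_mat d d" using S by (simp add: P_def)
  moreover have "P * P = P"
  proof -
    have "P * P = inverse c \<cdot>\<^sub>m (inverse c \<cdot>\<^sub>m (c \<cdot>\<^sub>m S))"
      using S unfolding P_def
      by (simp add: mult_smult_assoc_mat[of S d d _ d] mult_smult_distrib[of S d d _ d] SS)
    also have "\<dots> = P" using S c0 unfolding P_def by (intro eq_matI) auto
    finally show ?thesis .
  qed
  ultimately obtain r :: nat where r: "mat_trace P = of_nat r" using mat_trace_idempotent by blast
  have "mat_trace S = c * mat_trace P"
    using S c0 by (simp add: P_def mat_trace_def sum_distrib_left mult.assoc[symmetric])
  moreover have "mat_trace S = (\<Sum>x\<in>carrier G. mat_trace (\<rho> x))"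
    unfolding S_def using cl by (rule mat_trace_mat_sum)
  ultimately show ?thesis using r by (auto simp: c_def)
qed

lemma subspace_module_vecI:
  assumes "W \<subseteq> carrier_vec d" "0\<^sub>v d \<in> W" "\<And>v w. v \<in> W \<Longrightarrow> w \<in> W \<Longrightarrow> v + w \<in> W"
    and "\<And>c v. v \<in> W \<Longrightarrow> c \<cdot>\<^sub>v v \<in> W"
  shows "VectorSpace.subspace class_ring W (module_vec TYPE(complex) d)"
proof -
  interpret V: vec_space "TYPE(complex)" d .
  show ?thesis
    using assms V.module_axioms V.vectorspace_axioms
    by (intro subspace.intro submodule.intro) (auto simp: module_vec_def)
qed

text \<open>An eigenspace of \<open>A\<close> is invariant and nonzero, hence the whole
  space.\<close>

lemma schur_lemma:
  assumes "irreducible_representation G d \<rho>" and G: "group G" and A: "A \<in> carrier_mat d d"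
    and comm: "\<And>x. x \<in> carrier G \<Longrightarrow> A * \<rho> x = \<rho> x * A"
  shows "\<exists>c. A = c \<cdot>\<^sub>m 1\<^sub>m d"
proof -
  have \<rho>: "matrix_representation G d \<rho>" and d: "d > 0"
    and irr: "\<And>W. invariant_subspace G d \<rho> W \<Longrightarrow> W = {0\<^sub>v d} \<or> W = carrier_vec d"
    using assms(1) by (auto simp: irreducible_representation_def)
  note cl = matrix_representation_closed[OF G \<rho>]
  obtain c where "eigenvalue A c" using spectrum_non_empty[OF A d] by (auto simp: spectrum_def)
  then obtain v where v: "v \<in> carrier_vec d" "v \<noteq> 0\<^sub>v d" "A *\<^sub>v v = c \<cdot>\<^sub>v v"
    using A by (auto simp: eigenvalue_def eigenvector_def)
  define W where "W = {w \<in> carrier_vec d. A *\<^sub>v w = c \<cdot>\<^sub>v w}"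
  have "VectorSpace.subspace class_ring W (module_vec TYPE(complex) d)"
    using A by (intro subspace_module_vecI)
      (auto simp: W_def mult_add_distrib_mat_vec smult_add_distrib_vec mult_mat_vec smult_smult_assoc mult.commute)
  moreover have "\<rho> x *\<^sub>v w \<in> W" if x: "x \<in> carrier G" and w: "w \<in> W" for x w
  proof -
    have wc: "w \<in> carrier_vec d" using w by (simp add: W_def)
    have "A *\<^sub>v (\<rho> x *\<^sub>v w) = (A * \<rho> x) *\<^sub>v w" using A cl[OF x] wc by (simp add: assoc_mult_mat_vec)
    also have "\<dots> = \<rho> x *\<^sub>v (A *\<^sub>v w)" using A cl[OF x] wc by (simp add: comm[OF x] assoc_mult_mat_vec)
    also have "\<dots> = c \<cdot>\<^sub>v (\<rho> x *\<^sub>v w)"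
      using w cl[OF x] wc by (simp add: W_def mult_mat_vec)
    finally show ?thesis using cl[OF x] wc by (auto simp: W_def)
  qed
  ultimately have "invariant_subspace G d \<rho> W" by (simp add: invariant_subspace_def)
  then have "W = {0\<^sub>v d} \<or> W = carrier_vec d" by (rule irr)
  moreover have "v \<in> W" using v by (simp add: W_def)
  ultimately have "carrier_vec d \<subseteq> W" using v(2) by blast
  then have e: "A *\<^sub>v unit_vec d j = c \<cdot>\<^sub>v unit_vec d j" for j
    using unit_vec_carrier[of d j] unfolding W_def by blast
  have "A = c \<cdot>\<^sub>m 1\<^sub>m d"
  proof (rule eq_matI)
    fix i j assume "i < dim_row (c \<cdot>\<^sub>m 1\<^sub>m d)" "j < dim_col (c \<cdot>\<^sub>m 1\<^sub>m d)"
    then have ij: "i < d" "j < d" by auto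
    then have "A $$ (i, j) = (A *\<^sub>v unit_vec d j) $ i" using A by simp
    also have "\<dots> = (c \<cdot>\<^sub>m 1\<^sub>m d) $$ (i, j)" unfolding e using ij by simp
    finally show "A $$ (i, j) = (c \<cdot>\<^sub>m 1\<^sub>m d) $$ (i, j)" .
  qed (use A in auto)
  then show ?thesis by blast
qed

text \<open>The product of the two traces is the sum over \<open>k\<close> and \<open>l\<close> of
  the \<open>(k, l)\<close> entry of \<open>\<rho> x * E k l * \<rho> (inv x)\<close>. Summing over
  the group makes this matrix scalar by Schur's lemma, and the scalar is read off from the
  trace.\<close>

lemma sum_character_inverse:
  assumes "irreducible_representation G d \<rho>" and G: "group G" and fin: "finite (carrier G)"
  shows "(\<Sum>x\<in>carrier G. mat_trace (\<rho> x) * mat_trace (\<rho> (inv\<^bsub>G\<^esub> x))) = of_nat (card (carrier G))"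
proof -
  interpret group G by fact
  have \<rho>: "matrix_representation G d \<rho>" and d: "d > 0"
    using assms(1) by (auto simp: irreducible_representation_def)
  note cl = matrix_representation_closed[OF G \<rho>]
  define n where "n = (of_nat (card (carrier G)) :: complex)"
  define E where "E k l = mat d d (\<lambda>ij. if ij = (k, l) then 1 else (0 :: complex))" for k l
  have E: "E k l \<in> carrier_mat d d" for k l by (simp add: E_def)
  define M where "M k l x = \<rho> x * E k l * \<rho> (inv\<^bsub>G\<^esub> x)" for k l x
  have M: "M k l x \<in> carrier_mat d d" if "x \<in> carrier G" for k l x
    unfolding M_def using cl[OF that] cl[of "inv\<^bsub>G\<^esub> x"] that E by (intro mult_carrier_mat[of _ d d]) auto
  define S where "S k l = mat_sum d (M k l) (carrier G)" for k l
  have entry: "M k l x $$ (k, l) = \<rho> x $$ (k, k) * \<rho> (inv\<^bsub>G\<^esub> x) $$ (l, l)"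
    if "x \<in> carrier G" "k < d" "l < d" for k l x
  proof -
    have 1: "(\<rho> x * E k l) $$ (k, j) = (if j = l then \<rho> x $$ (k, k) else 0)" if "j < d" for j
    proof -
      have "(\<rho> x * E k l) $$ (k, j) = (\<Sum>i<d. \<rho> x $$ (k, i) * E k l $$ (i, j))"
        using cl[OF \<open>x \<in> carrier G\<close>] E \<open>k < d\<close> that by (intro mat_mult_entry) auto
      also have "\<dots> = (\<Sum>i<d. if i = k then (if j = l then \<rho> x $$ (k, k) else 0) else 0)"
        using that \<open>k < d\<close> by (intro sum.cong refl) (auto simp: E_def)
      also have "\<dots> = (if j = l then \<rho> x $$ (k, k) else 0)" using \<open>k < d\<close> by simp
      finally show ?thesis .
    qed
    have "M k l x $$ (k, l) = (\<Sum>j<d. (\<rho> x * E k l) $$ (k, j) * \<rho> (inv\<^bsub>G\<^esub> x) $$ (j, l))"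
      unfolding M_def using cl[OF that(1)] cl[of "inv\<^bsub>G\<^esub> x"] that E by (intro mat_mult_entry) auto
    also have "\<dots> = (\<Sum>j<d. if j = l then \<rho> x $$ (k, k) * \<rho> (inv\<^bsub>G\<^esub> x) $$ (l, l) else 0)"
      by (intro sum.cong refl) (auto simp: 1)
    also have "\<dots> = \<rho> x $$ (k, k) * \<rho> (inv\<^bsub>G\<^esub> x) $$ (l, l)" using that by simp
    finally show ?thesis .
  qed
  have comm: "S k l * \<rho> y = \<rho> y * S k l" if y: "y \<in> carrier G" for k l y
  proof -
    have "\<rho> y * M k l x = M k l (y \<otimes>\<^bsub>G\<^esub> x) * \<rho> y" if x: "x \<in> carrier G" for x
    proof -
      have "\<rho> (inv\<^bsub>G\<^esub> (y \<otimes>\<^bsub>G\<^esub> x)) * \<rho> y = \<rho> (inv\<^bsub>G\<^esub> x)"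
        using x y by (simp add: matrix_representation_mult[OF G \<rho>, symmetric] inv_mult_group m_assoc)
      note inv = this
      have c: "\<rho> x \<in> carrier_mat d d" "\<rho> y \<in> carrier_mat d d" "\<rho> (inv\<^bsub>G\<^esub> x) \<in> carrier_mat d d"
        "\<rho> (inv\<^bsub>G\<^esub> (y \<otimes>\<^bsub>G\<^esub> x)) \<in> carrier_mat d d" "\<rho> (y \<otimes>\<^bsub>G\<^esub> x) \<in> carrier_mat d d"
        using x y cl by auto
      have "M k l (y \<otimes>\<^bsub>G\<^esub> x) * \<rho> y
          = \<rho> (y \<otimes>\<^bsub>G\<^esub> x) * E k l * (\<rho> (inv\<^bsub>G\<^esub> (y \<otimes>\<^bsub>G\<^esub> x)) * \<rho> y)"
        unfolding M_def using c E by (intro assoc_mult_mat[of _ d d _ d _ d]) auto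
      also have "\<dots> = \<rho> y * \<rho> x * E k l * \<rho> (inv\<^bsub>G\<^esub> x)"
        by (simp only: inv matrix_representation_mult[OF G \<rho> y x])
      also have "\<dots> = \<rho> y * M k l x"
        unfolding M_def using c E by (simp add: assoc_mult_mat[of _ d d _ d _ d])
      finally show ?thesis by simp
    qed
    then have "\<rho> y * S k l = mat_sum d (\<lambda>x. M k l (y \<otimes>\<^bsub>G\<^esub> x) * \<rho> y) (carrier G)"
      unfolding S_def using M cl[OF y] by (subst mat_sum_mult_left) (auto simp: mat_sum_def intro!: cong_mat)
    also have "\<dots> = mat_sum d (\<lambda>x. M k l x * \<rho> y) (carrier G)"
      unfolding mat_sum_def
      by (intro cong_mat refl sum.reindex_bij_betw[OF bij_betw_mult_left[OF G y], of "\<lambda>x. (M k l x * \<rho> y) $$ _"])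
    also have "\<dots> = S k l * \<rho> y"
      unfolding S_def using M cl[OF y] by (intro mat_sum_mult_right[symmetric]) auto
    finally show ?thesis by simp
  qed
  \<comment> \<open>Off the diagonal an entry of a scalar matrix is zero; for \<open>k = l\<close>
    the trace \<open>n\<close> is shared by \<open>d\<close> equal entries.\<close>
  have SE: "S k l $$ (k, l) = (if k = l then n / of_nat d else 0)" if "k < d" "l < d" for k l
  proof -
    obtain c where c: "S k l = c \<cdot>\<^sub>m 1\<^sub>m d"
      using schur_lemma[OF assms(1) G, of "S k l"] comm by (auto simp: S_def)
    have "mat_trace (S k l) = (\<Sum>x\<in>carrier G. mat_trace (M k l x))"
      unfolding S_def by (intro mat_trace_mat_sum M)
    also have "\<dots> = (\<Sum>x\<in>carrier G. mat_trace (E k l))"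
    proof (rule sum.cong[OF refl])
      fix x assume x: "x \<in> carrier G"
      have "\<rho> (inv\<^bsub>G\<^esub> x) * \<rho> x = 1\<^sub>m d"
        using x \<rho> by (simp add: matrix_representation_iff[OF G] matrix_representation_mult[OF G \<rho>, symmetric])
      then show "mat_trace (M k l x) = mat_trace (E k l)"
        unfolding M_def using x cl E by (intro mat_trace_similar) auto
    qed
    also have "\<dots> = (if k = l then n else 0)"
      using that by (auto simp: n_def mat_trace_def E_def)
    finally have "mat_trace (S k l) = (if k = l then n else 0)" .
    moreover have "mat_trace (S k l) = of_nat d * c" unfolding c by (simp add: mat_trace_def)
    ultimately show ?thesis using c d that by (auto simp: field_simps)
  qed
  have "(\<Sum>x\<in>carrier G. mat_trace (\<rho> x) * mat_trace (\<rho> (inv\<^bsub>G\<^esub> x)))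
      = (\<Sum>x\<in>carrier G. \<Sum>k<d. \<Sum>l<d. M k l x $$ (k, l))"
  proof (rule sum.cong[OF refl])
    fix x assume x: "x \<in> carrier G"
    then show "mat_trace (\<rho> x) * mat_trace (\<rho> (inv\<^bsub>G\<^esub> x)) = (\<Sum>k<d. \<Sum>l<d. M k l x $$ (k, l))"
      using cl[OF x] cl[of "inv\<^bsub>G\<^esub> x"] by (simp add: mat_trace_def sum_product entry)
  qed
  also have "\<dots> = (\<Sum>k<d. \<Sum>l<d. S k l $$ (k, l))"
    by (simp add: S_def mat_sum_entry sum.swap[of _ "carrier G"])
  also have "\<dots> = (\<Sum>k<d. n / of_nat d)" by (simp add: SE)
  also have "\<dots> = n" using d by simp
  finally show ?thesis by (simp add: n_def)
qed

section \<open>Tensor products and permutation representations\<close>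

lemma sum_div_mod:
  fixes f :: "nat \<Rightarrow> nat \<Rightarrow> 'a :: comm_monoid_add"
  shows "(\<Sum>k<n * m. f (k div m) (k mod m)) = (\<Sum>a<n. \<Sum>b<m. f a b)"
proof (cases "m = 0")
  case False
  have "(\<Sum>k<n * m. f (k div m) (k mod m)) = (\<Sum>(a, b)\<in>{..<n} \<times> {..<m}. f a b)"
  proof (rule sum.reindex_bij_witness[where i = "\<lambda>(a, b). a * m + b" and j = "\<lambda>k. (k div m, k mod m)"])
    fix k assume "k \<in> {..<n * m}"
    then show "(k div m, k mod m) \<in> {..<n} \<times> {..<m}"
      using False by (simp add: less_mult_imp_div_less)
  next
    fix p assume "p \<in> {..<n} \<times> {..<m}"
    then obtain a b where p: "p = (a, b)" "a < n" "b < m" by auto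
    then have "a * m + b < Suc a * m" by simp
    also have "\<dots> \<le> n * m" using p by (intro mult_le_mono1) simp
    finally show "(case p of (a, b) \<Rightarrow> a * m + b) \<in> {..<n * m}" using p by simp
  qed auto
  then show ?thesis by (simp add: sum.cartesian_product)
qed simp

definition kronecker :: "complex mat \<Rightarrow> complex mat \<Rightarrow> complex mat" where
  "kronecker A B = mat (dim_row A * dim_row B) (dim_col A * dim_col B)
     (\<lambda>(i, j). A $$ (i div dim_row B, j div dim_col B) * B $$ (i mod dim_row B, j mod dim_col B))"

lemma kronecker_carrier: "A \<in> carrier_mat n n \<Longrightarrow> B \<in> carrier_mat m m \<Longrightarrow> kronecker A B \<in> carrier_mat (n * m) (n * m)"
  by (simp add: kronecker_def)

lemma kronecker_entry:
  assumes "A \<in> carrier_mat n n" "B \<in> carrier_mat m m" "i < n * m" "j < n * m"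
  shows "kronecker A B $$ (i, j) = A $$ (i div m, j div m) * B $$ (i mod m, j mod m)"
  using assms by (simp add: kronecker_def)

lemma kronecker_mult:
  assumes A: "A \<in> carrier_mat n n" and B: "B \<in> carrier_mat m m"
    and C: "C \<in> carrier_mat n n" and D: "D \<in> carrier_mat m m"
  shows "kronecker A B * kronecker C D = kronecker (A * C) (B * D)"
proof (rule eq_matI)
  have AC: "A * C \<in> carrier_mat n n" and BD: "B * D \<in> carrier_mat m m" using assms by auto
  fix i j assume "i < dim_row (kronecker (A * C) (B * D))" "j < dim_col (kronecker (A * C) (B * D))"
  then have ij: "i < n * m" "j < n * m" using kronecker_carrier[OF AC BD] by auto
  then have "m > 0" by (cases m) auto
  then have dm: "i div m < n" "j div m < n" "i mod m < m" "j mod m < m"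
    using ij by (auto simp: less_mult_imp_div_less)
  have "(kronecker A B * kronecker C D) $$ (i, j) = (\<Sum>k<n * m. kronecker A B $$ (i, k) * kronecker C D $$ (k, j))"
    by (rule mat_mult_entry[OF kronecker_carrier[OF A B] kronecker_carrier[OF C D] ij])
  also have "\<dots> = (\<Sum>k<n * m. (A $$ (i div m, k div m) * B $$ (i mod m, k mod m))
      * (C $$ (k div m, j div m) * D $$ (k mod m, j mod m)))"
    using ij by (intro sum.cong refl) (simp add: kronecker_entry[OF A B] kronecker_entry[OF C D])
  also have "\<dots> = (\<Sum>a<n. \<Sum>b<m. (A $$ (i div m, a) * B $$ (i mod m, b))
      * (C $$ (a, j div m) * D $$ (b, j mod m)))"
    by (rule sum_div_mod)
  also have "\<dots> = (\<Sum>a<n. A $$ (i div m, a) * C $$ (a, j div m))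
      * (\<Sum>b<m. B $$ (i mod m, b) * D $$ (b, j mod m))"
    by (simp add: sum_product mult.assoc mult.left_commute)
  also have "\<dots> = (A * C) $$ (i div m, j div m) * (B * D) $$ (i mod m, j mod m)"
    using dm by (simp only: mat_mult_entry[OF A C] mat_mult_entry[OF B D])
  also have "\<dots> = kronecker (A * C) (B * D) $$ (i, j)" using kronecker_entry[OF AC BD ij] by simp
  finally show "(kronecker A B * kronecker C D) $$ (i, j) = kronecker (A * C) (B * D) $$ (i, j)" .
qed (use assms in \<open>auto simp: kronecker_def\<close>)

lemma kronecker_one: "kronecker (1\<^sub>m n) (1\<^sub>m m) = 1\<^sub>m (n * m)"
proof (rule eq_matI)
  fix i j assume "i < dim_row (1\<^sub>m (n * m) :: complex mat)" "j < dim_col (1\<^sub>m (n * m) :: complex mat)"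
  then have ij: "i < n * m" "j < n * m" by auto
  then have m: "m > 0" by (cases m) auto
  have "i = j \<longleftrightarrow> i div m = j div m \<and> i mod m = j mod m" by (metis div_mult_mod_eq)
  then show "kronecker (1\<^sub>m n) (1\<^sub>m m) $$ (i, j) = 1\<^sub>m (n * m) $$ (i, j)"
    using ij m by (simp add: kronecker_def less_mult_imp_div_less)
qed (auto simp: kronecker_def)

lemma mat_trace_kronecker:
  assumes "A \<in> carrier_mat n n" "B \<in> carrier_mat m m"
  shows "mat_trace (kronecker A B) = mat_trace A * mat_trace B"
proof -
  have "mat_trace (kronecker A B) = (\<Sum>k<n * m. A $$ (k div m, k div m) * B $$ (k mod m, k mod m))"
    using assms kronecker_carrier[OF assms] by (simp add: mat_trace_def kronecker_entry[OF assms])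
  also have "\<dots> = (\<Sum>a<n. \<Sum>b<m. A $$ (a, a) * B $$ (b, b))" by (rule sum_div_mod)
  also have "\<dots> = mat_trace A * mat_trace B"
    using assms by (simp add: mat_trace_def sum_product)
  finally show ?thesis .
qed

lemma matrix_representation_kronecker:
  assumes "group G" "matrix_representation G d \<rho>" "matrix_representation G e \<sigma>"
  shows "matrix_representation G (d * e) (\<lambda>x. kronecker (\<rho> x) (\<sigma> x))"
proof -
  interpret group G by fact
  show ?thesis
    using assms unfolding matrix_representation_iff[OF assms(1)]
    by (auto simp: kronecker_carrier kronecker_mult[of _ d _ e] kronecker_one)
qed

lemma permutation_representation:
  assumes G: "group G" and X: "finite X"
    and closed: "\<And>x f. x \<in> carrier G \<Longrightarrow> f \<in> X \<Longrightarrow> act x f \<in> X"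
    and mult: "\<And>x y f. x \<in> carrier G \<Longrightarrow> y \<in> carrier G \<Longrightarrow> f \<in> X \<Longrightarrow> act (x \<otimes>\<^bsub>G\<^esub> y) f = act x (act y f)"
    and one: "\<And>f. f \<in> X \<Longrightarrow> act \<one>\<^bsub>G\<^esub> f = f"
  obtains \<pi> where "matrix_representation G (card X) \<pi>"
    and "\<And>x. x \<in> carrier G \<Longrightarrow> mat_trace (\<pi> x) = of_nat (card {f \<in> X. act x f = f})"
proof -
  interpret group G by fact
  let ?c = "card X"
  obtain e where e: "bij_betw e {..<?c} X"
    using ex_bij_betw_nat_finite[OF X] by (auto simp: lessThan_atLeast0)
  have eX: "e i \<in> X" if "i < ?c" for i using bij_betwE[OF e] that by auto
  have einj: "e i = e j \<longleftrightarrow> i = j" if "i < ?c" "j < ?c" for i j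
    using bij_betw_imp_inj_on[OF e] that by (auto simp: inj_on_def)
  define \<pi> where "\<pi> x = mat ?c ?c (\<lambda>(i, j). if e i = act x (e j) then 1 else (0 :: complex))" for x
  have cl: "\<pi> x \<in> carrier_mat ?c ?c" for x by (simp add: \<pi>_def)
  have "\<pi> (x \<otimes>\<^bsub>G\<^esub> y) = \<pi> x * \<pi> y" if x: "x \<in> carrier G" and y: "y \<in> carrier G" for x y
  proof (rule eq_matI)
    fix i j assume "i < dim_row (\<pi> x * \<pi> y)" "j < dim_col (\<pi> x * \<pi> y)"
    then have ij: "i < ?c" "j < ?c" by (simp_all add: \<pi>_def)
    then have "act y (e j) \<in> X" using closed y eX by blast
    then obtain k where k: "k < ?c" "act y (e j) = e k" using bij_betw_imp_surj_on[OF e] by auto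
    have "(\<pi> x * \<pi> y) $$ (i, j) = (\<Sum>l<?c. \<pi> x $$ (i, l) * \<pi> y $$ (l, j))"
      by (rule mat_mult_entry[OF cl cl ij])
    also have "\<dots> = (\<Sum>l<?c. if l = k then \<pi> x $$ (i, k) else 0)"
      using ij k by (intro sum.cong refl) (auto simp: \<pi>_def einj)
    also have "\<dots> = \<pi> x $$ (i, k)" using k by simp
    also have "\<dots> = \<pi> (x \<otimes>\<^bsub>G\<^esub> y) $$ (i, j)" using ij k mult[OF x y eX] by (simp add: \<pi>_def)
    finally show "\<pi> (x \<otimes>\<^bsub>G\<^esub> y) $$ (i, j) = (\<pi> x * \<pi> y) $$ (i, j)" by simp
  qed (auto simp: \<pi>_def)
  moreover have "\<pi> \<one>\<^bsub>G\<^esub> = 1\<^sub>m ?c"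
    by (rule eq_matI) (auto simp: \<pi>_def one eX einj)
  ultimately have "matrix_representation G ?c \<pi>"
    using cl by (simp add: matrix_representation_iff[OF G])
  moreover have "mat_trace (\<pi> x) = of_nat (card {f \<in> X. act x f = f})" if "x \<in> carrier G" for x
  proof -
    have "mat_trace (\<pi> x) = (\<Sum>i<?c. if e i = act x (e i) then 1 else 0)"
      by (simp add: mat_trace_def \<pi>_def)
    also have "\<dots> = (\<Sum>f\<in>X. if f = act x f then 1 else 0)"
      by (rule sum.reindex_bij_betw[OF e])
    also have "\<dots> = of_nat (card {f \<in> X. f = act x f})"
      using X by (simp add: sum.If_cases Int_def)
    finally show ?thesis by (simp add: eq_commute)
  qed
  ultimately show ?thesis by (rule that)
qed

text \<open>The number \<open>r\<close> is the multiplicity of the trivial representation in the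
  tensor product. For a permutation representation \<open>\<pi>\<close> it is the inner product of
  the two characters.\<close>

lemma sum_character_mult:
  assumes G: "group G" "finite (carrier G)" and \<rho>: "matrix_representation G d \<rho>"
    and \<pi>: "matrix_representation G e \<pi>"
  shows "\<exists>r::nat. (\<Sum>x\<in>carrier G. mat_trace (\<rho> x) * mat_trace (\<pi> x)) = of_nat (card (carrier G)) * of_nat r"
proof -
  have "(\<Sum>x\<in>carrier G. mat_trace (\<rho> x) * mat_trace (\<pi> x)) = (\<Sum>x\<in>carrier G. mat_trace (kronecker (\<rho> x) (\<pi> x)))"
    using matrix_representation_closed[OF G(1)] \<rho> \<pi>
    by (intro sum.cong refl mat_trace_kronecker[symmetric]) auto
  then show ?thesis
    using sum_character_eq[OF G matrix_representation_kronecker[OF G(1) \<rho> \<pi>]] by simp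
qed

text \<open>A maximal independent subset \<open>B\<close> of \<open>W\<close> is extended to a
  maximal independent set \<open>C\<close> of the full space. The columns of \<open>P\<close> list
  \<open>B\<close> before the rest, so \<open>r\<close> is the dimension of \<open>W\<close>, and
  \<open>Q\<close> reads off coordinates.\<close>

lemma subspace_adapted_basis:
  assumes sub: "VectorSpace.subspace class_ring W (module_vec TYPE(complex) d)"
    and nt: "W \<noteq> {0\<^sub>v d}" "W \<noteq> carrier_vec d"
  obtains P Q r where "P \<in> carrier_mat d d" "Q \<in> carrier_mat d d" "P * Q = 1\<^sub>m d" "Q * P = 1\<^sub>m d"
    and "0 < r" "r < d" and "\<And>j. j < r \<Longrightarrow> col P j \<in> W"
    and "\<And>w i. w \<in> W \<Longrightarrow> r \<le> i \<Longrightarrow> i < d \<Longrightarrow> (Q *\<^sub>v w) $ i = 0"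
proof -
  interpret V: vec_space "TYPE(complex)" d .
  have subm: "submodule class_ring W V.V" using sub by (simp add: subspace_def)
  have WV: "W \<subseteq> carrier_vec d" using submodule.subset[OF subm] by simp
  have W0: "0\<^sub>v d \<in> W" using submodule.zero_closed[OF subm] by (simp add: module_vec_simps)
  define PW where "PW S \<longleftrightarrow> S \<subseteq> W \<and> V.lin_indpt S" for S
  define PV where "PV B S \<longleftrightarrow> S \<subseteq> carrier_vec d \<and> V.lin_indpt S \<and> B \<subseteq> S" for B S
  have bound: "finite S \<and> card S \<le> d" if "S \<subseteq> carrier_vec d" "V.lin_indpt S" for S
    using V.li_le_dim[OF V.fin_dim, of S] that by (simp add: V.dim_is_n)
  have "V.lin_indpt {}" using V.finite_lin_indpt2[of "{}"] by auto
  then have "PW {}" by (simp add: PW_def)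
  moreover have "finite S \<and> card S \<le> d" if "PW S" for S
    using that bound WV unfolding PW_def by blast
  ultimately obtain B where B: "finite B" "maximal B PW" using maximal_exists[of PW d "{}"] by blast
  have BW: "B \<subseteq> W" "V.lin_indpt B" using B(2) by (auto simp: maximal_def PW_def)
  have spanB: "W \<subseteq> V.span B"
  proof
    fix w assume w: "w \<in> W"
    show "w \<in> V.span B"
    proof (cases "w \<in> B")
      case True then show ?thesis using V.in_own_span[of B] BW WV by auto
    next
      case False
      have "\<not> PW (B \<union> {w})" using B(2) False unfolding maximal_def by blast
      then have "V.lin_dep (B \<union> {w})" using BW w by (auto simp: PW_def)
      then show ?thesis using V.lin_dep_iff_in_span[of B w] BW WV w False by auto
    qed
  qed
  have "PV B B" using BW WV by (auto simp: PV_def)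
  moreover have "finite S \<and> card S \<le> d" if "PV B S" for S
    using that bound unfolding PV_def by blast
  ultimately obtain C where C: "finite C" "maximal C (PV B)" using maximal_exists[of "PV B" d B] by blast
  have CV: "C \<subseteq> carrier_vec d" "V.lin_indpt C" "B \<subseteq> C" using C(2) by (auto simp: maximal_def PV_def)
  have "maximal C (\<lambda>S. S \<subseteq> carrier_vec d \<and> V.lin_indpt S)"
    using C(2) CV unfolding maximal_def PV_def by (auto simp: module_vec_simps)
  then have "V.basis C" by (rule V.max_li_is_basis)
  then have cardC: "card C = d" using V.dim_basis[OF C(1)] by (simp add: V.dim_is_n)
  obtain xs where xs: "set xs = B" "distinct xs" using finite_distinct_list[OF B(1)] by blast
  obtain ys where ys: "set ys = C - B" "distinct ys" using finite_distinct_list[of "C - B"] C(1) by blast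
  define zs where "zs = xs @ ys"
  define P where "P = mat_of_cols d zs"
  define r where "r = length xs"
  have zs: "set zs = C" "distinct zs" using xs ys CV(3) by (auto simp: zs_def)
  then have lz: "length zs = d" using cardC distinct_card[of zs] by simp
  have P: "P \<in> carrier_mat d d"
    using mat_of_cols_carrier(1)[of d zs] unfolding P_def lz .
  have colsP: "cols P = zs" unfolding P_def using zs CV by (intro cols_mat_of_cols) auto
  have "V.rank P = d" using P colsP zs CV(2) by (intro V.lin_indpt_full_rank) auto
  then have "det P \<noteq> 0" using V.det_rank_iff[OF P] by simp
  then obtain Q where Q: "Q \<in> carrier_mat d d" "Q * P = 1\<^sub>m d" "P * Q = 1\<^sub>m d"
    using det_non_zero_imp_unit[OF P, of "()"] by (auto simp: Units_def ring_mat_def)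
  have colP: "col P j = zs ! j" if "j < d" for j
    using colsP lz P that by (metis carrier_matD(2) cols_nth)
  have rd: "r \<le> d" using lz by (simp add: r_def zs_def)
  have colW: "col P j \<in> W" if "j < r" for j
    using colP[of j] rd that BW xs by (auto simp: zs_def r_def nth_append)
  \<comment> \<open>\<open>K\<close> consists of the vectors whose coordinates from \<open>r\<close>
    on vanish; it contains \<open>B\<close>, hence the span of \<open>B\<close>, hence
    \<open>W\<close>.\<close>
  define K where "K = {v \<in> carrier_vec d. \<forall>i. r \<le> i \<and> i < d \<longrightarrow> (Q *\<^sub>v v) $ i = 0}"
  have "VectorSpace.subspace class_ring K (module_vec TYPE(complex) d)"
    using Q(1) by (intro subspace_module_vecI) (auto simp: K_def scalar_prod_add_distrib[of _ d])
  then have K: "submodule class_ring K V.V" by (simp add: subspace_def)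
  have "B \<subseteq> K"
  proof
    fix b assume "b \<in> B"
    then obtain j where j: "j < r" "b = xs ! j" using xs by (auto simp: in_set_conv_nth r_def)
    then have b: "b = col P j" using colP[of j] rd by (simp add: zs_def r_def nth_append)
    have jd: "j < d" using j rd by simp
    have "Q *\<^sub>v b = col (Q * P) j" unfolding b by (rule col_mult2[OF Q(1) P jd, symmetric])
    then have "Q *\<^sub>v b = unit_vec d j" using Q(2) jd by simp
    moreover have "b \<in> carrier_vec d" using b P jd by auto
    ultimately show "b \<in> K" using j jd by (auto simp: K_def)
  qed
  then have "V.span B \<subseteq> K" by (rule V.span_is_subset[OF _ K])
  then have WK: "W \<subseteq> K" using spanB by blast
  have "r > 0"
  proof (rule ccontr)
    assume "\<not> r > 0"
    then have "W \<subseteq> {0\<^sub>v d}"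
    proof (intro subsetI)
      fix w assume w: "w \<in> W"
      then have wc: "w \<in> carrier_vec d" using WV by blast
      have "Q *\<^sub>v w = 0\<^sub>v d" using w WK \<open>\<not> r > 0\<close> Q(1) by (intro eq_vecI) (auto simp: K_def)
      then have "P *\<^sub>v (Q *\<^sub>v w) = 0\<^sub>v d" using P by (simp add: mult_mat_vec_def scalar_prod_def) auto
      moreover have "P *\<^sub>v (Q *\<^sub>v w) = w"
        using P Q wc by (simp flip: assoc_mult_mat_vec)
      ultimately show "w \<in> {0\<^sub>v d}" by simp
    qed
    then show False using W0 nt(1) by blast
  qed
  moreover have "r < d"
  proof (rule ccontr)
    assume "\<not> r < d"
    then have "r = d" using rd by simp
    then have "B = C" using xs CV(3) C(1) cardC distinct_card[of xs]
      by (metis card_subset_eq r_def)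
    then have "carrier_vec d = V.span B" using \<open>V.basis C\<close> by (simp add: V.basis_def module_vec_simps)
    moreover have "V.span B \<subseteq> W" using BW(1) by (rule V.span_is_subset[OF _ subm])
    ultimately show False using WV nt(2) by blast
  qed
  ultimately show ?thesis
    using that[OF P Q(1,3,2)] colW WK by (auto simp: K_def)
qed

text \<open>In a basis adapted to \<open>W\<close> all matrices are block upper triangular. The
  diagonal blocks represent \<open>G\<close> on \<open>W\<close> and on the quotient, and the trace
  is the sum of theirs.\<close>

lemma reducible_representation_splits:
  assumes G: "group G" and \<rho>: "matrix_representation G d \<rho>"
    and inv: "invariant_subspace G d \<rho> W" "W \<noteq> {0\<^sub>v d}" "W \<noteq> carrier_vec d"
  obtains r \<rho>1 \<rho>2 where "r < d" "0 < r"
    and "matrix_representation G r \<rho>1" "matrix_representation G (d - r) \<rho>2"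
    and "\<forall>x\<in>carrier G. mat_trace (\<rho> x) = mat_trace (\<rho>1 x) + mat_trace (\<rho>2 x)"
proof -
  interpret group G by fact
  note cl = matrix_representation_closed[OF G \<rho>]
  obtain P Q r where P: "P \<in> carrier_mat d d" and Q: "Q \<in> carrier_mat d d"
    and PQ: "P * Q = 1\<^sub>m d" "Q * P = 1\<^sub>m d" and r: "0 < r" "r < d"
    and colW: "\<And>j. j < r \<Longrightarrow> col P j \<in> W"
    and van: "\<And>w i. w \<in> W \<Longrightarrow> r \<le> i \<Longrightarrow> i < d \<Longrightarrow> (Q *\<^sub>v w) $ i = 0"
    using subspace_adapted_basis[of W d] inv by (auto simp: invariant_subspace_def)
  define \<sigma> where "\<sigma> x = Q * \<rho> x * P" for x
  have \<sigma>: "\<sigma> x \<in> carrier_mat d d" if "x \<in> carrier G" for x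
    using P Q cl[OF that] by (simp add: \<sigma>_def)
  have \<sigma>_mult: "\<sigma> (x \<otimes>\<^bsub>G\<^esub> y) = \<sigma> x * \<sigma> y" if "x \<in> carrier G" "y \<in> carrier G" for x y
  proof -
    note c = P Q cl[OF that(1)] cl[OF that(2)] mult_carrier_mat[of _ d d _ d]
    have "\<sigma> x * \<sigma> y = (Q * \<rho> x) * (P * (Q * (\<rho> y * P)))"
      unfolding \<sigma>_def using c by (simp add: assoc_mult_mat[of _ d d _ d _ d])
    also have "P * (Q * (\<rho> y * P)) = (P * Q) * (\<rho> y * P)"
      using c by (intro assoc_mult_mat[symmetric, of _ d d _ d _ d]) auto
    also have "\<dots> = \<rho> y * P" unfolding PQ using c by simp
    also have "(Q * \<rho> x) * (\<rho> y * P) = \<sigma> (x \<otimes>\<^bsub>G\<^esub> y)"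
      unfolding \<sigma>_def matrix_representation_mult[OF G \<rho> that]
      using c by (simp add: assoc_mult_mat[of _ d d _ d _ d])
    finally show ?thesis by simp
  qed
  have "\<rho> \<one>\<^bsub>G\<^esub> = 1\<^sub>m d" using \<rho> by (simp add: matrix_representation_iff[OF G])
  then have \<sigma>_one: "\<sigma> \<one>\<^bsub>G\<^esub> = 1\<^sub>m d" unfolding \<sigma>_def using P Q PQ by simp
  have lower: "\<sigma> x $$ (i, j) = 0" if x: "x \<in> carrier G" and ij: "r \<le> i" "i < d" "j < r" for x i j
  proof -
    have jd: "j < d" using ij r by simp
    have "\<rho> x *\<^sub>v col P j \<in> W" using inv(1) colW[OF ij(3)] x by (simp add: invariant_subspace_def)
    then have vanish: "(Q *\<^sub>v (\<rho> x *\<^sub>v col P j)) $ i = 0" using van ij by blast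
    have "\<sigma> x = Q * (\<rho> x * P)"
      unfolding \<sigma>_def using P Q cl[OF x] by (simp add: assoc_mult_mat[of _ d d _ d _ d])
    then have "col (\<sigma> x) j = Q *\<^sub>v (\<rho> x *\<^sub>v col P j)"
      using col_mult2[OF Q mult_carrier_mat[OF cl[OF x] P] jd] col_mult2[OF cl[OF x] P jd] by (simp only:)
    moreover have "\<sigma> x $$ (i, j) = col (\<sigma> x) j $ i" using \<sigma>[OF x] ij jd by simp
    ultimately have "\<sigma> x $$ (i, j) = (Q *\<^sub>v (\<rho> x *\<^sub>v col P j)) $ i" by (simp only:)
    then show ?thesis by (simp only: vanish)
  qed
  define \<rho>1 where "\<rho>1 x = mat r r (\<lambda>(i, j). \<sigma> x $$ (i, j))" for x
  define \<rho>2 where "\<rho>2 x = mat (d - r) (d - r) (\<lambda>(i, j). \<sigma> x $$ (i + r, j + r))" for x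
  have c1: "\<rho>1 x \<in> carrier_mat r r" and c2: "\<rho>2 x \<in> carrier_mat (d - r) (d - r)" for x
    by (simp_all add: \<rho>1_def \<rho>2_def)
  have split: "(\<Sum>k<d. f k) = (\<Sum>k<r. f k) + (\<Sum>k<d - r. f (k + r))" for f :: "nat \<Rightarrow> complex"
  proof -
    have "(\<Sum>k<d. f k) = (\<Sum>k<r. f k) + (\<Sum>k=r..<d. f k)"
      using r by (simp add: lessThan_atLeast0 sum.atLeastLessThan_concat)
    also have "(\<Sum>k=r..<d. f k) = (\<Sum>k<d - r. f (k + r))"
      using r sum.shift_bounds_nat_ivl[of f 0 r "d - r"] by (simp add: lessThan_atLeast0)
    finally show ?thesis .
  qed
  have "\<rho>1 (x \<otimes>\<^bsub>G\<^esub> y) = \<rho>1 x * \<rho>1 y" if x: "x \<in> carrier G" and y: "y \<in> carrier G" for x y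
  proof (rule eq_matI)
    fix i j assume "i < dim_row (\<rho>1 x * \<rho>1 y)" "j < dim_col (\<rho>1 x * \<rho>1 y)"
    then have ij: "i < r" "j < r" by (auto simp: \<rho>1_def)
    have "\<rho>1 (x \<otimes>\<^bsub>G\<^esub> y) $$ (i, j) = (\<Sum>k<d. \<sigma> x $$ (i, k) * \<sigma> y $$ (k, j))"
      using ij r mat_mult_entry[OF \<sigma>[OF x] \<sigma>[OF y], of i j] by (simp add: \<rho>1_def \<sigma>_mult[OF x y])
    also have "\<dots> = (\<Sum>k<r. \<sigma> x $$ (i, k) * \<sigma> y $$ (k, j))"
      unfolding split using ij lower[OF y] by simp
    also have "\<dots> = (\<Sum>k<r. \<rho>1 x $$ (i, k) * \<rho>1 y $$ (k, j))" using ij by (simp add: \<rho>1_def)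
    also have "\<dots> = (\<rho>1 x * \<rho>1 y) $$ (i, j)" by (rule mat_mult_entry[OF c1 c1 ij, symmetric])
    finally show "\<rho>1 (x \<otimes>\<^bsub>G\<^esub> y) $$ (i, j) = (\<rho>1 x * \<rho>1 y) $$ (i, j)" .
  qed (auto simp: \<rho>1_def)
  moreover have "\<rho>1 \<one>\<^bsub>G\<^esub> = 1\<^sub>m r" using r by (intro eq_matI) (auto simp: \<rho>1_def \<sigma>_one)
  ultimately have R1: "matrix_representation G r \<rho>1" using c1 by (simp add: matrix_representation_iff[OF G])
  have "\<rho>2 (x \<otimes>\<^bsub>G\<^esub> y) = \<rho>2 x * \<rho>2 y" if x: "x \<in> carrier G" and y: "y \<in> carrier G" for x y
  proof (rule eq_matI)
    fix i j assume "i < dim_row (\<rho>2 x * \<rho>2 y)" "j < dim_col (\<rho>2 x * \<rho>2 y)"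
    then have ij: "i < d - r" "j < d - r" by (auto simp: \<rho>2_def)
    have "\<rho>2 (x \<otimes>\<^bsub>G\<^esub> y) $$ (i, j) = (\<Sum>k<d. \<sigma> x $$ (i + r, k) * \<sigma> y $$ (k, j + r))"
      using ij r mat_mult_entry[OF \<sigma>[OF x] \<sigma>[OF y], of "i + r" "j + r"] by (simp add: \<rho>2_def \<sigma>_mult[OF x y])
    also have "\<dots> = (\<Sum>k<d - r. \<sigma> x $$ (i + r, k + r) * \<sigma> y $$ (k + r, j + r))"
      unfolding split using ij lower[OF x] by simp
    also have "\<dots> = (\<Sum>k<d - r. \<rho>2 x $$ (i, k) * \<rho>2 y $$ (k, j))" using ij by (simp add: \<rho>2_def)
    also have "\<dots> = (\<rho>2 x * \<rho>2 y) $$ (i, j)" by (rule mat_mult_entry[OF c2 c2 ij, symmetric])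
    finally show "\<rho>2 (x \<otimes>\<^bsub>G\<^esub> y) $$ (i, j) = (\<rho>2 x * \<rho>2 y) $$ (i, j)" .
  qed (auto simp: \<rho>2_def)
  moreover have "\<rho>2 \<one>\<^bsub>G\<^esub> = 1\<^sub>m (d - r)" using r by (intro eq_matI) (auto simp: \<rho>2_def \<sigma>_one)
  ultimately have R2: "matrix_representation G (d - r) \<rho>2" using c2 by (simp add: matrix_representation_iff[OF G])
  have "mat_trace (\<rho> x) = mat_trace (\<rho>1 x) + mat_trace (\<rho>2 x)" if x: "x \<in> carrier G" for x
  proof -
    have "mat_trace (\<rho> x) = mat_trace (\<sigma> x)"
      unfolding \<sigma>_def by (rule mat_trace_similar[OF Q P cl[OF x] PQ(1), symmetric])
    then show ?thesis using \<sigma>[OF x] by (simp add: mat_trace_def split \<rho>1_def \<rho>2_def)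
  qed
  with r R1 R2 show ?thesis by (intro that[of r \<rho>1 \<rho>2]) auto
qed

section \<open>Characters of the symmetric group\<close>

abbreviation beta_sets :: "nat \<Rightarrow> (nat \<Rightarrow> nat) set" where
  "beta_sets n \<equiv> bead_configs n (\<Sum>{..<n} + n)"

abbreviation sym_beta :: "nat \<Rightarrow> (nat \<Rightarrow> nat) \<Rightarrow> (nat \<Rightarrow> nat) \<Rightarrow> int" where
  "sym_beta n g \<beta> \<equiv> beta_char n (cyc_type g {1..n}) \<beta>"

definition class_function :: "nat \<Rightarrow> ((nat \<Rightarrow> nat) \<Rightarrow> complex) \<Rightarrow> bool" where
  "class_function n f \<longleftrightarrow>
     (\<forall>x y. x permutes {1..n} \<longrightarrow> y permutes {1..n} \<longrightarrow> f (inv' y \<circ> x \<circ> y) = f x)"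

text \<open>The inner product of \<open>f\<close> with an integer-valued function. Being indexed by
  ordered beads, it repeats each partition \<open>n!\<close> times up to sign.\<close>

definition beta_coeff :: "nat \<Rightarrow> ((nat \<Rightarrow> nat) \<Rightarrow> complex) \<Rightarrow> (nat \<Rightarrow> nat) \<Rightarrow> complex" where
  "beta_coeff n f \<beta> = (\<Sum>x | x permutes {1..n}. f x * of_int (sym_beta n x \<beta>)) / fact n"

section \<open>Orthogonality and inversion for class functions\<close>

lemma permutation_sym: "x permutes {1..n} \<Longrightarrow> permutation (x :: nat \<Rightarrow> nat)"
  by (auto simp: permutation_permutes)

lemma permutes_image_subset: "x permutes S \<Longrightarrow> x ` S \<subseteq> S"
  by (simp add: permutes_image)

text \<open>Extending an intertwiner by the identity outside \<open>S\<close> turns it into a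
  permutation.\<close>

lemma card_intertwiners_permutes:
  assumes x: "x permutes S" and g: "g permutes S"
  shows "card (intertwiners x S g S) = card {y. y permutes S \<and> y \<circ> x = g \<circ> y}"
proof (rule bij_betw_same_card[symmetric])
  show "bij_betw (\<lambda>y. restrict y S) {y. y permutes S \<and> y \<circ> x = g \<circ> y} (intertwiners x S g S)"
    unfolding bij_betw_def
  proof (intro conjI inj_onI subset_antisym subsetI)
    fix y y' assume y: "y \<in> {y. y permutes S \<and> y \<circ> x = g \<circ> y}" "y' \<in> {y. y permutes S \<and> y \<circ> x = g \<circ> y}"
      and e: "restrict y S = restrict y' S"
    show "y = y'"
    proof
      fix a show "y a = y' a"
        using y fun_cong[OF e, of a] by (cases "a \<in> S") (auto simp: permutes_not_in)
    qed
  next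
    fix z assume "z \<in> (\<lambda>y. restrict y S) ` {y. y permutes S \<and> y \<circ> x = g \<circ> y}"
    then obtain y where y: "z = restrict y S" "y permutes S" "y \<circ> x = g \<circ> y" by auto
    have "bij_betw z S S"
      unfolding y(1) using bij_betw_cong[of S "restrict y S" y S] permutes_imp_bij[OF y(2)] by simp
    moreover have "z (x a) = g (z a)" if "a \<in> S" for a
      using fun_cong[OF y(3), of a] that permutes_in_image[OF x, of a] by (simp add: y(1))
    moreover have "z \<in> S \<rightarrow>\<^sub>E S" using permutes_in_image[OF y(2)] by (auto simp: y(1))
    ultimately show "z \<in> intertwiners x S g S" by (simp add: intertwiners_def)
  next
    fix z assume z: "z \<in> intertwiners x S g S"
    define y where "y a = (if a \<in> S then z a else a)" for a
    have "bij_betw y S S"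
      using z bij_betw_cong[of S y z S] by (simp add: intertwiners_def y_def)
    then have "y permutes S" by (rule bij_imp_permutes) (simp add: y_def)
    moreover have "y \<circ> x = g \<circ> y"
    proof
      fix a show "(y \<circ> x) a = (g \<circ> y) a"
        using z permutes_in_image[OF x, of a] permutes_not_in[OF x, of a] permutes_not_in[OF g, of a]
        by (cases "a \<in> S") (auto simp: y_def intertwiners_def)
    qed
    moreover have "z = restrict y S"
      using z by (auto simp: y_def intertwiners_def fun_eq_iff PiE_def extensional_def)
    ultimately show "z \<in> (\<lambda>y. restrict y S) ` {y. y permutes S \<and> y \<circ> x = g \<circ> y}" by blast
  qed
qed

text \<open>Column orthogonality: the count is the order of the centraliser of \<open>g\<close> if
  \<open>x\<close> and \<open>g\<close> are conjugate, and zero otherwise.\<close>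

lemma sym_beta_gram:
  assumes "x permutes {1..n}" "g permutes {1..n}"
  shows "(\<Sum>\<beta>\<in>beta_sets n. sym_beta n x \<beta> * sym_beta n g \<beta>)
       = fact n * int (card {y. y permutes {1..n} \<and> y \<circ> x = g \<circ> y})"
  unfolding card_intertwiners_permutes[OF assms, symmetric]
  using gram_intertwiners[OF permutation_sym[OF assms(1)] permutation_sym[OF assms(2)], of "{1..n}" "{1..n}" n]
    permutes_image_subset[OF assms(1)] permutes_image_subset[OF assms(2)]
  by simp

text \<open>Exchanging the sums leaves, for each of the \<open>n!\<close> choices of
  \<open>y\<close>, the single \<open>x\<close> conjugate to \<open>g\<close> by \<open>y\<close>,
  where \<open>f\<close> takes the value \<open>f g\<close>.\<close>

lemma beta_coeff_inversion:
  assumes f: "class_function n f" and g: "g permutes {1..n}"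
  shows "(\<Sum>\<beta>\<in>beta_sets n. beta_coeff n f \<beta> * of_int (sym_beta n g \<beta>)) = fact n * f g"
proof -
  define G where "G = {x :: nat \<Rightarrow> nat. x permutes {1..n}}"
  have G: "finite G" "card G = fact n"
    using finite_permutations[of "{1..n}"] card_permutations[of "{1..n}" n] by (auto simp: G_def)
  have "(\<Sum>\<beta>\<in>beta_sets n. beta_coeff n f \<beta> * of_int (sym_beta n g \<beta>))
      = (\<Sum>\<beta>\<in>beta_sets n. \<Sum>x\<in>G. f x * of_int (sym_beta n x \<beta> * sym_beta n g \<beta>) / fact n)"
    unfolding beta_coeff_def G_def[symmetric]
    by (intro sum.cong refl) (simp add: sum_divide_distrib sum_distrib_right mult.assoc)
  also have "\<dots> = (\<Sum>x\<in>G. f x * of_int (\<Sum>\<beta>\<in>beta_sets n. sym_beta n x \<beta> * sym_beta n g \<beta>) / fact n)"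
    by (subst sum.swap) (simp add: sum_divide_distrib sum_distrib_left)
  also have "\<dots> = (\<Sum>x\<in>G. f x * of_nat (card {y \<in> G. y \<circ> x = g \<circ> y}))"
  proof (rule sum.cong[OF refl])
    fix x assume "x \<in> G"
    then have "(\<Sum>\<beta>\<in>beta_sets n. sym_beta n x \<beta> * sym_beta n g \<beta>) = fact n * int (card {y \<in> G. y \<circ> x = g \<circ> y})"
      using sym_beta_gram[OF _ g, of x] unfolding G_def by simp
    then show "f x * of_int (\<Sum>\<beta>\<in>beta_sets n. sym_beta n x \<beta> * sym_beta n g \<beta>) / fact n
        = f x * of_nat (card {y \<in> G. y \<circ> x = g \<circ> y})"
      by (simp only:) simp
  qed
  also have "\<dots> = (\<Sum>x\<in>G. \<Sum>y\<in>G. if y \<circ> x = g \<circ> y then f x else 0)"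
    using G(1) by (intro sum.cong refl) (simp add: sum.If_cases Int_def mult.commute)
  also have "\<dots> = (\<Sum>y\<in>G. \<Sum>x\<in>G. if y \<circ> x = g \<circ> y then f x else 0)" by (rule sum.swap)
  also have "\<dots> = (\<Sum>y\<in>G. f g)"
  proof (rule sum.cong[OF refl])
    fix y assume "y \<in> G"
    then have y: "y permutes {1..n}" by (simp add: G_def)
    define z where "z = inv' y \<circ> g \<circ> y"
    have z: "z \<in> G"
      unfolding z_def G_def using y g by (auto intro: permutes_compose permutes_inv)
    have "y \<circ> x = g \<circ> y \<longleftrightarrow> x = z" for x
    proof
      assume "y \<circ> x = g \<circ> y"
      then have "inv' y \<circ> (y \<circ> x) = inv' y \<circ> (g \<circ> y)" by simp
      then show "x = z" by (simp add: z_def comp_assoc[symmetric] permutes_inv_o(2)[OF y])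
    next
      assume "x = z"
      then show "y \<circ> x = g \<circ> y"
        by (simp add: z_def comp_assoc[symmetric] permutes_inv_o(1)[OF y])
    qed
    then have "(\<Sum>x\<in>G. if y \<circ> x = g \<circ> y then f x else 0) = f z" using z G(1) by simp
    also have "f z = f g" using f y g by (simp add: class_function_def z_def)
    finally show "(\<Sum>x\<in>G. if y \<circ> x = g \<circ> y then f x else 0) = f g" .
  qed
  also have "\<dots> = fact n * f g" using G(2) by simp
  finally show ?thesis .
qed

text \<open>The factor \<open>1 / n!\<close> of the usual norm is absent because each partition is
  counted in all \<open>n!\<close> orders of its beads.\<close>

lemma beta_coeff_parseval:
  assumes "class_function n f"
  shows "(\<Sum>\<beta>\<in>beta_sets n. beta_coeff n f \<beta> * beta_coeff n f \<beta>) = (\<Sum>x | x permutes {1..n}. f x * f x)"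
proof -
  have "(\<Sum>\<beta>\<in>beta_sets n. beta_coeff n f \<beta> * beta_coeff n f \<beta>)
      = (\<Sum>x | x permutes {1..n}. f x * (\<Sum>\<beta>\<in>beta_sets n. beta_coeff n f \<beta> * of_int (sym_beta n x \<beta>))) / fact n"
    unfolding sum_distrib_left
    by (subst sum.swap, subst (2) beta_coeff_def)
       (simp add: sum_distrib_left sum_divide_distrib mult_ac)
  also have "\<dots> = (\<Sum>x | x permutes {1..n}. f x * f x)"
    using beta_coeff_inversion[OF assms] by (simp add: sum_divide_distrib)
  finally show ?thesis .
qed

lemma sym_beta_inv: "x permutes {1..n} \<Longrightarrow> sym_beta n (inv' x) \<beta> = sym_beta n x \<beta>"
  by (simp add: cyc_type_def orbit_inv_eq[OF permutation_sym])

text \<open>A permutation and its inverse have the same cycle type, so the Gram identity counts as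
  many \<open>y\<close> carrying \<open>x\<close> to its inverse as \<open>y\<close> commuting with
  \<open>x\<close>, and \<open>id\<close> is among the latter.\<close>

lemma ex_conjugate_inverse:
  fixes x :: "nat \<Rightarrow> nat"
  assumes x: "x permutes {1..n}"
  obtains y where "y permutes {1..n}" "inv' y \<circ> inv' x \<circ> y = x"
proof -
  have "fact n * int (card {y. y permutes {1..n} \<and> y \<circ> x = inv' x \<circ> y})
      = fact n * int (card {y. y permutes {1..n} \<and> y \<circ> x = x \<circ> y})"
    using sym_beta_gram[OF x permutes_inv[OF x]] sym_beta_gram[OF x x] sym_beta_inv[OF x] by simp
  then have "card {y. y permutes {1..n} \<and> y \<circ> x = inv' x \<circ> y} = card {y. y permutes {1..n} \<and> y \<circ> x = x \<circ> y}"
    by simp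
  moreover have "id \<in> {y. y permutes {1..n} \<and> y \<circ> x = x \<circ> y}" by (simp add: permutes_id)
  moreover have "finite {y. y permutes {1..n} \<and> y \<circ> x = x \<circ> y}"
    by (rule finite_subset[OF _ finite_permutations[of "{1..n}"]]) auto
  ultimately have "{y. y permutes {1..n} \<and> y \<circ> x = inv' x \<circ> y} \<noteq> {}"
    by (metis (no_types, lifting) card.empty card_gt_0_iff empty_iff less_numeral_extra(3))
  then obtain y where y: "y permutes {1..n}" "y \<circ> x = inv' x \<circ> y" by auto
  have "inv' y \<circ> (inv' x \<circ> y) = x"
    unfolding y(2)[symmetric] by (simp add: comp_assoc[symmetric] permutes_inv_o(2)[OF y(1)])
  then show ?thesis using that[OF y(1)] by (simp add: comp_assoc)
qed

lemma sym_group_inv: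
  assumes "x permutes {1..n}"
  shows "inv\<^bsub>sym_group n\<^esub> x = inv' x"
proof (rule group.inv_equality[OF sym_group_is_group])
  show "inv' x \<otimes>\<^bsub>sym_group n\<^esub> x = \<one>\<^bsub>sym_group n\<^esub>"
    by (simp add: sym_group_mult sym_group_one permutes_inv_o(2)[OF assms])
qed (use assms permutes_inv[OF assms] in \<open>auto simp: sym_group_carrier\<close>)

lemma class_function_trace:
  assumes \<rho>: "matrix_representation (sym_group n) d \<rho>"
  shows "class_function n (\<lambda>x. mat_trace (\<rho> x))"
  unfolding class_function_def
proof (intro allI impI)
  fix x y :: "nat \<Rightarrow> nat" assume x: "x permutes {1..n}" and y: "y permutes {1..n}"
  let ?G = "sym_group n"
  note cl = matrix_representation_closed[OF sym_group_is_group \<rho>, unfolded sym_group_carrier]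
  note mult = matrix_representation_mult[OF sym_group_is_group \<rho>, unfolded sym_group_carrier sym_group_mult]
  have iy: "inv' y permutes {1..n}" using y by (rule permutes_inv)
  have ix: "inv' y \<circ> x permutes {1..n}" using x iy by (rule permutes_compose)
  have "\<rho> y * \<rho> (inv' y) = \<rho> id"
    by (simp add: mult[OF y iy, symmetric] permutes_inv_o(1)[OF y])
  also have "\<dots> = 1\<^sub>m d" using \<rho> by (simp add: matrix_representation_iff[OF sym_group_is_group] sym_group_one)
  finally have one: "\<rho> y * \<rho> (inv' y) = 1\<^sub>m d" .
  have "\<rho> (inv' y \<circ> x \<circ> y) = \<rho> (inv' y) * \<rho> x * \<rho> y"
    by (simp only: mult[OF ix y] mult[OF iy x])
  then show "mat_trace (\<rho> (inv' y \<circ> x \<circ> y)) = mat_trace (\<rho> x)"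
    using mat_trace_similar[OF cl[OF iy] cl[OF y] cl[OF x] one] by simp
qed

text \<open>The symmetric group permutes the points under colourings of fixed content; being fixed
  by \<open>x\<close> means being constant along the orbits of \<open>x\<close>.\<close>

lemma colouring_representation:
  obtains e \<pi> where "matrix_representation (sym_group n) e \<pi>"
    and "\<forall>x. x permutes {1..n} \<longrightarrow> mat_trace (\<pi> x) = of_nat (card (colourings N x {1..n} \<gamma> \<beta>))"
proof -
  define S where "S = {1..n}"
  define X where "X = {f \<in> S \<rightarrow>\<^sub>E {..<N}. \<forall>i<N. \<beta> i = \<gamma> i + card {a \<in> S. f a = i}}"
  \<comment> \<open>The inverse makes this a left action, and the restriction keeps the functions
    extensional.\<close>
  define act where "act x f = restrict (f \<circ> inv' x) S" for x and f :: "nat \<Rightarrow> nat"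
  have X: "finite X"
    unfolding X_def by (rule finite_subset[of _ "S \<rightarrow>\<^sub>E {..<N}"]) (auto simp: S_def intro: finite_PiE)
  have car: "x \<in> carrier (sym_group n) \<longleftrightarrow> x permutes S" for x by (simp add: S_def sym_group_carrier)
  have inS: "inv' x a \<in> S" if "x permutes S" "a \<in> S" for x a
    using permutes_in_image[OF permutes_inv[OF that(1)]] that(2) by simp
  have closed: "act x f \<in> X" if x: "x permutes S" and f: "f \<in> X" for x f
  proof -
    have "card {a \<in> S. act x f a = i} = card {a \<in> S. f a = i}" for i
    proof -
      have "{a \<in> S. act x f a = i} = x ` {a \<in> S. f a = i}"
      proof (intro subset_antisym subsetI)
        fix a assume "a \<in> {a \<in> S. act x f a = i}"
        then have "inv' x a \<in> {a \<in> S. f a = i}" "a = x (inv' x a)"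
          using inS[OF x] permutes_inverses(1)[OF x] by (auto simp: act_def)
        then show "a \<in> x ` {a \<in> S. f a = i}" by blast
      next
        fix a assume "a \<in> x ` {a \<in> S. f a = i}"
        then show "a \<in> {a \<in> S. act x f a = i}"
          using permutes_in_image[OF x] permutes_inverses(2)[OF x] by (auto simp: act_def)
      qed
      then show ?thesis using card_image[OF inj_on_subset[OF permutes_inj[OF x] subset_UNIV]] by simp
    qed
    moreover have "act x f \<in> S \<rightarrow>\<^sub>E {..<N}"
      using f inS[OF x] by (auto simp: act_def X_def)
    ultimately show ?thesis using f by (simp add: X_def)
  qed
  have mult: "act (x \<circ> y) f = act x (act y f)" if x: "x permutes S" and y: "y permutes S" for x y f
    using inS[OF x] by (auto simp: act_def fun_eq_iff o_inv_distrib[OF permutes_bij[OF x] permutes_bij[OF y]])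
  have one: "act id f = f" if "f \<in> X" for f
    using that by (auto simp: act_def X_def PiE_def extensional_restrict)
  obtain \<pi> where \<pi>: "matrix_representation (sym_group n) (card X) \<pi>"
    "\<And>x. x \<in> carrier (sym_group n) \<Longrightarrow> mat_trace (\<pi> x) = of_nat (card {f \<in> X. act x f = f})"
    by (rule permutation_representation[OF sym_group_is_group X, of n act])
       (simp_all add: car sym_group_mult sym_group_one closed mult one)
  have "{f \<in> X. act x f = f} = colourings N x S \<gamma> \<beta>" if x: "x permutes S" for x
  proof -
    have "act x f = f \<longleftrightarrow> (\<forall>a\<in>S. f (x a) = f a)" if f: "f \<in> X" for f
    proof
      assume e: "act x f = f"
      show "\<forall>a\<in>S. f (x a) = f a"
      proof
        fix a assume "a \<in> S"
        then show "f (x a) = f a"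
          using fun_cong[OF e, of "x a"] permutes_in_image[OF x, of a] permutes_inverses(2)[OF x, of a]
          by (simp add: act_def)
      qed
    next
      assume inv: "\<forall>a\<in>S. f (x a) = f a"
      show "act x f = f"
      proof
        fix a show "act x f a = f a"
        proof (cases "a \<in> S")
          case True
          then have "f (x (inv' x a)) = f (inv' x a)" using inv inS[OF x] by blast
          then show ?thesis using True permutes_inverses(1)[OF x, of a] by (simp add: act_def)
        next
          case False
          then show ?thesis using f by (auto simp: act_def X_def PiE_def extensional_def)
        qed
      qed
    qed
    then show ?thesis by (auto simp: X_def colourings_def)
  qed
  then show ?thesis using \<pi> unfolding S_def car by (intro that) (auto simp: S_def)
qed

text \<open>By the colouring expansion the coefficient is a signed sum of pairings of the character
  with permutation characters, each a natural multiple of \<open>n!\<close> before the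
  division.\<close>

lemma beta_coeff_integral:
  assumes \<rho>: "matrix_representation (sym_group n) d \<rho>" and \<beta>: "\<beta> \<in> beta_sets n"
  shows "\<exists>c::int. beta_coeff n (\<lambda>x. mat_trace (\<rho> x)) \<beta> = of_int c"
proof -
  let ?G = "{x. x permutes {1..n}}" and ?P = "{\<gamma>. \<gamma> permutes {..<n}}"
  let ?\<chi> = "\<lambda>x. mat_trace (\<rho> x)"
  have G: "finite (carrier (sym_group n))" "card (carrier (sym_group n)) = fact n" "carrier (sym_group n) = ?G"
    using finite_permutations[of "{1..n}"] card_permutations[of "{1..n}" n]
    by (auto simp: sym_group_def)
  have "\<exists>r::nat. (\<Sum>x\<in>?G. ?\<chi> x * of_nat (card (colourings n x {1..n} \<gamma> \<beta>))) = fact n * of_nat r" for \<gamma>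
  proof -
    obtain e \<pi> where \<pi>: "matrix_representation (sym_group n) e \<pi>"
      "\<forall>x. x permutes {1..n} \<longrightarrow> mat_trace (\<pi> x) = of_nat (card (colourings n x {1..n} \<gamma> \<beta>))"
      by (rule colouring_representation)
    show ?thesis
      using sum_character_mult[OF sym_group_is_group G(1) \<rho> \<pi>(1), unfolded G(2)] \<pi>(2)
      by (simp add: G(3))
  qed
  then obtain r :: "(nat \<Rightarrow> nat) \<Rightarrow> nat" where
    r: "\<And>\<gamma>. (\<Sum>x\<in>?G. ?\<chi> x * of_nat (card (colourings n x {1..n} \<gamma> \<beta>))) = fact n * of_nat (r \<gamma>)"
    by metis
  have b: "sym_beta n x \<beta> = (\<Sum>\<gamma>\<in>?P. sign \<gamma> * int (card (colourings n x {1..n} \<gamma> \<beta>)))"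
    if "x permutes {1..n}" for x
    using \<beta> permutes_image_subset[OF that]
    by (intro beta_char_eq_colourings[OF permutation_sym[OF that]]) (auto simp: bead_configs_def)
  have "(\<Sum>x\<in>?G. ?\<chi> x * of_int (sym_beta n x \<beta>))
      = (\<Sum>x\<in>?G. \<Sum>\<gamma>\<in>?P. of_int (sign \<gamma>) * (?\<chi> x * of_nat (card (colourings n x {1..n} \<gamma> \<beta>))))"
  proof (rule sum.cong[OF refl])
    fix x assume "x \<in> ?G"
    then have x: "x permutes {1..n}" by simp
    show "?\<chi> x * of_int (sym_beta n x \<beta>)
      = (\<Sum>\<gamma>\<in>?P. of_int (sign \<gamma>) * (?\<chi> x * of_nat (card (colourings n x {1..n} \<gamma> \<beta>))))"
      unfolding b[OF x] by (simp add: sum_distrib_left mult_ac)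
  qed
  also have "\<dots> = (\<Sum>\<gamma>\<in>?P. of_int (sign \<gamma>) * (fact n * of_nat (r \<gamma>)))"
    by (subst sum.swap) (simp only: sum_distrib_left[symmetric] r)
  also have "\<dots> = fact n * of_int (\<Sum>\<gamma>\<in>?P. sign \<gamma> * int (r \<gamma>))"
    by (simp add: sum_distrib_left mult_ac)
  finally have "beta_coeff n ?\<chi> \<beta> = of_int (\<Sum>\<gamma>\<in>?P. sign \<gamma> * int (r \<gamma>))"
    unfolding beta_coeff_def by simp
  then show ?thesis by blast
qed

lemma beta_coeff_alternating:
  assumes "\<tau> permutes {..<n}"
  shows "beta_coeff n f (\<beta> \<circ> \<tau>) = of_int (sign \<tau>) * beta_coeff n f \<beta>"
proof -
  have "beta_char n M (\<beta> \<circ> \<tau>) = sign \<tau> * beta_char n M \<beta>" for M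
    using alternating_beta_char assms unfolding alternating_def by blast
  then show ?thesis by (simp add: beta_coeff_def sum_distrib_left mult_ac)
qed

text \<open>The squares of the integral coefficients \<open>c\<close> sum to \<open>n!\<close>, and
  the \<open>n!\<close> reorderings of \<open>\<beta>\<close> already contribute \<open>n!\<close>
  times the square of \<open>c \<beta>\<close>. Hence \<open>c \<beta>\<close> is a sign, every
  coefficient outside this class vanishes, and the inversion formula has a single class
  left.\<close>

lemma irreducible_character_eq_beta_char:
  assumes irr: "irreducible_representation (sym_group n) d \<rho>"
    and \<beta>: "\<beta> \<in> beta_sets n" "beta_coeff n (\<lambda>x. mat_trace (\<rho> x)) \<beta> \<noteq> 0"
    and g: "g permutes {1..n}"
  shows "cmod (mat_trace (\<rho> g)) = real_of_int \<bar>sym_beta n g \<beta>\<bar>"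
proof -
  let ?\<chi> = "\<lambda>x. mat_trace (\<rho> x)" and ?P = "{\<tau>. \<tau> permutes {..<n}}"
  have \<rho>: "matrix_representation (sym_group n) d \<rho>" using irr by (simp add: irreducible_representation_def)
  note cf = class_function_trace[OF \<rho>]
  have G: "finite (carrier (sym_group n))" "card (carrier (sym_group n)) = fact n"
    "carrier (sym_group n) = {x. x permutes {1..n}}"
    using finite_permutations[of "{1..n}"] card_permutations[of "{1..n}" n]
    by (auto simp: sym_group_def)
  have "\<exists>c::int. beta_coeff n ?\<chi> \<beta> = of_int c" if "\<beta> \<in> beta_sets n" for \<beta>
    using beta_coeff_integral[OF \<rho> that] .
  then obtain c :: "(nat \<Rightarrow> nat) \<Rightarrow> int" where c: "\<And>\<beta>. \<beta> \<in> beta_sets n \<Longrightarrow> beta_coeff n ?\<chi> \<beta> = of_int (c \<beta>)"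
    by metis
  \<comment> \<open>Conjugacy of \<open>x\<close> with its inverse turns the Schur relation into the
    sum of squares that Parseval evaluates.\<close>
  have inv: "?\<chi> (inv' x) = ?\<chi> x" if x: "x permutes {1..n}" for x
  proof -
    obtain y where y: "y permutes {1..n}" "inv' y \<circ> inv' x \<circ> y = x" by (rule ex_conjugate_inverse[OF x])
    have "?\<chi> (inv' y \<circ> inv' x \<circ> y) = ?\<chi> (inv' x)"
      using cf y(1) permutes_inv[OF x] unfolding class_function_def by blast
    then show ?thesis by (simp add: y(2))
  qed
  have "of_int (\<Sum>\<beta>\<in>beta_sets n. c \<beta> * c \<beta>) = (\<Sum>\<beta>\<in>beta_sets n. beta_coeff n ?\<chi> \<beta> * beta_coeff n ?\<chi> \<beta>)"
    by (simp add: c)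
  also have "\<dots> = (\<Sum>x | x permutes {1..n}. ?\<chi> x * ?\<chi> x)" by (rule beta_coeff_parseval[OF cf])
  also have "\<dots> = (\<Sum>x\<in>carrier (sym_group n). ?\<chi> x * ?\<chi> (inv\<^bsub>sym_group n\<^esub> x))"
    unfolding G(3) by (intro sum.cong refl) (simp add: sym_group_inv inv)
  also have "\<dots> = of_nat (fact n)" using sum_character_inverse[OF irr sym_group_is_group G(1)] G(2) by simp
  finally have "of_int (\<Sum>\<beta>\<in>beta_sets n. c \<beta> * c \<beta>) = (of_int (fact n) :: complex)" by simp
  then have norm: "(\<Sum>\<beta>\<in>beta_sets n. c \<beta> * c \<beta>) = fact n" by (simp only: of_int_eq_iff)
  \<comment> \<open>A nonzero coefficient needs a nonzero value of \<open>sym_beta\<close>, which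
    forces distinct bead positions; so the reorderings of \<open>\<beta>\<close> are pairwise
    different.\<close>
  obtain x where "sym_beta n x \<beta> \<noteq> 0"
    using \<beta>(2) unfolding beta_coeff_def by (metis (no_types, lifting) div_0 mult_zero_right of_int_0 sum.neutral)
  then have inj: "inj_on \<beta> {..<n}" by (rule alternating_inj[OF alternating_beta_char])
  define Q where "Q = (\<lambda>\<tau>. \<beta> \<circ> \<tau>) ` ?P"
  have injQ: "inj_on (\<lambda>\<tau>. \<beta> \<circ> \<tau>) ?P"
  proof (rule inj_onI, rule ext)
    fix \<tau> \<tau>' i assume t: "\<tau> \<in> ?P" "\<tau>' \<in> ?P" "\<beta> \<circ> \<tau> = \<beta> \<circ> \<tau>'"
    show "\<tau> i = \<tau>' i"
    proof (cases "i < n")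
      case True
      then have "\<tau> i \<in> {..<n}" "\<tau>' i \<in> {..<n}" using t permutes_in_image by (metis lessThan_iff mem_Collect_eq)+
      then show ?thesis using inj fun_cong[OF t(3), of i] by (auto dest: inj_onD)
    next
      case False
      then show ?thesis using t by (simp add: permutes_not_in)
    qed
  qed
  have Q: "Q \<subseteq> beta_sets n"
  proof
    fix \<beta>' assume "\<beta>' \<in> Q"
    then obtain \<tau> where \<tau>: "\<tau> permutes {..<n}" "\<beta>' = \<beta> \<circ> \<tau>" by (auto simp: Q_def)
    have "sum \<beta>' {..<n} = sum \<beta> {..<n}" unfolding \<tau>(2) by (rule sum.permute[OF \<tau>(1), symmetric])
    then show "\<beta>' \<in> beta_sets n"
      using \<beta>(1) \<tau> permutes_not_in[OF \<tau>(1)] by (auto simp: bead_configs_def)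
  qed
  have cQ: "c (\<beta> \<circ> \<tau>) = sign \<tau> * c \<beta>" if "\<tau> permutes {..<n}" for \<tau>
  proof -
    have "\<beta> \<circ> \<tau> \<in> beta_sets n" using Q that by (auto simp: Q_def)
    then have "(of_int (c (\<beta> \<circ> \<tau>)) :: complex) = of_int (sign \<tau> * c \<beta>)"
      using c[of "\<beta> \<circ> \<tau>"] c[OF \<beta>(1)] beta_coeff_alternating[OF that, of ?\<chi> \<beta>] by simp
    then show ?thesis by (simp only: of_int_eq_iff)
  qed
  have sgn: "sign \<tau> * sign \<tau> = 1" for \<tau> :: "nat \<Rightarrow> nat" by (simp add: sign_def)
  have cardP: "card ?P = fact n" using card_permutations[of "{..<n}" n] by simp
  have sumQ: "sum f Q = (\<Sum>\<tau>\<in>?P. f (\<beta> \<circ> \<tau>))" for f :: "_ \<Rightarrow> 'x :: comm_monoid_add"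
    unfolding Q_def using injQ by (simp add: sum.reindex)
  have "(\<Sum>\<beta>\<in>Q. c \<beta> * c \<beta>) = (\<Sum>\<tau>\<in>?P. (sign \<tau> * sign \<tau>) * (c \<beta> * c \<beta>))"
    unfolding sumQ by (intro sum.cong refl) (simp add: cQ)
  then have normQ: "(\<Sum>\<beta>\<in>Q. c \<beta> * c \<beta>) = fact n * (c \<beta> * c \<beta>)" by (simp add: sgn cardP)
  have split: "(\<Sum>\<beta>\<in>beta_sets n. c \<beta> * c \<beta>) = (\<Sum>\<beta>\<in>beta_sets n - Q. c \<beta> * c \<beta>) + (\<Sum>\<beta>\<in>Q. c \<beta> * c \<beta>)"
    by (rule sum.subset_diff[OF Q finite_bead_configs])
  have nonneg: "(\<Sum>\<beta>\<in>beta_sets n - Q. c \<beta> * c \<beta>) \<ge> 0" by (intro sum_nonneg) simp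
  have "c \<beta> \<noteq> 0" using c[OF \<beta>(1)] \<beta>(2) by auto
  then have "c \<beta> * c \<beta> \<ge> 1" by (metis int_one_le_iff_zero_less not_real_square_gt_zero zero_less_mult_iff linorder_neqE_linordered_idom)
  moreover have "fact n * (c \<beta> * c \<beta>) \<le> fact n * 1" using norm normQ split nonneg by linarith
  then have "c \<beta> * c \<beta> \<le> 1" by (simp only: mult_le_cancel_left_pos[OF fact_gt_zero])
  ultimately have c1: "c \<beta> * c \<beta> = 1" by simp
  then have "(\<Sum>\<beta>\<in>beta_sets n - Q. c \<beta> * c \<beta>) = 0" using norm normQ split by simp
  then have rest: "c \<beta>' = 0" if "\<beta>' \<in> beta_sets n - Q" for \<beta>'
    using that sum_nonneg_eq_0_iff[of "beta_sets n - Q" "\<lambda>\<beta>. c \<beta> * c \<beta>"] finite_bead_configs by simp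
  have alt: "sym_beta n g (\<beta> \<circ> \<tau>) = sign \<tau> * sym_beta n g \<beta>" if "\<tau> permutes {..<n}" for \<tau>
    using alternating_beta_char that unfolding alternating_def by blast
  have "fact n * ?\<chi> g = (\<Sum>\<beta>\<in>beta_sets n. beta_coeff n ?\<chi> \<beta> * of_int (sym_beta n g \<beta>))"
    by (rule beta_coeff_inversion[OF cf g, symmetric])
  also have "\<dots> = (\<Sum>\<beta>\<in>Q. of_int (c \<beta> * sym_beta n g \<beta>))"
    using Q rest by (intro sum.mono_neutral_cong_right finite_bead_configs) (auto simp: c)
  \<comment> \<open>Reordering multiplies both the coefficient and the function by
    \<open>sign \<tau>\<close>, so all \<open>n!\<close> terms agree.\<close>
  also have "\<dots> = (\<Sum>\<tau>\<in>?P. of_int ((sign \<tau> * sign \<tau>) * (c \<beta> * sym_beta n g \<beta>)))"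
    unfolding sumQ
  proof (rule sum.cong[OF refl])
    fix \<tau> assume "\<tau> \<in> ?P"
    then have "c (\<beta> \<circ> \<tau>) * sym_beta n g (\<beta> \<circ> \<tau>) = (sign \<tau> * sign \<tau>) * (c \<beta> * sym_beta n g \<beta>)"
      by (simp only: mem_Collect_eq cQ alt mult_ac)
    then show "of_int (c (\<beta> \<circ> \<tau>) * sym_beta n g (\<beta> \<circ> \<tau>))
        = (of_int ((sign \<tau> * sign \<tau>) * (c \<beta> * sym_beta n g \<beta>)) :: complex)"
      by (simp only:)
  qed
  also have "\<dots> = fact n * of_int (c \<beta> * sym_beta n g \<beta>)"
    unfolding sgn by (simp add: cardP)
  finally have "?\<chi> g = of_int (c \<beta> * sym_beta n g \<beta>)" by simp
  then have "cmod (?\<chi> g) = real_of_int \<bar>c \<beta> * sym_beta n g \<beta>\<bar>" by (simp only: norm_of_int)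
  moreover have "\<bar>c \<beta>\<bar> = 1" using c1 by (metis abs_mult abs_one abs_mult_self_eq zmult_eq_1_iff abs_eq_iff)
  ultimately show ?thesis by (simp add: abs_mult)
qed

text \<open>Otherwise the inversion formula at the identity would give dimension zero.\<close>

lemma ex_beta_coeff_nonzero:
  assumes irr: "irreducible_representation (sym_group n) d \<rho>"
  obtains \<beta> where "\<beta> \<in> beta_sets n" "beta_coeff n (\<lambda>x. mat_trace (\<rho> x)) \<beta> \<noteq> 0"
proof -
  have \<rho>: "matrix_representation (sym_group n) d \<rho>" and d: "d > 0"
    using irr by (auto simp: irreducible_representation_def)
  have "mat_trace (\<rho> id) = of_nat d"
    using \<rho> by (simp add: matrix_representation_iff[OF sym_group_is_group] sym_group_one mat_trace_def)
  then have "(\<Sum>\<beta>\<in>beta_sets n. beta_coeff n (\<lambda>x. mat_trace (\<rho> x)) \<beta> * of_int (sym_beta n id \<beta>)) \<noteq> 0"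
    using beta_coeff_inversion[OF class_function_trace[OF \<rho>] permutes_id] d by simp
  then show ?thesis using that by (metis (no_types, lifting) mult_zero_left sum.neutral)
qed

text \<open>The group orbit also uses negative powers; for a permutation of a finite set the forward
  iterates already reach those points.\<close>

lemma perm_orbits_eq:
  assumes g: "g permutes {1..n}"
  shows "perm_orbits n g = Orbits.orbit g ` {1..n}"
proof -
  have gc: "g \<in> carrier (sym_group n)" using g by (simp add: sym_group_carrier)
  interpret group "sym_group n" by (rule sym_group_is_group)
  have pow: "g [^]\<^bsub>sym_group n\<^esub> (i :: nat) = g ^^ i" for i
    by (induction i) (simp_all add: sym_group_one sym_group_mult funpow_swap1 fun_eq_iff)
  have carr: "carrier (subgroup_generated (sym_group n) {g}) = {g [^]\<^bsub>sym_group n\<^esub> (i :: int) | i. True}"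
    using gc by (auto simp: carrier_subgroup_generated_by_singleton)
  have "{h x | h. h \<in> carrier (subgroup_generated (sym_group n) {g})} = Orbits.orbit g x" for x
  proof -
    have perm: "permutation g" using g by (rule permutation_sym)
    have orb: "Orbits.orbit g x = {(g ^^ i) x | i. True}" for x by (rule orbit_altdef_permutation[OF perm])
    have "(g [^]\<^bsub>sym_group n\<^esub> (i :: int)) x \<in> Orbits.orbit g x" for i
    proof (cases i)
      case (nonneg m)
      then show ?thesis by (auto simp: orb int_pow_int pow)
    next
      case (neg m)
      have "g [^]\<^bsub>sym_group n\<^esub> i = inv\<^bsub>sym_group n\<^esub> (g ^^ Suc m)"
        unfolding neg int_pow_neg_int[OF gc] pow ..
      also have "\<dots> = inv' (g ^^ Suc m)"
        by (rule sym_group_inv[OF permutes_funpow[OF g]])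
      finally have e: "g [^]\<^bsub>sym_group n\<^esub> i = inv' (g ^^ Suc m)" .
      \<comment> \<open>\<open>x\<close> is a forward iterate of \<open>y\<close>, and lying in the
        same orbit is symmetric.\<close>
      define y where "y = inv' (g ^^ Suc m) x"
      have "(g ^^ Suc m) y = x"
        unfolding y_def using permutes_inverses(1)[OF permutes_funpow[OF g]] .
      moreover have "(g ^^ Suc m) y \<in> Orbits.orbit g y" unfolding orbit_altdef by blast
      ultimately have "x \<in> Orbits.orbit g y" by simp
      then have "y \<in> Orbits.orbit g x"
        using orbit_eq[OF perm, of x y] permutation_self_in_orbit[OF perm, of y] by simp
      then show ?thesis by (simp add: e y_def)
    qed
    moreover have "(g ^^ i) x \<in> {h x | h. h \<in> carrier (subgroup_generated (sym_group n) {g})}" for i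
      unfolding carr by (auto intro!: exI[of _ "g ^^ i"] exI[of _ "int i"] simp: int_pow_int pow)
    ultimately show ?thesis unfolding carr orb by auto
  qed
  then show ?thesis
    unfolding perm_orbits_def Group_Action.orbits_def Group_Action.orbit_def by auto
qed

text \<open>Induction on the dimension: the coefficient is additive over the two blocks of a
  reducible representation, so one of them keeps it nonzero.\<close>

lemma ex_irreducible_beta_coeff:
  assumes \<rho>: "matrix_representation (sym_group n) d \<rho>"
    and nz: "beta_coeff n (\<lambda>x. mat_trace (\<rho> x)) \<beta> \<noteq> 0"
  obtains e \<sigma> where "irreducible_representation (sym_group n) e \<sigma>"
    and "beta_coeff n (\<lambda>x. mat_trace (\<sigma> x)) \<beta> \<noteq> 0"
proof -
  have "\<exists>e \<sigma>. irreducible_representation (sym_group n) e \<sigma> \<and> beta_coeff n (\<lambda>x. mat_trace (\<sigma> x)) \<beta> \<noteq> 0"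
    using assms
  proof (induction d arbitrary: \<rho> rule: less_induct)
    case (less d)
    show ?case
    proof (cases "irreducible_representation (sym_group n) d \<rho>")
      case True
      then show ?thesis using less.prems by blast
    next
      case False
      have "d > 0"
      proof (rule ccontr)
        assume "\<not> d > 0"
        then have "mat_trace (\<rho> x) = 0" if "x permutes {1..n}" for x
          using matrix_representation_closed[OF sym_group_is_group less.prems(1), of x] that
          by (simp add: mat_trace_def sym_group_carrier)
        then show False using less.prems(2) by (simp add: beta_coeff_def)
      qed
      then obtain W where W: "invariant_subspace (sym_group n) d \<rho> W" "W \<noteq> {0\<^sub>v d}" "W \<noteq> carrier_vec d"
        using False less.prems(1) by (auto simp: irreducible_representation_def)
      obtain r \<rho>1 \<rho>2 where r: "r < d" "0 < r"
        and R: "matrix_representation (sym_group n) r \<rho>1" "matrix_representation (sym_group n) (d - r) \<rho>2"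
        and tr: "\<forall>x\<in>carrier (sym_group n). mat_trace (\<rho> x) = mat_trace (\<rho>1 x) + mat_trace (\<rho>2 x)"
        by (rule reducible_representation_splits[OF sym_group_is_group less.prems(1) W])
      have "beta_coeff n (\<lambda>x. mat_trace (\<rho> x)) \<beta>
          = beta_coeff n (\<lambda>x. mat_trace (\<rho>1 x)) \<beta> + beta_coeff n (\<lambda>x. mat_trace (\<rho>2 x)) \<beta>"
        unfolding beta_coeff_def add_divide_distrib[symmetric] sum.distrib[symmetric]
        using tr by (intro arg_cong2[where f = "(/)"] sum.cong refl) (simp add: sym_group_carrier distrib_right)
      then have "beta_coeff n (\<lambda>x. mat_trace (\<rho>1 x)) \<beta> \<noteq> 0 \<or> beta_coeff n (\<lambda>x. mat_trace (\<rho>2 x)) \<beta> \<noteq> 0"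
        using less.prems(2) by auto
      moreover have "d - r < d" using r by simp
      ultimately show ?thesis using less.IH[OF r(1) R(1)] less.IH[OF _ R(2)] by blast
    qed
  qed
  then show ?thesis using that by blast
qed

text \<open>A function \<open>sym_beta n _ \<beta>\<close> that is not identically zero has positive
  norm, so by the colouring expansion some colouring character pairs nontrivially with it. An
  irreducible constituent inherits a nonzero coefficient and must agree with this function in
  absolute value.\<close>

lemma ex_irreducible_for_beta_set:
  assumes g: "g permutes {1..n}" and nz: "sym_beta n g \<beta> \<noteq> 0"
  obtains d \<rho> where "irreducible_representation (sym_group n) d \<rho>"
    and "\<forall>x. x permutes {1..n} \<longrightarrow> cmod (mat_trace (\<rho> x)) = real_of_int \<bar>sym_beta n x \<beta>\<bar>"
proof -
  let ?G = "{x. x permutes {1..n}}" and ?P = "{\<gamma>. \<gamma> permutes {..<n}}"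
  have \<beta>: "\<beta> \<in> beta_sets n"
    using beta_char_in_bead_configs[OF nz] sum_mset_cyc_type[OF permutation_sym[OF g] _ permutes_image_subset[OF g]]
    by simp
  have finG: "finite ?G" using finite_permutations[of "{1..n}"] by simp
  have b: "sym_beta n x \<beta> = (\<Sum>\<gamma>\<in>?P. sign \<gamma> * int (card (colourings n x {1..n} \<gamma> \<beta>)))"
    if "x permutes {1..n}" for x
    using \<beta> permutes_image_subset[OF that]
    by (intro beta_char_eq_colourings[OF permutation_sym[OF that]]) (auto simp: bead_configs_def)
  have "(\<Sum>x\<in>?G. sym_beta n x \<beta> * sym_beta n x \<beta>) > 0"
    using finG g nz by (intro sum_pos2[of _ g]) (auto simp: zero_less_mult_iff)
  also have "(\<Sum>x\<in>?G. sym_beta n x \<beta> * sym_beta n x \<beta>)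
      = (\<Sum>x\<in>?G. \<Sum>\<gamma>\<in>?P. sign \<gamma> * (int (card (colourings n x {1..n} \<gamma> \<beta>)) * sym_beta n x \<beta>))"
  proof (rule sum.cong[OF refl])
    fix x assume "x \<in> ?G"
    then have "sym_beta n x \<beta> * sym_beta n x \<beta>
        = (\<Sum>\<gamma>\<in>?P. sign \<gamma> * int (card (colourings n x {1..n} \<gamma> \<beta>))) * sym_beta n x \<beta>"
      using b by simp
    then show "sym_beta n x \<beta> * sym_beta n x \<beta>
        = (\<Sum>\<gamma>\<in>?P. sign \<gamma> * (int (card (colourings n x {1..n} \<gamma> \<beta>)) * sym_beta n x \<beta>))"
      by (simp add: sum_distrib_right mult.assoc)
  qed
  also have "\<dots> = (\<Sum>\<gamma>\<in>?P. sign \<gamma> * (\<Sum>x\<in>?G. int (card (colourings n x {1..n} \<gamma> \<beta>)) * sym_beta n x \<beta>))"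
    by (subst sum.swap) (simp add: sum_distrib_left)
  finally obtain \<gamma> where \<gamma>: "(\<Sum>x\<in>?G. int (card (colourings n x {1..n} \<gamma> \<beta>)) * sym_beta n x \<beta>) \<noteq> 0"
    by (metis (no_types, lifting) less_irrefl mult_zero_right sum.neutral)
  obtain e \<pi> where \<pi>: "matrix_representation (sym_group n) e \<pi>"
    "\<forall>x. x permutes {1..n} \<longrightarrow> mat_trace (\<pi> x) = of_nat (card (colourings n x {1..n} \<gamma> \<beta>))"
    by (rule colouring_representation)
  have "beta_coeff n (\<lambda>x. mat_trace (\<pi> x)) \<beta>
      = of_int (\<Sum>x\<in>?G. int (card (colourings n x {1..n} \<gamma> \<beta>)) * sym_beta n x \<beta>) / fact n"
    by (simp add: beta_coeff_def \<pi>(2))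
  then have "beta_coeff n (\<lambda>x. mat_trace (\<pi> x)) \<beta> \<noteq> 0"
    using \<gamma> by (simp only: divide_eq_0_iff of_int_eq_0_iff fact_nonzero) simp
  from ex_irreducible_beta_coeff[OF \<pi>(1) this] obtain d \<rho> where
    "irreducible_representation (sym_group n) d \<rho>" "beta_coeff n (\<lambda>x. mat_trace (\<rho> x)) \<beta> \<noteq> 0" .
  then show ?thesis using irreducible_character_eq_beta_char \<beta> by (intro that[of d \<rho>]) auto
qed

theorem theorem3:
  shows "(\<forall>(k::nat) (n::nat) (g::nat \<Rightarrow> nat) (\<chi>::(nat \<Rightarrow> nat) \<Rightarrow> complex).
            1 \<le> k \<longrightarrow> k \<le> n \<longrightarrow>
            g \<in> carrier (sym_group n) \<longrightarrow>
            card (perm_orbits n g) = k \<longrightarrow>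
            irreducible_character (sym_group n) \<chi> \<longrightarrow>
            (\<exists>i\<in>{1..n}. g i = i) \<longrightarrow>
            cmod (\<chi> g) \<le> fact (k - 1)) \<and>
         (\<forall>k::nat. 1 \<le> k \<longrightarrow>
            (\<exists>(n::nat) (g::nat \<Rightarrow> nat) (\<chi>::(nat \<Rightarrow> nat) \<Rightarrow> complex).
               k \<le> n \<and>
               g \<in> carrier (sym_group n) \<and>
               card (perm_orbits n g) = k \<and>
               (\<exists>B\<in>perm_orbits n g. card B = 1) \<and>
               irreducible_character (sym_group n) \<chi> \<and>
               cmod (\<chi> g) = fact (k - 1)))"
proof (intro conjI allI impI)
  fix k n :: nat and g :: "nat \<Rightarrow> nat" and \<chi> :: "(nat \<Rightarrow> nat) \<Rightarrow> complex"
  assume g: "g \<in> carrier (sym_group n)" and k: "card (perm_orbits n g) = k"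
    and \<chi>: "irreducible_character (sym_group n) \<chi>" and fixed: "\<exists>i\<in>{1..n}. g i = i"
  have gp: "g permutes {1..n}" using g by (simp add: sym_group_carrier)
  from \<chi> obtain d \<rho> where irr: "irreducible_representation (sym_group n) d \<rho>"
    and tr: "\<forall>x\<in>carrier (sym_group n). \<chi> x = mat_trace (\<rho> x)"
    by (auto simp: irreducible_character_def)
  obtain \<beta> where \<beta>: "\<beta> \<in> beta_sets n" "beta_coeff n (\<lambda>x. mat_trace (\<rho> x)) \<beta> \<noteq> 0"
    by (rule ex_beta_coeff_nonzero[OF irr])
  from fixed obtain p where p: "p \<in> {1..n}" "g p = p" by auto
  have "\<bar>sym_beta n g \<beta>\<bar> \<le> fact (k - 1)"
    using beta_char_bound[OF permutation_sym[OF gp] _ permutes_image_subset[OF gp] p] k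
    by (simp add: perm_orbits_eq[OF gp])
  then have "real_of_int \<bar>sym_beta n g \<beta>\<bar> \<le> real_of_int (fact (k - 1))" by (simp only: of_int_le_iff)
  then show "cmod (\<chi> g) \<le> fact (k - 1)"
    using irreducible_character_eq_beta_char[OF irr \<beta> gp] tr g by simp
next
  fix k :: nat assume k: "1 \<le> k"
  \<comment> \<open>This \<open>n\<close> is both the degree and the number of beads;
    \<open>k \<le> n\<close> leaves room for the \<open>k\<close> displaced beads of the
    square.\<close>
  define n where "n = k * k"
  define M where "M = add_mset 1 (replicate_mset (k - 1) (k + 1))"
  have M0: "0 \<notin># M" by (auto simp: M_def in_replicate_mset)
  have Mn: "sum_mset M = n"
  proof -
    obtain j where "k = Suc j" using k by (cases k) auto
    then show ?thesis by (simp add: M_def n_def)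
  qed
  obtain g where g: "g permutes {1..n}" "cyc_type g {1..n} = M"
    using ex_permutation_with_cyc_type[OF M0] unfolding Mn by blast
  have kn: "k \<le> n" using k by (simp add: n_def)
  have sq: "\<bar>sym_beta n g (square_bead n k {})\<bar> = fact (k - 1)"
    using beta_char_square[OF _ kn] k unfolding g(2) M_def by (simp only: less_eq_Suc_le One_nat_def)
  then have "sym_beta n g (square_bead n k {}) \<noteq> 0" by auto
  then obtain d \<rho> where irr: "irreducible_representation (sym_group n) d \<rho>"
    and val: "\<forall>x. x permutes {1..n} \<longrightarrow>
      cmod (mat_trace (\<rho> x)) = real_of_int \<bar>sym_beta n x (square_bead n k {})\<bar>"
    by (rule ex_irreducible_for_beta_set[OF g(1)])
  have "cmod (mat_trace (\<rho> g)) = real_of_int \<bar>sym_beta n g (square_bead n k {})\<bar>"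
    using val g(1) by blast
  then have "cmod (mat_trace (\<rho> g)) = fact (k - 1)" unfolding sq by simp
  moreover have "irreducible_character (sym_group n) (\<lambda>x. mat_trace (\<rho> x))"
    using irr by (auto simp: irreducible_character_def)
  moreover have "card (perm_orbits n g) = k"
  proof -
    have "size (cyc_type g {1..n}) = card (Orbits.orbit g ` {1..n})" by (simp add: cyc_type_def)
    then have "card (perm_orbits n g) = size M" by (simp only: perm_orbits_eq[OF g(1)] g(2))
    then show ?thesis using k by (simp add: M_def)
  qed
  moreover have "\<exists>B\<in>perm_orbits n g. card B = 1"
  proof -
    have "1 \<in># cyc_type g {1..n}" unfolding g(2) M_def by simp
    then show ?thesis unfolding perm_orbits_eq[OF g(1)] by (auto simp: cyc_type_def)
  qed
  ultimately show "\<exists>n g \<chi>. k \<le> n \<and> g \<in> carrier (sym_group n) \<and> card (perm_orbits n g) = k \<and>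
      (\<exists>B\<in>perm_orbits n g. card B = 1) \<and> irreducible_character (sym_group n) \<chi> \<and> cmod (\<chi> g) = fact (k - 1)"
    using kn g(1) by (intro exI[of _ n] exI[of _ g] exI[of _ "\<lambda>x. mat_trace (\<rho> x)"]) (simp add: sym_group_carrier)
qed

end
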